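(* Let $\Sigma\subset S^3$ be a compact smooth embedded surface, dividing $S^3$ into $\Omega_1,\Omega_2$, with $\mathbf n$ the unit normal pointing into $\Omega_1$, and suppose $\Sigma$ is mean convex with respect to $\mathbf n$, i.e. $H\ge 0$ on $\Sigma$. Let $r_0=\min_{q\in\Sigma} r(q)$ be the normal injectivity radius of $\Sigma$ with respect to $\Omega_1$. Then $$r_0=\cot^{-1}\big((H+\lambda)_{\max}\big)\le \frac{\pi}{2},$$ where $(H+\lambda)_{\max}=\max_\Sigma (H+\lambda)$. Moreover, if the genus $g$ of $\Sigma$ satisfies $g\ge1$, then $r_0\le \frac{\pi}{4}$.
   Context: $S^3\subset\mathbb{R}^4$ is the round unit sphere with distance $\rho_{S^3}$. For $q\in\Sigma$, $r(q)=\sup\{d\ge0:\ \rho_{S^3}(\exp_q(d\,\mathbf n(q)),\Sigma)=d\}$ (the cut distance of $q$ in $\Omega_1$). $H$ is the mean curvature with respect to $\mathbf n$ (average of principal curvatures) and $\lambda=\sqrt{H^2+1-K}\ge0$, $K$ the Gaussian curvature, so the principal curvatures are $H\pm\lambda$. $\cot^{-1}$ takes values in $(0,\pi)$. *)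

theory Defs
  imports "HOL-Analysis.Analysis" "HOL-Homology.Homology"
begin

fun Ck_on :: "nat \<Rightarrow> ('a::euclidean_space) set \<Rightarrow> ('a \<Rightarrow> 'b::euclidean_space) \<Rightarrow> bool" where
  "Ck_on 0 U f = continuous_on U f"
| "Ck_on (Suc k) U f =
     (continuous_on U f \<and> (\<forall>x\<in>U. f differentiable (at x)) \<and>
      (\<forall>v. Ck_on k U (\<lambda>x. frechet_derivative f (at x) v)))"

definition smooth_on :: "('a::euclidean_space) set \<Rightarrow> ('a \<Rightarrow> 'b::euclidean_space) \<Rightarrow> bool" where
  "smooth_on U f \<longleftrightarrow> (\<forall>k. Ck_on k U f)"

definition chart :: "(real^4) set \<Rightarrow> (real^2) set \<Rightarrow> (real^2 \<Rightarrow> real^4) \<Rightarrow> bool" where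
  "chart S V \<phi> \<longleftrightarrow> open V \<and> smooth_on V \<phi> \<and> inj_on \<phi> V \<and> \<phi> ` V \<subseteq> S \<and>
     openin (top_of_set S) (\<phi> ` V) \<and> continuous_on (\<phi> ` V) (inv_into V \<phi>) \<and>
     (\<forall>x\<in>V. inj (frechet_derivative \<phi> (at x)))"

definition embedded_surface_S3 :: "(real^4) set \<Rightarrow> bool" where
  "embedded_surface_S3 S \<longleftrightarrow> S \<subseteq> sphere 0 1 \<and>
     (\<forall>p\<in>S. \<exists>V \<phi>. chart S V \<phi> \<and> p \<in> \<phi> ` V)"

definition smooth_map_on_surface :: "(real^4) set \<Rightarrow> (real^4 \<Rightarrow> real^4) \<Rightarrow> bool" where
  "smooth_map_on_surface S f \<longleftrightarrow> (\<forall>V \<phi>. chart S V \<phi> \<longrightarrow> smooth_on V (f \<circ> \<phi>))"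

definition tangent_space :: "(real^4) set \<Rightarrow> real^4 \<Rightarrow> (real^4) set" where
  "tangent_space S q = {v. \<exists>V \<phi> x. chart S V \<phi> \<and> x \<in> V \<and> \<phi> x = q \<and>
                             v \<in> range (frechet_derivative \<phi> (at x))}"

definition dN :: "(real^4) set \<Rightarrow> (real^4 \<Rightarrow> real^4) \<Rightarrow> real^4 \<Rightarrow> real^4 \<Rightarrow> real^4" where
  "dN S n q v = (THE w. \<forall>V \<phi> x u. chart S V \<phi> \<and> x \<in> V \<and> \<phi> x = q \<and>
                    frechet_derivative \<phi> (at x) u = v \<longrightarrow>
                    frechet_derivative (n \<circ> \<phi>) (at x) u = w)"

text \<open>Second fundamental form w.r.t. n (shape operator A = - dn); positive principal
  curvature means bending towards n.\<close>
definition second_ff :: "(real^4) set \<Rightarrow> (real^4 \<Rightarrow> real^4) \<Rightarrow> real^4 \<Rightarrow> real^4 \<Rightarrow> real^4 \<Rightarrow> real" where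
  "second_ff S n q u v = - (u \<bullet> dN S n q v)"

definition tangent_onb :: "(real^4) set \<Rightarrow> real^4 \<Rightarrow> (real^4) \<times> (real^4)" where
  "tangent_onb S q = (SOME (e1, e2). e1 \<in> tangent_space S q \<and> e2 \<in> tangent_space S q \<and>
        norm e1 = 1 \<and> norm e2 = 1 \<and> e1 \<bullet> e2 = 0)"

definition mean_curv :: "(real^4) set \<Rightarrow> (real^4 \<Rightarrow> real^4) \<Rightarrow> real^4 \<Rightarrow> real" where
  "mean_curv S n q = (case tangent_onb S q of (e1, e2) \<Rightarrow>
       (second_ff S n q e1 e1 + second_ff S n q e2 e2) / 2)"

text \<open>Intrinsic Gaussian curvature of a surface in S^3 (Gauss equation: K = 1 + det A).\<close>
definition gauss_curv :: "(real^4) set \<Rightarrow> (real^4 \<Rightarrow> real^4) \<Rightarrow> real^4 \<Rightarrow> real" where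
  "gauss_curv S n q = (case tangent_onb S q of (e1, e2) \<Rightarrow>
       1 + (second_ff S n q e1 e1 * second_ff S n q e2 e2
            - second_ff S n q e1 e2 * second_ff S n q e2 e1))"

definition lam_curv :: "(real^4) set \<Rightarrow> (real^4 \<Rightarrow> real^4) \<Rightarrow> real^4 \<Rightarrow> real" where
  "lam_curv S n q = sqrt ((mean_curv S n q)\<^sup>2 + 1 - gauss_curv S n q)"

definition dist_S3 :: "real^4 \<Rightarrow> real^4 \<Rightarrow> real" where
  "dist_S3 x y = arccos (x \<bullet> y)"

definition setdist_S3 :: "real^4 \<Rightarrow> (real^4) set \<Rightarrow> real" where
  "setdist_S3 x S = Inf (dist_S3 x ` S)"

definition exp_S3 :: "real^4 \<Rightarrow> real^4 \<Rightarrow> real^4" where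
  "exp_S3 q w = (if w = 0 then q else cos (norm w) *\<^sub>R q + (sin (norm w) / norm w) *\<^sub>R w)"

definition cut_dist :: "(real^4) set \<Rightarrow> (real^4 \<Rightarrow> real^4) \<Rightarrow> real^4 \<Rightarrow> real" where
  "cut_dist S n q = Sup {d. d \<ge> 0 \<and> setdist_S3 (exp_S3 q (d *\<^sub>R n q)) S = d}"

definition arccot :: "real \<Rightarrow> real" where
  "arccot x = pi / 2 - arctan x"

definition genus :: "(real^4) set \<Rightarrow> nat" where
  "genus S = (THE g. homology_group 1 (top_of_set S) \<cong> free_Abelian_group {..<2 * g})"

end

theory Submission
  imports Defs
begin

text \<open>
  For \<open>x \<noteq> q\<close> on \<open>\<Sigma>\<close> put \<open>Z(q, x) = (x \<bullet> n(q)) / (1 - x \<bullet> q)\<close>. The ball of radius \<open>d\<close> centred at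
  \<open>exp\<^sub>q(d n(q))\<close> has no point of \<open>\<Sigma>\<close> in its interior iff \<open>Z(q, x) \<le> cot d\<close> for all \<open>x\<close>. As
  \<open>x \<rightarrow> q\<close>, the upper limit of \<open>Z\<close> is the larger principal curvature \<open>H + \<lambda>\<close>, so that
  \<open>r(q) \<le> cot\<^sup>-\<^sup>1 (H + \<lambda>)(q)\<close>, and the equality for \<open>r\<^sub>0\<close> says that \<open>Z\<close> never exceeds the supremum
  of \<open>H + \<lambda>\<close>. Otherwise \<open>Z\<close> attains a maximum \<open>\<kappa> = cot d\<close> at a pair \<open>(q, x)\<close> off the diagonal.
  Criticality in \<open>x\<close> and the separation of \<open>\<Omega>1\<close> from \<open>\<Omega>2\<close> give
  \<open>exp\<^sub>q(d n(q)) = exp\<^sub>x(d n(x))\<close>; criticality in \<open>q\<close> gives \<open>x = exp\<^sub>q(2 d n(q))\<close>, whence the tangent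
  planes at \<open>q\<close> and \<open>x\<close> agree as subspaces of \<open>\<real>\<^sup>4\<close>. The second variation, traced over this plane,
  then contradicts \<open>H \<ge> 0\<close>.

  If \<open>r\<^sub>0 > \<pi>/4\<close>, then both principal curvatures lie in \<open>(-1, 1)\<close>, so the quaternionic Gauss map
  \<open>q \<mapsto> n(q) q\<^sup>-\<^sup>1\<close> is an immersion of \<open>\<Sigma>\<close> into the sphere of unit imaginary quaternions. By
  compactness it is a covering, hence a homeomorphism, and the genus is \<open>0\<close>.
\<close>

subsection \<open>Directional derivatives of smooth maps\<close>

text \<open>Comparing a touching ball at \<open>q\<close> with the curvature at \<open>q\<close> is
  local and only bounds the radius from above. The opposite bound needs a pair of points extremal in
  both variables: then \<open>q\<close> and \<open>x\<close> are the ends of a geodesic of length 2d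
  normal to the surface at both ends, and both mean curvatures enter. With \<kappa> = cot d,
  \<alpha> = cos 2d and \<beta> = sin 2d, the margin that decides the contradiction is
  \<kappa>\<beta> = 2 (cos d)^2 < 2. At \<open>x\<close> mean convexity controls only the trace of
  the second form, which is why the variation is summed over an orthonormal basis common to both
  points. The curvatures are defined through charts and chosen bases, so continuity of H + \<lambda>
  is avoided: boundedness of \<open>kmax\<close> and its comparison with the infimum of the cut
  distances rest on inequalities for touching balls. Z itself is singular on the diagonal, and its
  maximum is sought away from it. For the genus, H \<ge> 0 makes the larger principal curvature also
  the larger in absolute value, so a single upper bound below 1 confines both.\<close>

abbreviation pd :: "('a::euclidean_space \<Rightarrow> 'b::euclidean_space) \<Rightarrow> 'a \<Rightarrow> 'a \<Rightarrow> 'b" where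
  "pd f u \<equiv> (\<lambda>x. frechet_derivative f (at x) u)"

lemma smooth_on_continuous: "smooth_on U f \<Longrightarrow> continuous_on U f"
  unfolding smooth_on_def by (metis Ck_on.simps(1))

lemma smooth_on_has_derivative:
  assumes "smooth_on U f" "x \<in> U"
  shows "(f has_derivative (\<lambda>u. pd f u x)) (at x)"
proof -
  have "Ck_on (Suc 0) U f" using assms(1) unfolding smooth_on_def by blast
  then show ?thesis using assms(2) by (simp add: frechet_derivative_works eta_contract_eq)
qed

lemma smooth_on_pd: "smooth_on U f \<Longrightarrow> smooth_on U (pd f u)"
  unfolding smooth_on_def by (metis Ck_on.simps(2))

lemma linear_pd:
  assumes "smooth_on U f" "x \<in> U"
  shows "linear (\<lambda>u. pd f u x)"
  using smooth_on_has_derivative[OF assms] has_derivative_linear by blast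

lemma has_vector_derivative_line:
  assumes "smooth_on U f" "a + t *\<^sub>R u \<in> U"
  shows "((\<lambda>t. f (a + t *\<^sub>R u)) has_vector_derivative pd f u (a + t *\<^sub>R u)) (at t)"
proof -
  have 1: "((\<lambda>t. a + t *\<^sub>R u) has_derivative (\<lambda>s. s *\<^sub>R u)) (at t)"
    by (auto intro!: derivative_eq_intros)
  have "((\<lambda>t. f (a + t *\<^sub>R u)) has_derivative (\<lambda>s. pd f (s *\<^sub>R u) (a + t *\<^sub>R u))) (at t)"
    using has_derivative_compose[OF 1 smooth_on_has_derivative[OF assms]] .
  then show ?thesis
    unfolding has_vector_derivative_def
    using linear_pd[OF assms] by (simp add: linear_cmul)
qed

text \<open>Mean value theorem twice, first along \<open>u\<close>, then along \<open>v\<close>.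
  Pairing with \<open>e\<close> makes the functions real-valued, as that theorem requires.\<close>

lemma mixed_difference_mean_value:
  fixes f :: "'a::euclidean_space \<Rightarrow> 'b::euclidean_space"
  assumes sm: "smooth_on U f" and sub: "ball x r \<subseteq> U" and h: "0 < h" "h * (norm u + norm v) < r"
  shows "\<exists>p. norm (p - x) \<le> h * (norm u + norm v) \<and>
     (f (x + h *\<^sub>R u + h *\<^sub>R v) - f (x + h *\<^sub>R u) - f (x + h *\<^sub>R v) + f x) \<bullet> e = h\<^sup>2 * (pd (pd f u) v p \<bullet> e)"
proof -
  have bnd: "norm (s *\<^sub>R u + t *\<^sub>R v) \<le> h * (norm u + norm v)" if "0 \<le> s" "s \<le> h" "0 \<le> t" "t \<le> h" for s t
  proof -
    have "norm (s *\<^sub>R u + t *\<^sub>R v) \<le> s * norm u + t * norm v"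
      using norm_triangle_ineq[of "s *\<^sub>R u" "t *\<^sub>R v"] that by simp
    also have "\<dots> \<le> h * norm u + h * norm v" using that by (intro add_mono mult_right_mono) auto
    finally show ?thesis by (simp add: algebra_simps)
  qed
  have inU: "x + s *\<^sub>R u + t *\<^sub>R v \<in> U" if "0 \<le> s" "s \<le> h" "0 \<le> t" "t \<le> h" for s t
  proof -
    have "dist x (x + s *\<^sub>R u + t *\<^sub>R v) = norm (s *\<^sub>R u + t *\<^sub>R v)"
      by (metis add.assoc add_diff_cancel_left' dist_norm norm_minus_commute)
    then show ?thesis using bnd[OF that] h(2) sub by auto
  qed
  define g where "g s = (f (x + h *\<^sub>R v + s *\<^sub>R u) - f (x + s *\<^sub>R u)) \<bullet> e" for s
  define g' where "g' s = (pd f u (x + h *\<^sub>R v + s *\<^sub>R u) - pd f u (x + s *\<^sub>R u)) \<bullet> e" for s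
  have dg: "(g has_real_derivative g' s) (at s)" if "0 \<le> s" "s \<le> h" for s
  proof -
    have 1: "x + h *\<^sub>R v + s *\<^sub>R u \<in> U" using inU[of s h] that h by (simp add: algebra_simps)
    have 2: "x + s *\<^sub>R u \<in> U" using inU[of s 0] that h by simp
    have "((\<lambda>s. f (x + h *\<^sub>R v + s *\<^sub>R u) - f (x + s *\<^sub>R u)) has_vector_derivative
        (pd f u (x + h *\<^sub>R v + s *\<^sub>R u) - pd f u (x + s *\<^sub>R u))) (at s)"
      by (intro has_vector_derivative_diff has_vector_derivative_line[OF sm] 1 2)
    from bounded_linear.has_vector_derivative[OF bounded_linear_inner_left this, of e]
    show ?thesis unfolding g_def g'_def has_real_derivative_iff_has_vector_derivative .
  qed
  obtain s where s: "0 < s" "s < h" "g h - g 0 = h * g' s"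
    using MVT2[of 0 h g g'] dg h by auto
  define k where "k t = pd f u (x + s *\<^sub>R u + t *\<^sub>R v) \<bullet> e" for t
  define k' where "k' t = pd (pd f u) v (x + s *\<^sub>R u + t *\<^sub>R v) \<bullet> e" for t
  have dk: "(k has_real_derivative k' t) (at t)" if "0 \<le> t" "t \<le> h" for t
    using bounded_linear.has_vector_derivative[OF bounded_linear_inner_left[of e]
        has_vector_derivative_line[OF smooth_on_pd[OF sm] inU[of s t]]] s that
    unfolding k_def k'_def has_real_derivative_iff_has_vector_derivative by simp
  obtain t where t: "0 < t" "t < h" "k h - k 0 = h * k' t"
    using MVT2[of 0 h k k'] dk h by auto
  have "k h - k 0 = g' s" unfolding k_def g'_def by (simp add: inner_diff_left algebra_simps)
  then have "g h - g 0 = h\<^sup>2 * k' t" using s t by (simp add: power2_eq_square)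
  moreover have "g h - g 0 = (f (x + h *\<^sub>R u + h *\<^sub>R v) - f (x + h *\<^sub>R u) - f (x + h *\<^sub>R v) + f x) \<bullet> e"
    unfolding g_def by (simp add: inner_diff_left inner_add_left algebra_simps)
  moreover have "norm ((x + s *\<^sub>R u + t *\<^sub>R v) - x) \<le> h * (norm u + norm v)"
    using bnd[of s t] s t by (simp add: add.assoc)
  ultimately show ?thesis unfolding k'_def by metis
qed

text \<open>The second difference in \<open>mixed_difference_mean_value\<close> is symmetric in
  \<open>u\<close> and \<open>v\<close>, so the two mixed derivatives agree at a pair of points
  arbitrarily near \<open>x\<close>; continuity does the rest.\<close>

lemma pd_commute:
  fixes f :: "'a::euclidean_space \<Rightarrow> 'b::euclidean_space"
  assumes sm: "smooth_on U f" and U: "open U" "x \<in> U"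
  shows "pd (pd f u) v x = pd (pd f v) u x"
proof (rule euclidean_eqI, rule ccontr)
  fix e :: 'b
  define G where "G u v p = pd (pd f u) v p \<bullet> e" for u v p
  assume "pd (pd f u) v x \<bullet> e \<noteq> pd (pd f v) u x \<bullet> e"
  then have pos: "\<bar>G u v x - G v u x\<bar> / 2 > 0" (is "?e > 0") unfolding G_def by simp
  have cont: "isCont (G u v) x" for u v
    unfolding G_def using smooth_on_continuous[OF smooth_on_pd[OF smooth_on_pd[OF sm]]] U
    by (intro continuous_intros) (auto simp: continuous_on_eq_continuous_at)
  have "\<exists>d>0. \<forall>p. dist p x < d \<longrightarrow> dist (G u v p) (G u v x) < ?e" for u v
    using cont[of u v] pos unfolding continuous_at_eps_delta dist_norm by blast
  from this[of u v] this[of v u] obtain d1 d2 where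
    d1: "d1 > 0" "\<And>p. dist p x < d1 \<Longrightarrow> dist (G u v p) (G u v x) < ?e" and
    d2: "d2 > 0" "\<And>p. dist p x < d2 \<Longrightarrow> dist (G v u p) (G v u x) < ?e" by metis
  obtain r where r: "r > 0" "ball x r \<subseteq> U" using U open_contains_ball by blast
  define d where "d = min r (min d1 d2)"
  define h where "h = d / (2 * (norm u + norm v + 1))"
  have d0: "d > 0" using d1 d2 r unfolding d_def by simp
  have den: "2 * (norm u + norm v + 1) > 0" by (smt (verit) norm_ge_zero)
  have h0: "h > 0" unfolding h_def using d0 den by simp
  have "h * (norm u + norm v) \<le> h * (norm u + norm v + 1)" using h0 by simp
  also have "\<dots> = d / 2" unfolding h_def using den by (simp add: field_simps)
  finally have hd: "h * (norm u + norm v) < d" using d0 by simp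
  obtain p where p: "norm (p - x) \<le> h * (norm u + norm v)"
     "(f (x + h *\<^sub>R u + h *\<^sub>R v) - f (x + h *\<^sub>R u) - f (x + h *\<^sub>R v) + f x) \<bullet> e = h\<^sup>2 * G u v p"
    using mixed_difference_mean_value[OF sm r(2) h0, of u v e] hd unfolding d_def G_def by auto
  obtain p' where p': "norm (p' - x) \<le> h * (norm v + norm u)"
     "(f (x + h *\<^sub>R v + h *\<^sub>R u) - f (x + h *\<^sub>R v) - f (x + h *\<^sub>R u) + f x) \<bullet> e = h\<^sup>2 * G v u p'"
    using mixed_difference_mean_value[OF sm r(2) h0, of v u e] hd unfolding d_def G_def by (auto simp: add.commute)
  have "h\<^sup>2 * G u v p = h\<^sup>2 * G v u p'" using p(2) p'(2)
    by (simp add: algebra_simps)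
  then have "G u v p = G v u p'" using h0 by simp
  moreover have "dist (G u v p) (G u v x) < ?e"
    using d1(2)[of p] p(1) hd unfolding d_def dist_norm by simp
  moreover have "dist (G v u p') (G v u x) < ?e"
    using d2(2)[of p'] p'(1) hd unfolding d_def dist_norm by (simp add: add.commute)
  ultimately show False unfolding dist_real_def abs_if by (auto split: if_splits)
qed

lemma second_derivative_at_min:
  fixes g :: "real \<Rightarrow> real"
  assumes d: "d > 0" and g: "\<And>t. \<bar>t\<bar> < d \<Longrightarrow> (g has_real_derivative g' t) (at t)"
    and g': "(g' has_real_derivative g2) (at 0)" and min: "\<And>t. \<bar>t\<bar> < d \<Longrightarrow> g 0 \<le> g t"
  shows "g' 0 = 0" "g2 \<ge> 0"
proof -
  show z: "g' 0 = 0"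
    using DERIV_local_min[of g "g' 0" 0 d] g[of 0] d min by (auto simp: abs_minus_commute)
  show "g2 \<ge> 0"
  proof (rule ccontr)
    assume "\<not> g2 \<ge> 0"
    then obtain e where e: "e > 0" "\<And>h. 0 < h \<Longrightarrow> h < e \<Longrightarrow> g' (0 + h) < g' 0"
      using DERIV_neg_dec_right[OF g'] by auto
    define h where "h = min d e / 2"
    have h: "0 < h" "h < d" "h < e" using d e unfolding h_def by auto
    obtain t where t: "0 < t" "t < h" "g h - g 0 = h * g' t"
      using MVT2[of 0 h g g'] g h by auto
    have "g' t < 0" using e(2)[of t] t h z by simp
    then have "g h < g 0" using t h by (smt (verit) mult_pos_neg)
    then show False using min[of h] h by simp
  qed
qed

subsection \<open>Surfaces with a unit normal\<close>

text \<open>In finite dimension, continuity of each directional derivative already gives continuity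
  of \<open>f'\<close> in operator norm, which is bounded by a sum over the basis. A left inverse of
  \<open>f' a\<close> then yields injectivity; the target may have larger dimension than the
  source.\<close>

lemma immersion_locally_injective:
  fixes f :: "'a::euclidean_space \<Rightarrow> 'b::euclidean_space"
  assumes U: "open U" "a \<in> U"
    and f: "\<And>x. x \<in> U \<Longrightarrow> (f has_derivative f' x) (at x)"
    and cont: "\<And>v. continuous_on U (\<lambda>x. f' x v)"
    and inj: "inj (f' a)"
  obtains r where "r > 0" "ball a r \<subseteq> U" "inj_on f (ball a r)"
proof -
  have bl: "bounded_linear (f' x)" if "x \<in> U" for x
    using f[OF that] by (rule has_derivative_bounded_linear)
  obtain g where g: "linear g" "g \<circ> f' a = id"
    using linear_injective_left_inverse[of "f' a"] inj bl[OF U(2)] bounded_linear.linear by blast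
  have "\<exists>d>0. \<forall>x. dist a x < d \<longrightarrow> onorm (\<lambda>v. f' x v - f' a v) < e" if e: "e > 0" for e :: real
  proof -
    define g where "g x = (\<Sum>i\<in>Basis. norm (f' x i - f' a i))" for x
    have "isCont g a"
      unfolding g_def using cont U by (intro continuous_intros) (auto simp: continuous_on_eq_continuous_at)
    then have "(g \<longlongrightarrow> g a) (nhds a)"
      unfolding isCont_def tendsto_at_iff_tendsto_nhds .
    then have "(g \<longlongrightarrow> 0) (nhds a)" by (simp add: g_def)
    then have "((\<lambda>x. \<Sum>i\<in>Basis. norm (f' x i - f' a i)) \<longlongrightarrow> 0) (nhds a)"
      unfolding g_def .
    then have "eventually (\<lambda>x. (\<Sum>i\<in>Basis. norm (f' x i - f' a i)) < e) (nhds a)"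
      using e by (rule order_tendstoD(2))
    moreover have "eventually (\<lambda>x. x \<in> U) (nhds a)" using U by (simp add: eventually_nhds_in_open)
    ultimately obtain d where d: "d > 0"
      "\<And>x. dist x a < d \<Longrightarrow> (\<Sum>i\<in>Basis. norm (f' x i - f' a i)) < e \<and> x \<in> U"
      using eventually_conj unfolding eventually_nhds_metric by (smt (verit) min_less_iff_conj)
    have "onorm (\<lambda>v. f' x v - f' a v) < e" if "dist a x < d" for x
    proof -
      have "x \<in> U" using d(2)[of x] that by (simp add: dist_commute)
      then have "onorm (\<lambda>v. f' x v - f' a v) \<le> (\<Sum>i\<in>Basis. norm (f' x i - f' a i))"
        by (intro onorm_componentwise bounded_linear_sub bl U(2))
      then show ?thesis using d(2)[of x] that by (simp add: dist_commute)
    qed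
    then show ?thesis using d(1) by blast
  qed
  then show ?thesis
    using has_derivative_locally_injective[OF U(2,1) _ g(2) f] that g(1)
    by (metis linear_conv_bounded_linear)
qed

text \<open>Source of the structure equations: it differentiates the orthonormality relations
  between position, tangent vectors and normal, and then the resulting relations once more.\<close>

lemma pd_inner_const:
  fixes f g :: "'a::euclidean_space \<Rightarrow> 'b::euclidean_space"
  assumes "smooth_on V f" "smooth_on V g" "open V" "a \<in> V" "\<And>x. x \<in> V \<Longrightarrow> f x \<bullet> g x = c"
  shows "pd f u a \<bullet> g a + f a \<bullet> pd g u a = 0"
proof -
  have "((\<lambda>x. f x \<bullet> g x) has_derivative (\<lambda>u. f a \<bullet> pd g u a + pd f u a \<bullet> g a)) (at a)"
    by (intro has_derivative_inner smooth_on_has_derivative[OF assms(1,4)] smooth_on_has_derivative[OF assms(2,4)])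
  moreover have "((\<lambda>x. f x \<bullet> g x) has_derivative (\<lambda>u. 0)) (at a)"
    using has_derivative_transform_within_open[OF has_derivative_const[of c] assms(3,4)] assms(5) by simp
  ultimately have "(\<lambda>u. f a \<bullet> pd g u a + pd f u a \<bullet> g a) = (\<lambda>u. 0)"
    by (rule has_derivative_unique)
  from fun_cong[OF this, of u] show ?thesis by (simp add: add.commute)
qed

locale unit_normal_surface =
  fixes S :: "(real^4) set" and n :: "real^4 \<Rightarrow> real^4"
  assumes surf: "embedded_surface_S3 S"
    and n_smooth: "smooth_map_on_surface S n"
    and n_unit: "\<And>q. q \<in> S \<Longrightarrow> norm (n q) = 1"
    and n_orth: "\<And>q. q \<in> S \<Longrightarrow> n q \<bullet> q = 0"
    and n_normal: "\<And>q v. q \<in> S \<Longrightarrow> v \<in> tangent_space S q \<Longrightarrow> n q \<bullet> v = 0"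
begin

lemma chartD:
  assumes "chart S V \<phi>"
  shows "open V" "smooth_on V \<phi>" "inj_on \<phi> V" "\<And>x. x \<in> V \<Longrightarrow> \<phi> x \<in> S"
    "openin (top_of_set S) (\<phi> ` V)" "continuous_on (\<phi> ` V) (inv_into V \<phi>)"
    "\<And>x. x \<in> V \<Longrightarrow> inj (\<lambda>u. pd \<phi> u x)" "smooth_on V (n \<circ> \<phi>)"
  using assms n_smooth unfolding chart_def smooth_map_on_surface_def by auto

lemma obtain_chart:
  assumes "q \<in> S"
  obtains V \<phi> a where "chart S V \<phi>" "a \<in> V" "\<phi> a = q"
  using assms surf unfolding embedded_surface_S3_def by (metis imageE)

lemma norm_S: "q \<in> S \<Longrightarrow> norm q = 1"
  using surf unfolding embedded_surface_S3_def by auto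

lemma inner_self_S: "q \<in> S \<Longrightarrow> q \<bullet> q = 1" "q \<in> S \<Longrightarrow> n q \<bullet> n q = 1"
  using norm_S n_unit by (simp_all add: dot_square_norm)

lemma pd_mem_tangent_space:
  "chart S V \<phi> \<Longrightarrow> a \<in> V \<Longrightarrow> pd \<phi> u a \<in> tangent_space S (\<phi> a)"
  unfolding tangent_space_def by blast

text \<open>The last equation is Weingarten's: it trades the derivative of \<open>n\<close> for a
  second derivative of the chart, whose symmetry makes the shape operator self-adjoint.\<close>

lemma pd_orth:
  assumes c: "chart S V \<phi>" and a: "a \<in> V"
  shows "pd \<phi> u a \<bullet> \<phi> a = 0" "n (\<phi> a) \<bullet> pd \<phi> u a = 0"
    "pd (n \<circ> \<phi>) u a \<bullet> \<phi> a = 0" "pd (n \<circ> \<phi>) u a \<bullet> n (\<phi> a) = 0"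
    "pd (n \<circ> \<phi>) w a \<bullet> pd \<phi> u a = - (n (\<phi> a) \<bullet> pd (pd \<phi> u) w a)"
proof -
  note C = chartD[OF c]
  show 1: "pd \<phi> u a \<bullet> \<phi> a = 0"
    using pd_inner_const[OF C(2,2,1) a, of 1 u] C(4) inner_self_S by (simp add: inner_commute)
  show 2: "n (\<phi> a) \<bullet> pd \<phi> u a = 0" using n_normal C(4) a pd_mem_tangent_space[OF c a] by blast
  show "pd (n \<circ> \<phi>) u a \<bullet> \<phi> a = 0"
    using pd_inner_const[OF C(8,2,1) a, of 0 u] C(4) n_orth 2 by simp
  show "pd (n \<circ> \<phi>) u a \<bullet> n (\<phi> a) = 0"
    using pd_inner_const[OF C(8,8,1) a, of 1 u] C(4) inner_self_S by (simp add: inner_commute)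
  have "n (\<phi> x) \<bullet> pd \<phi> u x = 0" if "x \<in> V" for x
    using n_normal C(4) that pd_mem_tangent_space[OF c that] by blast
  then show "pd (n \<circ> \<phi>) w a \<bullet> pd \<phi> u a = - (n (\<phi> a) \<bullet> pd (pd \<phi> u) w a)"
    using pd_inner_const[OF C(8) smooth_on_pd[OF C(2)] C(1) a, of u 0 w] by simp
qed

text \<open>The tangent plane as an orthogonal complement in the ambient space; in this form the
  planes at two different points of \<open>S\<close> can be compared as sets.\<close>

definition T :: "real^4 \<Rightarrow> (real^4) set" where
  "T q = {v. v \<bullet> q = 0 \<and> v \<bullet> n q = 0}"

lemma subspace_T: "subspace (T q)"
  unfolding T_def subspace_def by (auto simp: inner_add_left)

text \<open>Inclusion and equal dimension: the derivative of a chart is injective on the plane, and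
  \<open>T\<close> is the complement of two orthonormal vectors in dimension 4.\<close>

lemma range_pd_eq_T:
  assumes c: "chart S V \<phi>" and a: "a \<in> V"
  shows "range (\<lambda>u. pd \<phi> u a) = T (\<phi> a)"
proof (rule subspace_dim_equal)
  note C = chartD[OF c]
  let ?q = "\<phi> a"
  have q: "?q \<in> S" using C(4) a by blast
  have lin: "linear (\<lambda>u. pd \<phi> u a)" using linear_pd[OF C(2) a] .
  show "subspace (range (\<lambda>u. pd \<phi> u a))" using linear_subspace_image[OF lin subspace_UNIV] .
  show "subspace (T ?q)" by (rule subspace_T)
  show "range (\<lambda>u. pd \<phi> u a) \<subseteq> T ?q"
    using pd_orth[OF c a] unfolding T_def by (auto simp: inner_commute)
  have "dim (range (\<lambda>u. pd \<phi> u a)) = dim (UNIV :: (real^2) set)"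
    using dim_image_eq[OF lin, of UNIV] C(7)[OF a] by simp
  then have d1: "dim (range (\<lambda>u. pd \<phi> u a)) = 2" by simp
  have nz: "?q \<noteq> 0" "n ?q \<noteq> 0" using norm_S[OF q] n_unit[OF q] by auto
  have ne: "?q \<noteq> n ?q" using n_orth[OF q] inner_self_S[OF q] by auto
  have "independent {?q, n ?q}"
    by (intro pairwise_orthogonal_independent)
      (use nz n_orth[OF q] in \<open>auto simp: pairwise_def orthogonal_def inner_commute\<close>)
  then have "dim {?q, n ?q} = 2" using ne by (simp add: dim_eq_card_independent)
  moreover have "dim {y \<in> UNIV. \<forall>x\<in>span {?q, n ?q}. orthogonal x y} + dim (span {?q, n ?q}) = dim (UNIV :: (real^4) set)"
    by (rule dim_subspace_orthogonal_to_vectors) auto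
  moreover have "{y \<in> UNIV. \<forall>x\<in>span {?q, n ?q}. orthogonal x y} = T ?q" (is "?A = _")
  proof
    show "?A \<subseteq> T ?q" unfolding T_def orthogonal_def by (auto simp: inner_commute span_base)
    show "T ?q \<subseteq> ?A"
    proof
      fix y assume "y \<in> T ?q"
      have "orthogonal y x" if "x \<in> span {?q, n ?q}" for x
        by (rule orthogonal_to_span[OF that]) (use \<open>y \<in> T ?q\<close> in \<open>auto simp: T_def orthogonal_def\<close>)
      then show "y \<in> ?A" by (auto simp: orthogonal_commute)
    qed
  qed
  ultimately have "dim (T ?q) = 2" by simp
  then show "dim (range (\<lambda>u. pd \<phi> u a)) \<ge> dim (T ?q)" using d1 by simp
qed

lemma tangent_space_eq_T:
  assumes "q \<in> S"
  shows "tangent_space S q = T q"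
proof
  show "tangent_space S q \<subseteq> T q" unfolding tangent_space_def using range_pd_eq_T by blast
  show "T q \<subseteq> tangent_space S q"
    using obtain_chart[OF assms] range_pd_eq_T unfolding tangent_space_def by (smt (verit) mem_Collect_eq subsetI)
qed

text \<open>The coordinate change is differentiable: compose with a left inverse \<open>L\<close> of the derivative
  of \<open>\<psi>\<close>, so that \<open>L \<circ> \<psi>\<close> is a local diffeomorphism of the plane.\<close>
lemma pd_normal_chart_independent:
  assumes c: "chart S V \<phi>" "a \<in> V" and d: "chart S W \<psi>" "b \<in> W"
    and eq: "\<phi> a = \<psi> b" and eq': "pd \<phi> u a = pd \<psi> u' b"
  shows "pd (n \<circ> \<phi>) u a = pd (n \<circ> \<psi>) u' b"
proof -
  note C = chartD[OF c(1)] and D = chartD[OF d(1)]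
  have lin: "linear (\<lambda>u. pd \<psi> u b)" using linear_pd[OF D(2) d(2)] .
  obtain L where L: "linear L" "L \<circ> (\<lambda>u. pd \<psi> u b) = id"
    using linear_injective_left_inverse[OF lin D(7)[OF d(2)]] by blast
  have bL: "bounded_linear L" using L(1) linear_conv_bounded_linear by blast
  have dF: "((\<lambda>x. L (\<psi> x)) has_derivative (\<lambda>v. L (pd \<psi> v x))) (at x)" if "x \<in> W" for x
    using bounded_linear.has_derivative[OF bL smooth_on_has_derivative[OF D(2) that]] .
  have cF: "continuous_on W (\<lambda>x. L (pd \<psi> v x))" for v
    using bounded_linear.continuous_on[OF bL smooth_on_continuous[OF smooth_on_pd[OF D(2)]]] .
  have idF: "(\<lambda>v. L (pd \<psi> v b)) = id" using L(2) by (auto simp: o_def)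
  obtain r where r: "r > 0" "ball b r \<subseteq> W" "inj_on (\<lambda>x. L (\<psi> x)) (ball b r)"
  proof (rule immersion_locally_injective[OF D(1) d(2) dF cF])
    show "inj (\<lambda>v. L (pd \<psi> v b))" unfolding idF by simp
  qed
  define G where "G = inv_into (ball b r) (\<lambda>x. L (\<psi> x))"
  have GF: "G (L (\<psi> x)) = x" if "x \<in> ball b r" for x
    unfolding G_def using inv_into_f_f[OF r(3) that] .
  have dG: "(G has_derivative id) (at (L (\<psi> b)))"
  proof (rule has_derivative_inverse_strong[of "ball b r" b "\<lambda>x. L (\<psi> x)" G "\<lambda>v. L (pd \<psi> v b)" id])
    show "((\<lambda>x. L (\<psi> x)) has_derivative (\<lambda>v. L (pd \<psi> v b))) (at b)" using dF d(2) by blast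
    show "continuous_on (ball b r) (\<lambda>x. L (\<psi> x))"
      by (rule has_derivative_continuous_on, rule has_derivative_at_withinI, rule dF) (use r(2) in auto)
  qed (use r GF idF in auto)
  \<comment> \<open>The line through \<open>a\<close>, read in the chart \<psi>. Continuity of the
    inverse chart keeps \<tau> in the ball where \<open>G\<close> undoes
    \<open>L \<circ> \<psi>\<close>, and there \<tau> inherits differentiability from
    \<open>G\<close>.\<close>
  define \<tau> where "\<tau> t = inv_into W \<psi> (\<phi> (a + t *\<^sub>R u))" for t
  have lc: "((\<lambda>t. a + t *\<^sub>R u) \<longlongrightarrow> a) (at 0)" for a :: "real^2"
    by (auto intro!: tendsto_eq_intros)
  have evV: "eventually (\<lambda>t. a + t *\<^sub>R u \<in> V) (at 0)"
    using lc[of a] C(1) c(2) by (rule topological_tendstoD)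
  have cphi: "((\<lambda>t. \<phi> (a + t *\<^sub>R u)) \<longlongrightarrow> \<psi> b) (at 0)"
    using has_derivative_continuous[OF smooth_on_has_derivative[OF C(2) c(2)]] lc[of a]
    unfolding eq[symmetric] by (rule isCont_tendsto_compose)
  have evS: "eventually (\<lambda>t. \<phi> (a + t *\<^sub>R u) \<in> S) (at 0)"
    using evV by eventually_elim (rule C(4))
  obtain O' where O': "open O'" "\<psi> ` W = S \<inter> O'" using D(5) by (auto simp: openin_open)
  have evW: "eventually (\<lambda>t. \<phi> (a + t *\<^sub>R u) \<in> \<psi> ` W) (at 0)"
  proof -
    have "\<psi> b \<in> O'" using O'(2) d(2) by blast
    from topological_tendstoD[OF cphi O'(1) this] evS show ?thesis
      unfolding O'(2) by eventually_elim simp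
  qed
  have psit: "eventually (\<lambda>t. \<tau> t \<in> W \<and> \<psi> (\<tau> t) = \<phi> (a + t *\<^sub>R u)) (at 0)"
    using evW by eventually_elim (auto simp: \<tau>_def inv_into_into f_inv_into_f)
  have "((\<lambda>t. \<tau> t) \<longlongrightarrow> inv_into W \<psi> (\<psi> b)) (at 0)"
    unfolding \<tau>_def
    by (rule continuous_on_tendsto_compose[OF D(6) cphi _ evW]) (use d in auto)
  then have tb: "(\<tau> \<longlongrightarrow> b) (at 0)" using inv_into_f_f[OF D(3) d(2)] by simp
  have "eventually (\<lambda>t. \<tau> t \<in> ball b r) (at 0)"
    using topological_tendstoD[OF tb open_ball] r(1) by simp
  with psit have Gt: "eventually (\<lambda>t. \<tau> t = G (L (\<phi> (a + t *\<^sub>R u)))) (at 0)"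
    by eventually_elim (metis GF)
  have t0: "\<tau> 0 = b" unfolding \<tau>_def using eq inv_into_f_f[OF D(3) d(2)] by simp
  have dphi: "((\<lambda>t. \<phi> (a + t *\<^sub>R u)) has_vector_derivative pd \<phi> u a) (at 0)"
    using has_vector_derivative_line[OF C(2), of a 0 u] c(2) by simp
  have "((\<lambda>t. G (L (\<phi> (a + t *\<^sub>R u)))) has_derivative (\<lambda>s. id (L (s *\<^sub>R pd \<phi> u a)))) (at 0)"
    by (rule has_derivative_compose[where f="\<lambda>t. L (\<phi> (a + t *\<^sub>R u))" and g=G])
      (use bounded_linear.has_derivative[OF bL dphi[unfolded has_vector_derivative_def]] dG eq in \<open>simp_all add: id_def\<close>)
  moreover have "L (s *\<^sub>R pd \<phi> u a) = s *\<^sub>R u'" for s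
    using idF L(1) by (metis eq' id_apply linear_cmul)
  ultimately have dG': "((\<lambda>t. G (L (\<phi> (a + t *\<^sub>R u)))) has_derivative (\<lambda>s. s *\<^sub>R u')) (at 0)" by simp
  have dt: "(\<tau> has_derivative (\<lambda>s. s *\<^sub>R u')) (at 0)"
    using has_derivative_transform_eventually[OF dG', of \<tau>] Gt t0 eq GF[of b] r(1)
    by (auto simp: eq_commute)
  have dn: "((\<lambda>t. (n \<circ> \<psi>) (\<tau> t)) has_derivative (\<lambda>s. pd (n \<circ> \<psi>) (s *\<^sub>R u') b)) (at 0)"
    using has_derivative_compose[OF dt, of "n \<circ> \<psi>"] smooth_on_has_derivative[OF D(8) d(2)] t0 by simp
  have "((\<lambda>t. (n \<circ> \<phi>) (a + t *\<^sub>R u)) has_derivative (\<lambda>s. pd (n \<circ> \<psi>) (s *\<^sub>R u') b)) (at 0)"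
    by (rule has_derivative_transform_eventually[OF dn]) (use psit eq t0 in \<open>auto elim: eventually_mono\<close>)
  moreover have "((\<lambda>t. (n \<circ> \<phi>) (a + t *\<^sub>R u)) has_derivative (\<lambda>s. s *\<^sub>R pd (n \<circ> \<phi>) u a)) (at 0)"
    using has_vector_derivative_line[OF C(8), of a 0 u] c(2) by (simp add: has_vector_derivative_def)
  ultimately have "(\<lambda>s. pd (n \<circ> \<psi>) (s *\<^sub>R u') b) = (\<lambda>s. s *\<^sub>R pd (n \<circ> \<phi>) u a)"
    by (rule has_derivative_unique)
  from fun_cong[OF this, of 1] show ?thesis by simp
qed

text \<open>From here on \<open>dN\<close> is computed in any convenient chart; its description by
  \<open>THE\<close> is not unfolded again.\<close>

lemma dN_pd:
  assumes c: "chart S V \<phi>" "a \<in> V"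
  shows "dN S n (\<phi> a) (pd \<phi> u a) = pd (n \<circ> \<phi>) u a"
  unfolding dN_def
proof (rule the_equality)
  show "\<forall>W \<psi> x u'. chart S W \<psi> \<and> x \<in> W \<and> \<psi> x = \<phi> a \<and> pd \<psi> u' x = pd \<phi> u a \<longrightarrow>
      pd (n \<circ> \<psi>) u' x = pd (n \<circ> \<phi>) u a"
    using pd_normal_chart_independent c by metis
qed (use c in blast)

end

section \<open>Principal curvatures and the second fundamental form\<close>

text \<open>The hypothesis says that m times the identity minus the matrix is positive semidefinite,
  so its determinant (m - a)(m - c) - b^2 is nonnegative; completing the square about half the trace
  gives the root.\<close>

lemma max_eigenvalue_le:
  fixes a b c m :: real
  assumes "\<And>x y. a * x\<^sup>2 + 2 * b * x * y + c * y\<^sup>2 \<le> m * (x\<^sup>2 + y\<^sup>2)"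
  shows "(a + c) / 2 + sqrt (((a + c) / 2)\<^sup>2 - (a * c - b\<^sup>2)) \<le> m"
proof -
  have ma: "a \<le> m" using assms[of 1 0] by simp
  have mc: "c \<le> m" using assms[of 0 1] by simp
  have "(m - a) * (m - c) \<ge> b\<^sup>2"
  proof (cases "m = a")
    case True
    have "2 * b * x \<le> m - c" for x using assms[of x 1] True by (simp add: algebra_simps)
    \<comment> \<open>A linear function of \<open>x\<close> is bounded above only if b = 0; for b
      different from 0 the chosen \<open>x\<close> would give m - c + 1 \<le> m - c.\<close>
    then have "2 * b * ((m - c + 1) / (2 * b)) \<le> m - c" .
    then have "b = 0" by (cases "b = 0") simp_all
    then show ?thesis using True by simp
  next
    case False
    then have pos: "m - a > 0" using ma by simp
    have "0 \<le> (m - a) * b\<^sup>2 - 2 * b * b * (m - a) + (m - c) * (m - a)\<^sup>2"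
      using assms[of b "m - a"] by (simp add: algebra_simps power2_eq_square)
    then have "0 \<le> (m - a) * ((m - a) * (m - c) - b\<^sup>2)" by (simp add: algebra_simps power2_eq_square)
    then show ?thesis using pos by (simp add: zero_le_mult_iff)
  qed
  then have "((a + c) / 2)\<^sup>2 - (a * c - b\<^sup>2) \<le> (m - (a + c) / 2)\<^sup>2"
    by (simp add: field_simps power2_eq_square)
  then have "sqrt (((a + c) / 2)\<^sup>2 - (a * c - b\<^sup>2)) \<le> sqrt ((m - (a + c) / 2)\<^sup>2)"
    by (rule real_sqrt_le_mono)
  then show ?thesis using ma mc by simp
qed

text \<open>Cauchy-Schwarz for (d, b) and (x^2 - y^2, 2 x y): the second vector has length x^2 + y^2
  by the double angle identity, and the first has length \<open>s\<close>.\<close>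

lemma quadratic_form_le_max_eigenvalue:
  fixes a b c :: real
  defines "s \<equiv> sqrt (((a + c) / 2)\<^sup>2 - (a * c - b\<^sup>2))"
  shows "a * x\<^sup>2 + 2 * b * x * y + c * y\<^sup>2 \<le> ((a + c) / 2 + s) * (x\<^sup>2 + y\<^sup>2)"
proof -
  define d where "d = (a - c) / 2"
  have disc: "((a + c) / 2)\<^sup>2 - (a * c - b\<^sup>2) = d\<^sup>2 + b\<^sup>2"
    unfolding d_def by (simp add: field_simps power2_eq_square)
  have "d * (x\<^sup>2 - y\<^sup>2) + b * (2 * x * y) \<le> \<bar>d * (x\<^sup>2 - y\<^sup>2) + b * (2 * x * y)\<bar>" by simp
  also have "\<dots> = sqrt ((d * (x\<^sup>2 - y\<^sup>2) + b * (2 * x * y))\<^sup>2)" by simp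
  also have "\<dots> \<le> sqrt ((d\<^sup>2 + b\<^sup>2) * (x\<^sup>2 + y\<^sup>2)\<^sup>2)"
  proof (rule real_sqrt_le_mono)
    have "(d\<^sup>2 + b\<^sup>2) * (x\<^sup>2 + y\<^sup>2)\<^sup>2 - (d * (x\<^sup>2 - y\<^sup>2) + b * (2 * x * y))\<^sup>2
        = (d * (2 * x * y) - b * (x\<^sup>2 - y\<^sup>2))\<^sup>2"
      by (simp add: power2_eq_square algebra_simps)
    then show "(d * (x\<^sup>2 - y\<^sup>2) + b * (2 * x * y))\<^sup>2 \<le> (d\<^sup>2 + b\<^sup>2) * (x\<^sup>2 + y\<^sup>2)\<^sup>2"
      by (smt (verit) zero_le_power2)
  qed
  also have "\<dots> = s * (x\<^sup>2 + y\<^sup>2)" unfolding s_def disc by (simp add: real_sqrt_mult)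
  finally have "d * (x\<^sup>2 - y\<^sup>2) + b * (2 * x * y) \<le> s * (x\<^sup>2 + y\<^sup>2)" .
  then show ?thesis unfolding d_def by (simp add: field_simps power2_eq_square)
qed

context unit_normal_surface
begin

lemma obtain_tangent_coords:
  assumes "q \<in> S"
  obtains V \<phi> a where "chart S V \<phi>" "a \<in> V" "\<phi> a = q" "\<forall>v\<in>T q. \<exists>u. v = pd \<phi> u a"
  using obtain_chart[OF assms] range_pd_eq_T by (metis (no_types, lifting) imageE)

lemma dN_mem_T:
  assumes q: "q \<in> S" and v: "v \<in> T q"
  shows "dN S n q v \<in> T q"
proof -
  obtain V \<phi> a where c: "chart S V \<phi>" "a \<in> V" "\<phi> a = q" and cov: "\<forall>v\<in>T q. \<exists>u. v = pd \<phi> u a"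
    using obtain_tangent_coords[OF q] .
  obtain u where "v = pd \<phi> u a" using cov v by blast
  then show ?thesis using dN_pd[OF c(1,2)] pd_orth[OF c(1,2)] c(3) unfolding T_def by auto
qed

lemma dN_linear:
  assumes q: "q \<in> S" and v: "v \<in> T q" "w \<in> T q"
  shows "dN S n q (x *\<^sub>R v + y *\<^sub>R w) = x *\<^sub>R dN S n q v + y *\<^sub>R dN S n q w"
proof -
  obtain V \<phi> a where c: "chart S V \<phi>" "a \<in> V" "\<phi> a = q" and cov: "\<forall>v\<in>T q. \<exists>u. v = pd \<phi> u a"
    using obtain_tangent_coords[OF q] .
  obtain u u' where u: "v = pd \<phi> u a" "w = pd \<phi> u' a" using cov v by blast
  note l1 = linear_pd[OF chartD(2)[OF c(1)] c(2)] and l2 = linear_pd[OF chartD(8)[OF c(1)] c(2)]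
  have "x *\<^sub>R v + y *\<^sub>R w = pd \<phi> (x *\<^sub>R u + y *\<^sub>R u') a"
    using u by (simp add: linear_add[OF l1] linear_cmul[OF l1])
  then show ?thesis
    using dN_pd[OF c(1,2)] u c(3) by (simp add: linear_add[OF l2] linear_cmul[OF l2])
qed

lemma dN_symmetric:
  assumes q: "q \<in> S" and v: "v \<in> T q" "w \<in> T q"
  shows "v \<bullet> dN S n q w = w \<bullet> dN S n q v"
proof -
  obtain V \<phi> a where c: "chart S V \<phi>" "a \<in> V" "\<phi> a = q" and cov: "\<forall>v\<in>T q. \<exists>u. v = pd \<phi> u a"
    using obtain_tangent_coords[OF q] .
  obtain u u' where u: "v = pd \<phi> u a" "w = pd \<phi> u' a" using cov v by blast
  have "pd (pd \<phi> u) u' a = pd (pd \<phi> u') u a"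
    using pd_commute[OF chartD(2,1)[OF c(1)] c(2)] .
  then show ?thesis
    using pd_orth(5)[OF c(1,2)] dN_pd[OF c(1,2)] u c(3) by (metis inner_commute)
qed

lemma dim_T:
  assumes "q \<in> S"
  shows "dim (T q) = 2"
proof -
  obtain V \<phi> a where c: "chart S V \<phi>" "a \<in> V" "\<phi> a = q" using obtain_chart[OF assms] .
  have "dim (range (\<lambda>u. pd \<phi> u a)) = dim (UNIV :: (real^2) set)"
    using dim_image_eq[OF linear_pd[OF chartD(2)[OF c(1)] c(2)], of UNIV] chartD(7)[OF c(1,2)] by simp
  then show ?thesis using range_pd_eq_T[OF c(1,2)] c(3) by simp
qed

definition onb :: "real^4 \<Rightarrow> real^4 \<Rightarrow> real^4 \<Rightarrow> bool" where
  "onb q e1 e2 \<longleftrightarrow> e1 \<in> T q \<and> e2 \<in> T q \<and> e1 \<bullet> e1 = 1 \<and> e2 \<bullet> e2 = 1 \<and> e1 \<bullet> e2 = 0"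

lemma onb_tangent_onb:
  assumes q: "q \<in> S"
  obtains e1 e2 where "tangent_onb S q = (e1, e2)" "onb q e1 e2"
proof -
  obtain B where B: "B \<subseteq> T q" "pairwise orthogonal B" "\<And>x. x \<in> B \<Longrightarrow> norm x = 1" "card B = dim (T q)"
    using orthonormal_basis_subspace[OF subspace_T[of q]] by metis
  then obtain b1 b2 where b: "B = {b1, b2}" "b1 \<noteq> b2"
    using dim_T[OF q] by (metis card_2_iff)
  have ts: "tangent_space S q = T q" by (rule tangent_space_eq_T[OF q])
  let ?P = "\<lambda>(e1, e2). e1 \<in> tangent_space S q \<and> e2 \<in> tangent_space S q \<and>
        norm e1 = 1 \<and> norm e2 = 1 \<and> e1 \<bullet> e2 = 0"
  have "?P (b1, b2)" using B b ts by (auto simp: pairwise_def orthogonal_def)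
  then have "?P (tangent_onb S q)" unfolding tangent_onb_def by (rule someI[of ?P])
  then show ?thesis using that ts by (cases "tangent_onb S q") (auto simp: onb_def dot_square_norm)
qed

lemma onb_expand:
  assumes q: "q \<in> S" and e: "onb q e1 e2" and v: "v \<in> T q"
  shows "v = (v \<bullet> e1) *\<^sub>R e1 + (v \<bullet> e2) *\<^sub>R e2"
proof -
  define w where "w = v - ((v \<bullet> e1) *\<^sub>R e1 + (v \<bullet> e2) *\<^sub>R e2)"
  have w1: "w \<bullet> e1 = 0" "w \<bullet> e2 = 0"
    unfolding w_def using e by (simp_all add: onb_def inner_diff_left inner_add_left inner_commute[of e2 e1])
  have wT: "w \<in> T q" unfolding w_def using e v subspace_T[of q]
    by (intro subspace_diff subspace_add subspace_scale) (auto simp: onb_def)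
  have ne: "e1 \<noteq> e2" "e1 \<noteq> 0" "e2 \<noteq> 0" using e by (auto simp: onb_def)
  have ind: "independent {e1, e2}"
    by (intro pairwise_orthogonal_independent)
      (use ne e in \<open>auto simp: pairwise_def orthogonal_def inner_commute onb_def\<close>)
  have "T q \<subseteq> span {e1, e2}"
    by (rule card_ge_dim_independent[OF _ ind]) (use e dim_T[OF q] ne in \<open>auto simp: onb_def\<close>)
  then have "w \<in> span {e1, e2}" using wT by blast
  then have "orthogonal w w"
    by (rule orthogonal_to_span) (use w1 in \<open>auto simp: orthogonal_def\<close>)
  then show ?thesis unfolding w_def orthogonal_def by simp
qed

abbreviation II :: "real^4 \<Rightarrow> real^4 \<Rightarrow> real^4 \<Rightarrow> real" where "II \<equiv> second_ff S n"

lemma II_symmetric: "q \<in> S \<Longrightarrow> v \<in> T q \<Longrightarrow> w \<in> T q \<Longrightarrow> II q v w = II q w v"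
  unfolding second_ff_def using dN_symmetric by simp

lemma II_expand:
  assumes q: "q \<in> S" and e: "onb q e1 e2"
  shows "II q (x *\<^sub>R e1 + y *\<^sub>R e2) (x' *\<^sub>R e1 + y' *\<^sub>R e2)
     = II q e1 e1 * x * x' + II q e1 e2 * (x * y' + y * x') + II q e2 e2 * y * y'"
proof -
  have e': "e1 \<in> T q" "e2 \<in> T q" using e by (auto simp: onb_def)
  show ?thesis
    using II_symmetric[OF q e'] dN_linear[OF q e', of x' y']
    unfolding second_ff_def by (simp add: inner_add_left inner_add_right algebra_simps)
qed

lemma dN_onb:
  assumes q: "q \<in> S" and e: "onb q e1 e2" and v: "v \<in> T q"
  shows "dN S n q v = (- II q e1 v) *\<^sub>R e1 + (- II q e2 v) *\<^sub>R e2"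
  using onb_expand[OF q e dN_mem_T[OF q v]] unfolding second_ff_def by (simp add: inner_commute)

text \<open>Both traces equal the sum over i, j of II(e_i, f_j) times the inner product of e_i and
  f_j. \<open>mean_curv\<close> refers to one chosen basis, while at a contact the basis comes from
  the other point.\<close>

lemma II_trace_unique:
  assumes q: "q \<in> S" and e: "onb q e1 e2" and f: "onb q f1 f2"
  shows "II q e1 e1 + II q e2 e2 = II q f1 f1 + II q f2 f2"
proof -
  have eT: "e1 \<in> T q" "e2 \<in> T q" and fT: "f1 \<in> T q" "f2 \<in> T q" using e f by (auto simp: onb_def)
  have 1: "II q e1 e1 = II q f1 e1 * (e1 \<bullet> f1) + II q f2 e1 * (e1 \<bullet> f2)" if "e1 \<in> T q" for e1
    using arg_cong[OF onb_expand[OF q f that], of "\<lambda>z. - (z \<bullet> dN S n q e1)"]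
    unfolding second_ff_def by (simp add: inner_add_left)
  have 2: "II q f1 f1 = II q e1 f1 * (f1 \<bullet> e1) + II q e2 f1 * (f1 \<bullet> e2)" if "f1 \<in> T q" for f1
    using arg_cong[OF onb_expand[OF q e that], of "\<lambda>z. - (z \<bullet> dN S n q f1)"]
    unfolding second_ff_def by (simp add: inner_add_left)
  show ?thesis using 1[OF eT(1)] 1[OF eT(2)] 2[OF fT(1)] 2[OF fT(2)]
      II_symmetric[OF q eT(1) fT(1)] II_symmetric[OF q eT(1) fT(2)]
      II_symmetric[OF q eT(2) fT(1)] II_symmetric[OF q eT(2) fT(2)]
    by (simp add: inner_commute algebra_simps)
qed

definition kmax :: "real^4 \<Rightarrow> real" where "kmax q = mean_curv S n q + lam_curv S n q"

lemma curvatures_onb: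
  assumes q: "q \<in> S"
  obtains e1 e2 where "onb q e1 e2"
    "mean_curv S n q = (II q e1 e1 + II q e2 e2) / 2"
    "lam_curv S n q = sqrt (((II q e1 e1 + II q e2 e2) / 2)\<^sup>2 - (II q e1 e1 * II q e2 e2 - (II q e1 e2)\<^sup>2))"
proof -
  obtain e1 e2 where e: "tangent_onb S q = (e1, e2)" "onb q e1 e2" using onb_tangent_onb[OF q] .
  have "II q e2 e1 = II q e1 e2" using II_symmetric q e(2) by (simp add: onb_def)
  then show ?thesis
    using that[OF e(2)] e(1) unfolding lam_curv_def mean_curv_def gauss_curv_def by (simp add: power2_eq_square)
qed

lemma inner_onb:
  "onb q e1 e2 \<Longrightarrow> (x *\<^sub>R e1 + y *\<^sub>R e2) \<bullet> (x' *\<^sub>R e1 + y' *\<^sub>R e2) = x * x' + y * y'"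
  unfolding onb_def by (simp add: inner_add_left inner_add_right inner_commute)

lemma onb_mem_T: "onb q e1 e2 \<Longrightarrow> x *\<^sub>R e1 + y *\<^sub>R e2 \<in> T q"
  using subspace_T[of q] unfolding onb_def by (intro subspace_add subspace_scale) auto

lemma II_le_kmax:
  assumes q: "q \<in> S" and v: "v \<in> T q"
  shows "II q v v \<le> kmax q * (v \<bullet> v)"
proof -
  obtain e1 e2 where e: "onb q e1 e2" and H: "mean_curv S n q = (II q e1 e1 + II q e2 e2) / 2"
    "lam_curv S n q = sqrt (((II q e1 e1 + II q e2 e2) / 2)\<^sup>2 - (II q e1 e1 * II q e2 e2 - (II q e1 e2)\<^sup>2))"
    using curvatures_onb[OF q] .
  obtain x y where v': "v = x *\<^sub>R e1 + y *\<^sub>R e2" using onb_expand[OF q e v] by blast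
  show ?thesis
    using quadratic_form_le_max_eigenvalue[of "II q e1 e1" x "II q e1 e2" y "II q e2 e2"]
    unfolding v' II_expand[OF q e] inner_onb[OF e] kmax_def H by (simp add: power2_eq_square algebra_simps)
qed

text \<open>The smaller principal curvature is H - \<lambda> = 2 H - \<open>kmax\<close>; the claim
  is the eigenvalue estimate for minus the form.\<close>

lemma II_ge_neg:
  assumes q: "q \<in> S" and v: "v \<in> T q"
  shows "- II q v v \<le> (kmax q - 2 * mean_curv S n q) * (v \<bullet> v)"
proof -
  obtain e1 e2 where e: "onb q e1 e2" and H: "mean_curv S n q = (II q e1 e1 + II q e2 e2) / 2"
    "lam_curv S n q = sqrt (((II q e1 e1 + II q e2 e2) / 2)\<^sup>2 - (II q e1 e1 * II q e2 e2 - (II q e1 e2)\<^sup>2))"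
    using curvatures_onb[OF q] .
  obtain x y where v': "v = x *\<^sub>R e1 + y *\<^sub>R e2" using onb_expand[OF q e v] by blast
  have "(- II q e1 e1 + - II q e2 e2) / 2 = - mean_curv S n q" using H by simp
  moreover have "sqrt (((- II q e1 e1 + - II q e2 e2) / 2)\<^sup>2 - (- II q e1 e1 * - II q e2 e2 - (- II q e1 e2)\<^sup>2)) = lam_curv S n q"
    unfolding H by (simp add: power2_eq_square algebra_simps)
  ultimately have "- II q e1 e1 * x\<^sup>2 + 2 * - II q e1 e2 * x * y + - II q e2 e2 * y\<^sup>2
      \<le> (- mean_curv S n q + lam_curv S n q) * (x\<^sup>2 + y\<^sup>2)"
    using quadratic_form_le_max_eigenvalue[of "- II q e1 e1" x "- II q e1 e2" y "- II q e2 e2"] by simp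
  then show ?thesis
    unfolding v' II_expand[OF q e] inner_onb[OF e] kmax_def by (simp add: power2_eq_square algebra_simps)
qed

text \<open>With \<open>II_le_kmax\<close> this identifies \<open>kmax\<close> as the least bound of
  the Rayleigh quotient, whatever basis was chosen.\<close>

lemma kmax_le:
  assumes q: "q \<in> S" and m: "\<And>v. v \<in> T q \<Longrightarrow> II q v v \<le> m * (v \<bullet> v)"
  shows "kmax q \<le> m"
proof -
  obtain e1 e2 where e: "onb q e1 e2" and H: "mean_curv S n q = (II q e1 e1 + II q e2 e2) / 2"
    "lam_curv S n q = sqrt (((II q e1 e1 + II q e2 e2) / 2)\<^sup>2 - (II q e1 e1 * II q e2 e2 - (II q e1 e2)\<^sup>2))"
    using curvatures_onb[OF q] .
  show ?thesis unfolding kmax_def H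
  proof (rule max_eigenvalue_le)
    fix x y
    show "II q e1 e1 * x\<^sup>2 + 2 * II q e1 e2 * x * y + II q e2 e2 * y\<^sup>2 \<le> m * (x\<^sup>2 + y\<^sup>2)"
      using m[OF onb_mem_T[OF e, of x y]] unfolding II_expand[OF q e] inner_onb[OF e]
      by (simp add: power2_eq_square algebra_simps)
  qed
qed

text \<open>\<open>sqrt\<close> is odd, so a negative radicand would give a negative value; with
  matrix entries a, b, c the radicand is ((a - c) / 2)^2 + b^2.\<close>

lemma lam_curv_nonneg: "q \<in> S \<Longrightarrow> lam_curv S n q \<ge> 0"
proof -
  assume q: "q \<in> S"
  obtain e1 e2 where H: 
    "lam_curv S n q = sqrt (((II q e1 e1 + II q e2 e2) / 2)\<^sup>2 - (II q e1 e1 * II q e2 e2 - (II q e1 e2)\<^sup>2))"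
    using curvatures_onb[OF q] .
  have "((II q e1 e1 + II q e2 e2) / 2)\<^sup>2 - (II q e1 e1 * II q e2 e2 - (II q e1 e2)\<^sup>2)
     = ((II q e1 e1 - II q e2 e2) / 2)\<^sup>2 + (II q e1 e2)\<^sup>2" by (simp add: field_simps power2_eq_square)
  then have "0 \<le> ((II q e1 e1 + II q e2 e2) / 2)\<^sup>2 - (II q e1 e1 * II q e2 e2 - (II q e1 e2)\<^sup>2)"
    by (metis add_nonneg_nonneg zero_le_power2)
  then show ?thesis unfolding H by (rule real_sqrt_ge_zero)
qed

text \<open>Images of chart lines. The chart influences their second derivatives only in the
  tangential direction; the components along \<open>q\<close> and \<open>n q\<close> are intrinsic
  and are all that later pairings use.\<close>

lemma obtain_curve:
  assumes q: "q \<in> S" and v: "v \<in> T q"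
  obtains c c1 c2 N1 N2 :: "real \<Rightarrow> real^4" and d where "d > 0" "c 0 = q" "c1 0 = v" "N1 0 = dN S n q v"
    "\<And>t. \<bar>t\<bar> < d \<Longrightarrow> c t \<in> S"
    "\<And>t. \<bar>t\<bar> < d \<Longrightarrow> (c has_vector_derivative c1 t) (at t)"
    "\<And>t. \<bar>t\<bar> < d \<Longrightarrow> (c1 has_vector_derivative c2 t) (at t)"
    "\<And>t. \<bar>t\<bar> < d \<Longrightarrow> ((\<lambda>t. n (c t)) has_vector_derivative N1 t) (at t)"
    "\<And>t. \<bar>t\<bar> < d \<Longrightarrow> (N1 has_vector_derivative N2 t) (at t)"
    "c2 0 \<bullet> q = - (v \<bullet> v)" "c2 0 \<bullet> n q = II q v v"
    "N2 0 \<bullet> q = II q v v" "N2 0 \<bullet> n q = - (dN S n q v \<bullet> dN S n q v)"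
proof -
  obtain V \<phi> a where c: "chart S V \<phi>" "a \<in> V" "\<phi> a = q" and cov: "\<forall>v\<in>T q. \<exists>u. v = pd \<phi> u a"
    using obtain_tangent_coords[OF q] .
  obtain u where u: "v = pd \<phi> u a" using cov v by blast
  note C = chartD[OF c(1)]
  have "((\<lambda>t. a + t *\<^sub>R u) \<longlongrightarrow> a + 0 *\<^sub>R u) (nhds 0)"
    by (intro tendsto_intros filterlim_ident)
  then have "eventually (\<lambda>t. a + t *\<^sub>R u \<in> V) (nhds 0)"
    by (rule topological_tendstoD[OF _ C(1)]) (use c(2) in simp)
  then obtain d where d: "d > 0" "\<And>t::real. \<bar>t\<bar> < d \<Longrightarrow> a + t *\<^sub>R u \<in> V"
    unfolding eventually_nhds_metric by auto
  have dNv: "dN S n q v = pd (n \<circ> \<phi>) u a" using dN_pd[OF c(1,2)] u c(3) by simp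
  have IIv: "II q v v = - (pd (n \<circ> \<phi>) u a \<bullet> pd \<phi> u a)" unfolding second_ff_def dNv by (simp add: inner_commute u)
  have 1: "pd (pd \<phi> u) u a \<bullet> q = - (v \<bullet> v)"
    using pd_inner_const[OF smooth_on_pd[OF C(2)] C(2,1) c(2), of u 0 u] pd_orth(1)[OF c(1)] c(3) u by simp
  have 2: "pd (pd \<phi> u) u a \<bullet> n q = II q v v"
    using pd_orth(5)[OF c(1,2), of u u] c(3) unfolding IIv by (simp add: inner_commute)
  have 3: "pd (pd (n \<circ> \<phi>) u) u a \<bullet> q = II q v v"
    using pd_inner_const[OF smooth_on_pd[OF C(8)] C(2,1) c(2), of u 0 u] pd_orth(3)[OF c(1)] c(3)
    unfolding IIv by simp
  have 4: "pd (pd (n \<circ> \<phi>) u) u a \<bullet> n q = - (dN S n q v \<bullet> dN S n q v)"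
    using pd_inner_const[OF smooth_on_pd[OF C(8)] C(8,1) c(2), of u 0 u] pd_orth(4)[OF c(1)] c(3)
    unfolding dNv by simp
  let ?l = "\<lambda>f t. f (a + t *\<^sub>R u)"
  show ?thesis
  proof (rule that[of d "?l \<phi>" "?l (pd \<phi> u)" "?l (pd (n \<circ> \<phi>) u)" "?l (pd (pd \<phi> u) u)" "?l (pd (pd (n \<circ> \<phi>) u) u)"])
    show "\<And>t. \<bar>t\<bar> < d \<Longrightarrow> ((\<lambda>t. n (\<phi> (a + t *\<^sub>R u))) has_vector_derivative pd (n \<circ> \<phi>) u (a + t *\<^sub>R u)) (at t)"
      using has_vector_derivative_line[OF C(8)] d(2) by simp
  qed (use d c u dNv 1 2 3 4 C(4) has_vector_derivative_line[OF C(2)] has_vector_derivative_line[OF smooth_on_pd[OF C(2)]]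
      has_vector_derivative_line[OF smooth_on_pd[OF C(8)]] in auto)
qed

end

subsection \<open>Local touching bounds\<close>

text \<open>Turns definiteness into two strict inequalities between the coefficients, an open
  condition that continuity carries to nearby points.\<close>

lemma negative_definite_discriminant:
  fixes a b c :: real
  assumes "\<And>x y. (x, y) \<noteq> (0, 0) \<Longrightarrow> a * x\<^sup>2 + 2 * b * x * y + c * y\<^sup>2 < 0"
  shows "a < 0" "a * c - b\<^sup>2 > 0"
proof -
  show a: "a < 0" using assms[of 1 0] by simp
  have "a * b\<^sup>2 + 2 * b * b * (- a) + c * a\<^sup>2 < 0" using assms[of b "- a"] a by simp
  then have "a * (a * c - b\<^sup>2) < 0" by (simp add: algebra_simps power2_eq_square)
  then show "a * c - b\<^sup>2 > 0" using a by (simp add: mult_less_0_iff)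
qed

lemma nonpositive_quadratic_form:
  fixes a b c :: real
  assumes "a < 0" "a * c - b\<^sup>2 > 0"
  shows "a * x\<^sup>2 + 2 * b * x * y + c * y\<^sup>2 \<le> 0"
proof -
  have "a * (a * x\<^sup>2 + 2 * b * x * y + c * y\<^sup>2) = (a * x + b * y)\<^sup>2 + (a * c - b\<^sup>2) * y\<^sup>2"
    by (simp add: algebra_simps power2_eq_square)
  then have "a * (a * x\<^sup>2 + 2 * b * x * y + c * y\<^sup>2) \<ge> 0" using assms(2) by simp
  then show ?thesis using assms(1) by (simp add: zero_le_mult_iff)
qed

text \<open>Continuity of three coefficient functions thus controls every direction \<open>w\<close>
  at once.\<close>

lemma pd_pd_quadratic:
  fixes f :: "real^2 \<Rightarrow> 'b::euclidean_space"
  assumes sm: "smooth_on V f" and V: "open V" "x \<in> V"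
  defines "e1 \<equiv> axis 1 1 :: real^2" and "e2 \<equiv> axis 2 1 :: real^2"
  shows "pd (pd f w) w x = (w $ 1)\<^sup>2 *\<^sub>R pd (pd f e1) e1 x + (2 * w $ 1 * w $ 2) *\<^sub>R pd (pd f e1) e2 x
     + (w $ 2)\<^sup>2 *\<^sub>R pd (pd f e2) e2 x"
proof -
  have w: "w = w $ 1 *\<^sub>R e1 + w $ 2 *\<^sub>R e2"
    unfolding e1_def e2_def by (simp add: vec_eq_iff axis_def forall_2)
  have lin: "pd (pd f u) w x = w $ 1 *\<^sub>R pd (pd f u) e1 x + w $ 2 *\<^sub>R pd (pd f u) e2 x" for u
  proof -
    note l = linear_pd[OF smooth_on_pd[OF sm, of u] V(2)]
    show ?thesis by (subst w) (simp only: linear_add[OF l] linear_cmul[OF l])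
  qed
  have "pd (pd f w) w x = w $ 1 *\<^sub>R pd (pd f e1) w x + w $ 2 *\<^sub>R pd (pd f e2) w x"
    unfolding lin[of w] by (simp add: pd_commute[OF sm V, of w])
  then show ?thesis
    unfolding lin[of e1] lin[of e2] pd_commute[OF sm V, of e2 e1]
    by (simp add: scaleR_add_right scaleR_add_left power2_eq_square algebra_simps flip: scaleR_2)
qed

context unit_normal_surface
begin

lemma n_continuous: "continuous_on S n"
  unfolding continuous_on_eq_continuous_within
proof
  fix q assume q: "q \<in> S"
  obtain V \<phi> a where c: "chart S V \<phi>" "a \<in> V" "\<phi> a = q" using obtain_chart[OF q] .
  note C = chartD[OF c(1)]
  have "continuous_on (\<phi> ` V) ((n \<circ> \<phi>) \<circ> inv_into V \<phi>)"
    by (intro continuous_on_compose C(6) continuous_on_subset[OF smooth_on_continuous[OF C(8)]])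
      (auto simp: inv_into_into)
  then have "continuous_on (\<phi> ` V) n"
    by (rule continuous_on_eq) (simp add: f_inv_into_f)
  then have "continuous (at q within \<phi> ` V) n"
    using c by (auto simp: continuous_on_eq_continuous_within)
  moreover obtain O' where O': "open O'" "\<phi> ` V = S \<inter> O'" using C(5) by (auto simp: openin_open)
  have "at q within \<phi> ` V = at q within S"
    by (rule at_within_nhd[of q O']) (use O' c in auto)
  ultimately show "continuous (at q within S) n" by simp
qed

lemma openin_chart_image:
  assumes c: "chart S V \<phi>" and B: "open B" "B \<subseteq> V"
  shows "openin (top_of_set S) (\<phi> ` B)"
proof -
  note C = chartD[OF c]
  have "openin (top_of_set (\<phi> ` V)) (\<phi> ` V \<inter> inv_into V \<phi> -` B)"
    using continuous_openin_preimage_gen[OF C(6) B(1)] .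
  then have "openin (top_of_set S) (\<phi> ` V \<inter> inv_into V \<phi> -` B)"
    using C(5) openin_trans by blast
  moreover have "\<phi> ` V \<inter> inv_into V \<phi> -` B = \<phi> ` B"
    using C(3) B(2) by (auto simp: inv_into_f_f subset_iff)
  ultimately show ?thesis by simp
qed

text \<open>Along a chart segment from \<open>q = \<phi> a\<close>, the function \<open>x \<mapsto> x \<bullet> (s n(q) + \<kappa> q)\<close> starts at a
  critical point and is concave.\<close>
lemma local_touching_bound:
  assumes q0: "q0 \<in> S" and neg: "\<And>v. v \<in> T q0 \<Longrightarrow> v \<noteq> 0 \<Longrightarrow> s * II q0 v v < \<kappa> * (v \<bullet> v)"
  shows "\<exists>\<delta>>0. \<forall>q\<in>S. \<forall>x\<in>S. dist q q0 < \<delta> \<longrightarrow> dist x q0 < \<delta> \<longrightarrow> s * (x \<bullet> n q) \<le> \<kappa> * (1 - x \<bullet> q)"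
proof -
  obtain V \<phi> a0 where c: "chart S V \<phi>" "a0 \<in> V" "\<phi> a0 = q0" using obtain_chart[OF q0] .
  note C = chartD[OF c(1)]
  define m where "m a = s *\<^sub>R n (\<phi> a) + \<kappa> *\<^sub>R \<phi> a" for a
  \<comment> \<open>Base point and evaluation point are separate arguments: along a segment starting
    at \<open>a\<close> the vector \<open>m a\<close> stays fixed while the second derivative of the
    chart moves.\<close>
  define h where "h i j p = m (fst p) \<bullet> pd (pd \<phi> i) j (snd p)" for i j p
  define e1 e2 :: "real^2" where "e1 = axis 1 1" and "e2 = axis 2 1"
  have hq: "m a \<bullet> pd (pd \<phi> w) w x = h e1 e1 (a, x) * (w $ 1)\<^sup>2 + 2 * h e1 e2 (a, x) * w $ 1 * w $ 2
      + h e2 e2 (a, x) * (w $ 2)\<^sup>2" if "x \<in> V" for a x w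
    unfolding pd_pd_quadratic[OF C(2,1) that, of w] h_def e1_def e2_def
    by (simp add: inner_add_right algebra_simps)
  have neg0: "h e1 e1 (a0, a0) * x\<^sup>2 + 2 * h e1 e2 (a0, a0) * x * y + h e2 e2 (a0, a0) * y\<^sup>2 < 0"
    if "(x, y) \<noteq> (0, 0)" for x y
  proof -
    define w :: "real^2" where "w = vector [x, y]"
    have wc: "w $ 1 = x" "w $ 2 = y" unfolding w_def by simp_all
    have w: "w \<noteq> 0" using that wc by (auto simp: vec_eq_iff forall_2)
    let ?v = "pd \<phi> w a0"
    have v: "?v \<in> T q0" using range_pd_eq_T[OF c(1,2)] c(3) by blast
    have "pd \<phi> 0 a0 = 0" using linear_0[OF linear_pd[OF C(2) c(2)]] .
    then have "?v \<noteq> 0" using C(7)[OF c(2)] w unfolding inj_def by metis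
    moreover have "n q0 \<bullet> pd (pd \<phi> w) w a0 = II q0 ?v ?v"
      using pd_orth(5)[OF c(1,2), of w w] dN_pd[OF c(1,2), of w] c(3)
      unfolding second_ff_def by (simp add: inner_commute)
    moreover have "q0 \<bullet> pd (pd \<phi> w) w a0 = - (?v \<bullet> ?v)"
      using pd_inner_const[OF smooth_on_pd[OF C(2)] C(2,1) c(2), of w 0 w] pd_orth(1)[OF c(1)] c(3)
      by (simp add: inner_commute)
    ultimately have "m a0 \<bullet> pd (pd \<phi> w) w a0 < 0"
      using neg[OF v] c(3) unfolding m_def by (simp add: inner_add_left)
    then show ?thesis using hq[OF c(2), of a0 w] wc by simp
  qed
  have contm: "continuous_on V m"
    unfolding m_def using smooth_on_continuous[OF C(8)] smooth_on_continuous[OF C(2)]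
    by (intro continuous_intros) (simp_all add: o_def)
  have cont: "continuous_on (V \<times> V) (h i j)" for i j
    unfolding h_def
    by (intro continuous_on_inner continuous_on_compose2[OF contm] continuous_on_compose2[OF smooth_on_continuous[OF smooth_on_pd[OF smooth_on_pd[OF C(2)]]]]
        continuous_on_fst continuous_on_snd continuous_on_id) auto
  define D where "D p = h e1 e1 p * h e2 e2 p - (h e1 e2 p)\<^sup>2" for p
  have contD: "continuous_on (V \<times> V) D" unfolding D_def by (intro continuous_intros cont)
  have oV: "open (V \<times> V)" using C(1) by (simp add: open_Times)
  have "open ((V \<times> V) \<inter> h e1 e1 -` {..<0} \<inter> ((V \<times> V) \<inter> D -` {0<..}))"
    by (intro open_Int continuous_open_preimage[OF cont oV] continuous_open_preimage[OF contD oV]) auto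
  moreover have "(a0, a0) \<in> (V \<times> V) \<inter> h e1 e1 -` {..<0} \<inter> ((V \<times> V) \<inter> D -` {0<..})"
    using negative_definite_discriminant[OF neg0] c(2) unfolding D_def by simp
  ultimately obtain A B where AB: "open A" "open B" "a0 \<in> A" "a0 \<in> B"
      "A \<times> B \<subseteq> (V \<times> V) \<inter> h e1 e1 -` {..<0} \<inter> ((V \<times> V) \<inter> D -` {0<..})"
    by (rule open_prod_elim) auto
  have "open (A \<inter> B)" "a0 \<in> A \<inter> B" using AB by auto
  then obtain r where r: "r > 0" "ball a0 r \<subseteq> A \<inter> B" by (meson open_contains_ball)
  have P: "h e1 e1 (a, x) < 0" "D (a, x) > 0" "x \<in> V" if "a \<in> ball a0 r" "x \<in> ball a0 r" for a x
  proof -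
    have "(a, x) \<in> A \<times> B" using r(2) that by auto
    then have "(a, x) \<in> (V \<times> V) \<inter> h e1 e1 -` {..<0} \<inter> ((V \<times> V) \<inter> D -` {0<..})" using AB(5) by blast
    then show "h e1 e1 (a, x) < 0" "D (a, x) > 0" "x \<in> V" by auto
  qed
  have rV: "ball a0 r \<subseteq> V" using P(3) by blast
  have key: "s * (\<phi> b \<bullet> n (\<phi> a)) \<le> \<kappa> * (1 - \<phi> b \<bullet> \<phi> a)" if a: "a \<in> ball a0 r" and b: "b \<in> ball a0 r" for a b
  proof -
    define w where "w = b - a"
    have seg: "a + t *\<^sub>R w \<in> ball a0 r" if "0 \<le> t" "t \<le> 1" for t
      using mem_convex_alt[OF convex_ball a b, of "1 - t" t] that unfolding w_def
      by (simp add: algebra_simps)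
    have aV: "a \<in> V" using a rV by blast
    let ?g = "\<lambda>t. m a \<bullet> \<phi> (a + t *\<^sub>R w)"
    let ?g1 = "\<lambda>t. m a \<bullet> pd \<phi> w (a + t *\<^sub>R w)"
    let ?g2 = "\<lambda>t. m a \<bullet> pd (pd \<phi> w) w (a + t *\<^sub>R w)"
    have d1: "(?g has_real_derivative ?g1 t) (at t)" if "0 \<le> t" "t \<le> 1" for t
      unfolding has_real_derivative_iff_has_vector_derivative
      by (rule bounded_linear.has_vector_derivative[OF bounded_linear_inner_right has_vector_derivative_line[OF C(2)]])
        (use seg[OF that] rV in blast)
    have d2: "(?g1 has_real_derivative ?g2 t) (at t)" if "0 \<le> t" "t \<le> 1" for t
      unfolding has_real_derivative_iff_has_vector_derivative
      by (rule bounded_linear.has_vector_derivative[OF bounded_linear_inner_right has_vector_derivative_line[OF smooth_on_pd[OF C(2)]]])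
        (use seg[OF that] rV in blast)
    have g2: "?g2 t \<le> 0" if "0 \<le> t" "t \<le> 1" for t
      unfolding hq[OF P(3)[OF a seg[OF that]]]
      by (rule nonpositive_quadratic_form) (use P[OF a seg[OF that]] in \<open>auto simp: D_def\<close>)
    have g10: "?g1 0 = 0"
      using pd_orth(1,2)[OF c(1) aV, of w] unfolding m_def by (simp add: inner_add_left inner_commute[of "pd \<phi> w a" "\<phi> a"])
    have g1: "?g1 t \<le> 0" if "0 \<le> t" "t \<le> 1" for t
    proof -
      have "?g1 t \<le> ?g1 0"
      proof (rule DERIV_nonpos_imp_nonincreasing[of 0 t ?g1, OF that(1)])
        fix y assume "0 \<le> y" "y \<le> t"
        then show "\<exists>z. (?g1 has_real_derivative z) (at y) \<and> z \<le> 0" using d2[of y] g2[of y] that(2) by auto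
      qed
      then show ?thesis using g10 by simp
    qed
    have "?g 1 \<le> ?g 0"
    proof (rule DERIV_nonpos_imp_nonincreasing[of 0 1 ?g])
      fix y :: real assume "0 \<le> y" "y \<le> 1"
      then show "\<exists>z. (?g has_real_derivative z) (at y) \<and> z \<le> 0" using d1[of y] g1[of y] by auto
    qed simp
    moreover have "?g 0 = \<kappa>"
      using C(4)[OF aV] n_orth inner_self_S unfolding m_def by (simp add: inner_add_left)
    moreover have "?g 1 = s * (\<phi> b \<bullet> n (\<phi> a)) + \<kappa> * (\<phi> b \<bullet> \<phi> a)"
      unfolding m_def w_def by (simp add: inner_add_left inner_add_right inner_commute)
    ultimately show ?thesis by (simp add: algebra_simps)
  qed
  obtain \<delta> where d: "\<delta> > 0" "\<forall>q\<in>S. dist q (\<phi> a0) < \<delta> \<longrightarrow> q \<in> \<phi> ` ball a0 r"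
    using openin_chart_image[OF c(1) open_ball rV] r(1)
    unfolding openin_euclidean_subtopology_iff by (metis centre_in_ball imageI)
  show ?thesis
  proof (intro exI[of _ \<delta>] conjI ballI impI d(1))
    fix q x assume "q \<in> S" "x \<in> S" "dist q q0 < \<delta>" "dist x q0 < \<delta>"
    then have "q \<in> \<phi> ` ball a0 r" "x \<in> \<phi> ` ball a0 r" using d(2) c(3) by blast+
    then show "s * (x \<bullet> n q) \<le> \<kappa> * (1 - x \<bullet> q)" using key by blast
  qed
qed

lemma one_minus_inner: "q \<in> S \<Longrightarrow> x \<in> S \<Longrightarrow> 1 - x \<bullet> q = (dist x q)\<^sup>2 / 2"
  using inner_self_S[of q] inner_self_S[of x]
  unfolding dist_norm power2_norm_eq_inner by (simp add: inner_diff_left inner_diff_right inner_commute)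

lemma inner_n_bounds: "q \<in> S \<Longrightarrow> x \<in> S \<Longrightarrow> \<bar>x \<bullet> n q\<bar> \<le> 1"
  using Cauchy_Schwarz_ineq2[of x "n q"] norm_S[of x] n_unit[of q] by simp

text \<open>With \<alpha> = cos d and \<beta> = sin d the hypothesis says that the ball of radius d
  about \<alpha> q + \<beta> n(q) has no point of \<open>S\<close> in its interior. Keeping both
  coefficients instead of their quotient covers \<beta> = 0.\<close>

lemma touching_second_order:
  assumes q: "q \<in> S" and le: "\<And>x. x \<in> S \<Longrightarrow> \<alpha> * (x \<bullet> q) + \<beta> * (x \<bullet> n q) \<le> \<alpha>" and v: "v \<in> T q"
  shows "\<beta> * II q v v \<le> \<alpha> * (v \<bullet> v)"
proof -
  obtain c c1 c2 N1 N2 :: "real \<Rightarrow> real^4" and d where c: "d > 0" "c 0 = q" "c1 0 = v" "N1 0 = dN S n q v"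
    "\<And>t. \<bar>t\<bar> < d \<Longrightarrow> c t \<in> S"
    "\<And>t. \<bar>t\<bar> < d \<Longrightarrow> (c has_vector_derivative c1 t) (at t)"
    "\<And>t. \<bar>t\<bar> < d \<Longrightarrow> (c1 has_vector_derivative c2 t) (at t)"
    "c2 0 \<bullet> q = - (v \<bullet> v)" "c2 0 \<bullet> n q = II q v v"
    by (rule obtain_curve[OF q v]) blast
  define p where "p = \<alpha> *\<^sub>R q + \<beta> *\<^sub>R n q"
  have d1: "((\<lambda>t. - (c t \<bullet> p)) has_real_derivative - (c1 t \<bullet> p)) (at t)" if "\<bar>t\<bar> < d" for t
    unfolding has_real_derivative_iff_has_vector_derivative
    by (intro has_vector_derivative_minus bounded_linear.has_vector_derivative[OF bounded_linear_inner_left c(6)[OF that]])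
  have d2: "((\<lambda>t. - (c1 t \<bullet> p)) has_real_derivative - (c2 0 \<bullet> p)) (at 0)"
    unfolding has_real_derivative_iff_has_vector_derivative
    by (intro has_vector_derivative_minus bounded_linear.has_vector_derivative[OF bounded_linear_inner_left c(7)]) (use c(1) in simp)
  have "- (c 0 \<bullet> p) \<le> - (c t \<bullet> p)" if "\<bar>t\<bar> < d" for t
    using le[OF c(5)[OF that]] c(2) inner_self_S[OF q] n_orth[OF q]
    unfolding p_def by (simp add: inner_add_right inner_commute)
  from second_derivative_at_min(2)[OF c(1) d1 d2 this] show ?thesis
    unfolding p_def by (simp add: inner_add_right c(8,9))
qed

lemma critical_point_orthogonal:
  assumes x: "x \<in> S" and le: "\<And>z. z \<in> S \<Longrightarrow> z \<bullet> p \<le> x \<bullet> p" and v: "v \<in> T x"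
  shows "v \<bullet> p = 0"
proof -
  obtain c c1 c2 N1 N2 :: "real \<Rightarrow> real^4" and d where c: "d > 0" "c 0 = x" "c1 0 = v" "N1 0 = dN S n x v"
    "\<And>t. \<bar>t\<bar> < d \<Longrightarrow> c t \<in> S"
    "\<And>t. \<bar>t\<bar> < d \<Longrightarrow> (c has_vector_derivative c1 t) (at t)"
    "\<And>t. \<bar>t\<bar> < d \<Longrightarrow> (c1 has_vector_derivative c2 t) (at t)"
    by (rule obtain_curve[OF x v]) blast
  have d1: "((\<lambda>t. - (c t \<bullet> p)) has_real_derivative - (c1 t \<bullet> p)) (at t)" if "\<bar>t\<bar> < d" for t
    unfolding has_real_derivative_iff_has_vector_derivative
    by (intro has_vector_derivative_minus bounded_linear.has_vector_derivative[OF bounded_linear_inner_left c(6)[OF that]])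
  have d2: "((\<lambda>t. - (c1 t \<bullet> p)) has_real_derivative - (c2 0 \<bullet> p)) (at 0)"
    unfolding has_real_derivative_iff_has_vector_derivative
    by (intro has_vector_derivative_minus bounded_linear.has_vector_derivative[OF bounded_linear_inner_left c(7)]) (use c(1) in simp)
  have "- (c 0 \<bullet> p) \<le> - (c t \<bullet> p)" if "\<bar>t\<bar> < d" for t
    using le[OF c(5)[OF that]] c(2) by simp
  from second_derivative_at_min(1)[OF c(1) d1 d2 this] show ?thesis
    by (simp add: c(3))
qed

lemma normal_decomposition:
  assumes x: "x \<in> S" and orth: "\<And>v. v \<in> T x \<Longrightarrow> v \<bullet> p = 0"
  shows "p = (p \<bullet> x) *\<^sub>R x + (p \<bullet> n x) *\<^sub>R n x"
proof -
  define p' where "p' = p - ((p \<bullet> x) *\<^sub>R x + (p \<bullet> n x) *\<^sub>R n x)"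
  have "p' \<in> T x" unfolding T_def p'_def using inner_self_S[OF x] n_orth[OF x]
    by (simp add: inner_diff_left inner_add_left inner_commute[of x "n x"])
  then have "p' \<bullet> p = 0" "p' \<bullet> x = 0" "p' \<bullet> n x = 0" using orth by (auto simp: T_def)
  then have "p' \<bullet> p' = 0" by (subst (2) p'_def) (simp add: inner_diff_right inner_add_right)
  then show ?thesis unfolding p'_def by simp
qed

lemma exists_tangent_nonzero:
  assumes "q \<in> S"
  obtains v where "v \<in> T q" "v \<noteq> 0"
proof -
  obtain e1 e2 where "onb q e1 e2" using onb_tangent_onb[OF assms] by blast
  then have "e1 \<in> T q" "e1 \<bullet> e1 = 1" unfolding onb_def by blast+
  then show ?thesis using that[of e1] by (metis inner_zero_left zero_neq_one)
qed

end

section \<open>Uniform estimates from compactness\<close>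

locale compact_normal_surface = unit_normal_surface +
  assumes cpt: "compact S" and ne: "S \<noteq> {}"
begin

text \<open>Balls of one fixed size touch \<open>S\<close> from both sides: near the diagonal by
  \<open>local_touching_bound\<close> with both signs, elsewhere because 1 - x \<bullet> q is
  bounded below. This bounds the principal curvatures and keeps a collar on the negative side off
  \<open>S\<close>.\<close>

lemma quadratic_bound:
  obtains C where "C > 0" "\<And>q x. q \<in> S \<Longrightarrow> x \<in> S \<Longrightarrow> \<bar>x \<bullet> n q\<bar> \<le> C * (1 - x \<bullet> q)"
proof -
  have "\<exists>k \<delta>. k > 0 \<and> \<delta> > 0 \<and> (\<forall>q\<in>S. \<forall>x\<in>S. dist q q0 < \<delta> \<longrightarrow> dist x q0 < \<delta> \<longrightarrow> \<bar>x \<bullet> n q\<bar> \<le> k * (1 - x \<bullet> q))"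
    if q0: "q0 \<in> S" for q0
  proof -
    define k where "k = \<bar>kmax q0\<bar> + \<bar>kmax q0 - 2 * mean_curv S n q0\<bar> + 1"
    have pos: "v \<bullet> v > 0" if "v \<noteq> 0" for v :: "real^4" using that by simp
    have b1: "1 * II q0 v v < k * (v \<bullet> v)" if "v \<in> T q0" "v \<noteq> 0" for v
    proof -
      have "kmax q0 * (v \<bullet> v) < k * (v \<bullet> v)" unfolding k_def using pos[OF that(2)] by (intro mult_strict_right_mono) auto
      then show ?thesis using II_le_kmax[OF q0 that(1)] by simp
    qed
    have b2: "-1 * II q0 v v < k * (v \<bullet> v)" if "v \<in> T q0" "v \<noteq> 0" for v
    proof -
      have "(kmax q0 - 2 * mean_curv S n q0) * (v \<bullet> v) < k * (v \<bullet> v)"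
        unfolding k_def using pos[OF that(2)] by (intro mult_strict_right_mono) auto
      then show ?thesis using II_ge_neg[OF q0 that(1)] by simp
    qed
    obtain \<delta>1 where 1: "\<delta>1 > 0" "\<forall>q\<in>S. \<forall>x\<in>S. dist q q0 < \<delta>1 \<longrightarrow> dist x q0 < \<delta>1 \<longrightarrow> 1 * (x \<bullet> n q) \<le> k * (1 - x \<bullet> q)"
      using local_touching_bound[OF q0 b1] by blast
    obtain \<delta>2 where 2: "\<delta>2 > 0" "\<forall>q\<in>S. \<forall>x\<in>S. dist q q0 < \<delta>2 \<longrightarrow> dist x q0 < \<delta>2 \<longrightarrow> -1 * (x \<bullet> n q) \<le> k * (1 - x \<bullet> q)"
      using local_touching_bound[OF q0 b2] by blast
    have "\<bar>x \<bullet> n q\<bar> \<le> k * (1 - x \<bullet> q)"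
      if "q \<in> S" "x \<in> S" "dist q q0 < min \<delta>1 \<delta>2" "dist x q0 < min \<delta>1 \<delta>2" for q x
    proof -
      have "1 * (x \<bullet> n q) \<le> k * (1 - x \<bullet> q)" using 1(2) that by simp
      moreover have "-1 * (x \<bullet> n q) \<le> k * (1 - x \<bullet> q)" using 2(2)[rule_format, of q x] that by simp
      ultimately show ?thesis by simp
    qed
    moreover have "k > 0" unfolding k_def by simp
    moreover have "min \<delta>1 \<delta>2 > 0" using 1(1) 2(1) by simp
    ultimately show ?thesis by blast
  qed
  then obtain k \<delta> where kd: "\<And>q0. q0 \<in> S \<Longrightarrow> k q0 > 0" "\<And>q0. q0 \<in> S \<Longrightarrow> \<delta> q0 > 0"
    "\<And>q0 q x. q0 \<in> S \<Longrightarrow> q \<in> S \<Longrightarrow> x \<in> S \<Longrightarrow> dist q q0 < \<delta> q0 \<Longrightarrow> dist x q0 < \<delta> q0 \<Longrightarrow> \<bar>x \<bullet> n q\<bar> \<le> k q0 * (1 - x \<bullet> q)"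
    by metis
  \<comment> \<open>Halved radii: if \<open>q\<close> lies in the half ball about \<open>q0\<close>
    and \<open>x\<close> is within \<open>d\<close> of \<open>q\<close>, then both lie in the full
    ball, where the local bound holds.\<close>
  have "S \<subseteq> (\<Union>q0\<in>S. ball q0 (\<delta> q0 / 2))" using kd(2) by force
  then obtain D where D: "D \<subseteq> S" "finite D" "S \<subseteq> (\<Union>q0\<in>D. ball q0 (\<delta> q0 / 2))"
    using compactE_image[OF cpt, of S "\<lambda>q0. ball q0 (\<delta> q0 / 2)"] by auto
  have Dne: "D \<noteq> {}" using D(3) ne by blast
  define d where "d = Min ((\<lambda>q0. \<delta> q0 / 2) ` D)"
  have d: "d > 0" "\<And>q0. q0 \<in> D \<Longrightarrow> d \<le> \<delta> q0 / 2"
  proof -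
    show "d > 0" unfolding d_def using D Dne kd(2) by (subst Min_gr_iff) auto
    show "d \<le> \<delta> q0 / 2" if "q0 \<in> D" for q0 unfolding d_def using D(2) that by (intro Min_le) auto
  qed
  \<comment> \<open>The sum of the finitely many \<open>k q0\<close> serves near pairs; for pairs at
    distance at least \<open>d\<close> the summand 2 / d^2 suffices, since |x \<bullet> n q| \<le> 1
    and 1 - x \<bullet> q \<ge> d^2 / 2.\<close>
  define C where "C = (\<Sum>q0\<in>D. k q0) + 2 / d\<^sup>2"
  have sum_ge: "k q0 \<le> (\<Sum>q0\<in>D. k q0)" if "q0 \<in> D" for q0
    by (rule member_le_sum[OF that]) (use D kd(1) in \<open>auto intro: less_imp_le\<close>)
  have sum0: "(\<Sum>q0\<in>D. k q0) \<ge> 0" by (rule sum_nonneg) (use D kd(1) in \<open>auto intro: less_imp_le\<close>)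
  have C: "\<bar>x \<bullet> n q\<bar> \<le> C * (1 - x \<bullet> q)" if q: "q \<in> S" and x: "x \<in> S" for q x
  proof (cases "dist x q < d")
    case True
    obtain q0 where q0: "q0 \<in> D" "dist q q0 < \<delta> q0 / 2" using D(3) q by (auto simp: dist_commute)
    have "dist x q0 < \<delta> q0" using dist_triangle[of x q0 q] True q0 d(2)[OF q0(1)] by linarith
    moreover have "dist q q0 < \<delta> q0" using q0 kd(2)[of q0] D(1) by force
    ultimately have "\<bar>x \<bullet> n q\<bar> \<le> k q0 * (1 - x \<bullet> q)" using kd(3)[of q0 q x] q x q0(1) D(1) by blast
    also have "\<dots> \<le> C * (1 - x \<bullet> q)"
      using sum_ge[OF q0(1)] d(1) unfolding C_def one_minus_inner[OF q x]
      by (intro mult_right_mono) (auto intro: order_trans)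
    finally show ?thesis .
  next
    case False
    have "1 \<le> 2 / d\<^sup>2 * ((dist x q)\<^sup>2 / 2)" using False d(1) by (simp add: power_mono field_simps)
    also have "\<dots> \<le> C * ((dist x q)\<^sup>2 / 2)" unfolding C_def
      by (intro mult_right_mono) (use sum0 in auto)
    finally show ?thesis using inner_n_bounds[OF q x] unfolding one_minus_inner[OF q x] by simp
  qed
  have "C > 0" unfolding C_def using d(1) sum0 by (simp add: add_nonneg_pos)
  then show ?thesis using that C by blast
qed

text \<open>Makes \<open>Sup\<close> of the curvatures meaningful. The touching bound replaces a
  continuity argument for \<open>kmax\<close>.\<close>

lemma kmax_bdd_above: "bdd_above (kmax ` S)"
proof -
  obtain C where C: "\<And>q x. q \<in> S \<Longrightarrow> x \<in> S \<Longrightarrow> \<bar>x \<bullet> n q\<bar> \<le> C * (1 - x \<bullet> q)"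
    using quadratic_bound by metis
  have "kmax q \<le> C" if q: "q \<in> S" for q
  proof (rule kmax_le[OF q])
    fix v assume v: "v \<in> T q"
    have "C * (x \<bullet> q) + 1 * (x \<bullet> n q) \<le> C" if "x \<in> S" for x
      using C[OF q that] by (simp add: algebra_simps)
    from touching_second_order[OF q this v] show "II q v v \<le> C * (v \<bullet> v)" by simp
  qed
  then show ?thesis by (intro bdd_aboveI2)
qed

text \<open>Controls Z near the diagonal: a Lebesgue number for the balls given by
  \<open>local_touching_bound\<close> serves all pairs.\<close>

lemma uniform_touching_bound:
  assumes neg: "\<And>q. q \<in> S \<Longrightarrow> kmax q < \<kappa>"
  shows "\<exists>\<delta>>0. \<forall>q\<in>S. \<forall>x\<in>S. dist q x < \<delta> \<longrightarrow> x \<bullet> n q \<le> \<kappa> * (1 - x \<bullet> q)"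
proof -
  have "\<exists>\<delta>>0. \<forall>q\<in>S. \<forall>x\<in>S. dist q q0 < \<delta> \<longrightarrow> dist x q0 < \<delta> \<longrightarrow> 1 * (x \<bullet> n q) \<le> \<kappa> * (1 - x \<bullet> q)"
    if q0: "q0 \<in> S" for q0
  proof (rule local_touching_bound[OF q0])
    fix v assume v: "v \<in> T q0" "v \<noteq> 0"
    have "kmax q0 * (v \<bullet> v) < \<kappa> * (v \<bullet> v)" using neg[OF q0] v(2) by (intro mult_strict_right_mono) auto
    then show "1 * II q0 v v < \<kappa> * (v \<bullet> v)" using II_le_kmax[OF q0 v(1)] by simp
  qed
  then obtain \<delta> where \<delta>: "\<And>q0. q0 \<in> S \<Longrightarrow> \<delta> q0 > 0"
    "\<And>q0 q x. q0 \<in> S \<Longrightarrow> q \<in> S \<Longrightarrow> x \<in> S \<Longrightarrow> dist q q0 < \<delta> q0 \<Longrightarrow> dist x q0 < \<delta> q0 \<Longrightarrow> x \<bullet> n q \<le> \<kappa> * (1 - x \<bullet> q)"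
    unfolding mult_1 by metis
  obtain e where e: "e > 0" "\<And>x. x \<in> S \<Longrightarrow> \<exists>G\<in>(\<lambda>q0. ball q0 (\<delta> q0)) ` S. ball x e \<subseteq> G"
  proof (rule Heine_Borel_lemma[OF cpt, of "(\<lambda>q0. ball q0 (\<delta> q0)) ` S"])
    show "S \<subseteq> \<Union> ((\<lambda>q0. ball q0 (\<delta> q0)) ` S)" using \<delta>(1) by force
  qed auto
  have "x \<bullet> n q \<le> \<kappa> * (1 - x \<bullet> q)" if q: "q \<in> S" and x: "x \<in> S" and d: "dist q x < e" for q x
  proof -
    obtain q0 where q0: "q0 \<in> S" "ball q e \<subseteq> ball q0 (\<delta> q0)" using e(2)[OF q] by blast
    have "q \<in> ball q e" "x \<in> ball q e" using e(1) d by auto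
    then have "q \<in> ball q0 (\<delta> q0)" "x \<in> ball q0 (\<delta> q0)" using q0(2) by blast+
    then show ?thesis using \<delta>(2)[OF q0(1) q x] by (simp add: dist_commute)
  qed
  then show ?thesis using e(1) by blast
qed

end

subsection \<open>The two sides of the surface\<close>

locale dividing_surface = compact_normal_surface +
  fixes \<Omega>1 \<Omega>2 :: "(real^4) set"
  assumes conn: "connected S"
    and divide: "components (sphere 0 1 - S) = {\<Omega>1, \<Omega>2}" and distinct: "\<Omega>1 \<noteq> \<Omega>2"
    and n_inward: "\<And>q. q \<in> S \<Longrightarrow> \<exists>e>0. \<forall>t. 0 < t \<and> t < e \<longrightarrow> exp_S3 q (t *\<^sub>R n q) \<in> \<Omega>1"

context unit_normal_surface
begin

definition E :: "real^4 \<Rightarrow> real \<Rightarrow> real^4" where "E q t = cos t *\<^sub>R q + sin t *\<^sub>R n q"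

lemma exp_S3_eq_E:
  assumes "q \<in> S"
  shows "exp_S3 q (t *\<^sub>R n q) = E q t"
proof (cases "t = 0")
  case False
  have "sin \<bar>t\<bar> / \<bar>t\<bar> * t = sin t" using False by (cases "t > 0") auto
  moreover have "n q \<noteq> 0" using n_unit[OF assms] by auto
  ultimately show ?thesis using False n_unit[OF assms] unfolding exp_S3_def E_def by simp
qed (simp add: exp_S3_def E_def)

lemma E_inner_E:
  assumes "q \<in> S"
  shows "E q s \<bullet> E q t = cos (t - s)"
  using inner_self_S[OF assms] n_orth[OF assms]
  unfolding E_def by (simp add: inner_add_left inner_add_right inner_commute[of q "n q"] cos_diff algebra_simps)

lemma E_0 [simp]: "E q 0 = q" unfolding E_def by simp

lemma inner_E: "x \<bullet> E q t = cos t * (x \<bullet> q) + sin t * (x \<bullet> n q)"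
  unfolding E_def by (simp add: inner_add_right)

lemma norm_E: "q \<in> S \<Longrightarrow> norm (E q t) = 1"
  using E_inner_E[of q t t] by (simp add: norm_eq_sqrt_inner)

lemma continuous_on_E: "continuous_on (S \<times> UNIV) (\<lambda>(q, t). E q t)"
proof -
  have "continuous_on (S \<times> (UNIV :: real set)) (\<lambda>p. cos (snd p) *\<^sub>R fst p + sin (snd p) *\<^sub>R n (fst p))"
    by (intro continuous_intros continuous_on_compose2[OF n_continuous continuous_on_fst[OF continuous_on_id]]) auto
  then show ?thesis unfolding E_def case_prod_beta .
qed

lemma connected_E_image:
  assumes "A \<subseteq> S \<times> UNIV" "connected A"
  shows "connected ((\<lambda>(q, t). E q t) ` A)"
  using connected_continuous_image[OF continuous_on_subset[OF continuous_on_E assms(1)] assms(2)] .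

text \<open>\<open>E x (s * \<theta>)\<close> is the centre of a ball of radius \<theta> without
  points of \<open>S\<close> inside, and any point of the radius to \<open>x\<close> other than
  \<open>x\<close> is closer to the centre than \<theta>. The sign \<open>s\<close> selects the
  side.\<close>

lemma E_segment_avoids:
  assumes x: "x \<in> S" and \<theta>: "\<theta> \<le> pi" and s: "\<bar>s\<bar> = 1"
    and max: "\<And>z. z \<in> S \<Longrightarrow> z \<bullet> E x (s * \<theta>) \<le> cos \<theta>" and t: "0 < t" "t \<le> \<theta>"
  shows "E x (s * t) \<notin> S"
proof
  assume "E x (s * t) \<in> S"
  then have "cos (s * \<theta> - s * t) \<le> cos \<theta>" using max E_inner_E[OF x] by metis
  moreover have "cos (s * \<theta> - s * t) = cos (\<theta> - t)"
    using s by (auto simp: abs_if algebra_simps split: if_splits) (metis cos_minus minus_diff_eq)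
  moreover have "cos (\<theta> - t) > cos \<theta>" using t \<theta> by (intro cos_monotone_0_pi) auto
  ultimately show False by simp
qed

end

context dividing_surface
begin

lemma component_absorbs:
  assumes "connected C" "C \<subseteq> sphere 0 1 - S" "C \<inter> \<Omega> \<noteq> {}" "\<Omega> \<in> {\<Omega>1, \<Omega>2}"
  shows "C \<subseteq> \<Omega>"
  using components_maximal[of \<Omega> "sphere 0 1 - S" C] assms divide by (auto simp: Int_commute)

lemma disjoint_sides: "\<Omega>1 \<inter> \<Omega>2 = {}"
  using components_nonoverlap[of \<Omega>1 "sphere 0 1 - S" \<Omega>2] divide distinct by auto

lemma E_inward:
  assumes "q \<in> S"
  obtains e where "e > 0" "\<And>t. 0 < t \<Longrightarrow> t < e \<Longrightarrow> E q t \<in> \<Omega>1"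
  using n_inward[OF assms] exp_S3_eq_E[OF assms] by auto

lemma E_segment_in_component:
  assumes x: "x \<in> S" and \<theta>: "0 < \<theta>" "\<theta> \<le> pi" and s: "\<bar>s\<bar> = 1"
    and max: "\<And>z. z \<in> S \<Longrightarrow> z \<bullet> E x (s * \<theta>) \<le> cos \<theta>"
    and \<Omega>: "\<Omega> \<in> {\<Omega>1, \<Omega>2}" and u: "0 < u" "u \<le> \<theta>" "E x (s * u) \<in> \<Omega>"
    and t: "0 < t" "t \<le> \<theta>"
  shows "E x (s * t) \<in> \<Omega>"
proof -
  let ?A = "{x} \<times> ((*) s ` {0<..\<theta>})"
  have "connected ((*) s ` {0<..\<theta>})"
    by (intro connected_continuous_image continuous_intros) auto
  then have "connected ((\<lambda>(q, t). E q t) ` ?A)" by (intro connected_E_image connected_Times) (use x in auto)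
  moreover have "(\<lambda>(q, t). E q t) ` ?A \<subseteq> sphere 0 1 - S"
    using E_segment_avoids[OF x \<theta>(2) s max] norm_E[OF x] by (auto simp: dist_norm)
  moreover have "E x (s * u) \<in> (\<lambda>(q, t). E q t) ` ?A" using u by force
  ultimately have "(\<lambda>(q, t). E q t) ` ?A \<subseteq> \<Omega>" using component_absorbs[OF _ _ _ \<Omega>] u(3) by blast
  then show ?thesis using t by force
qed

text \<open>A point of \<open>\<Omega>2\<close> closest to \<open>\<Sigma>\<close> is reached along \<open>- n\<close>; the whole negative side, being
  connected, then lies in \<open>\<Omega>2\<close>.\<close>
lemma negative_side:
  obtains e where "e > 0" "\<And>q t. q \<in> S \<Longrightarrow> 0 < t \<Longrightarrow> t < e \<Longrightarrow> E q (- t) \<in> \<Omega>2"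
proof -
  have "\<Omega>2 \<noteq> {}" "\<Omega>2 \<subseteq> sphere 0 1 - S"
    using in_components_nonempty in_components_subset divide by blast+
  then obtain y where y: "y \<in> \<Omega>2" "y \<in> sphere 0 1 - S" by blast
  have yy: "y \<bullet> y = 1" using y(2) by (auto simp: dot_square_norm)
  have "continuous_on S (\<lambda>z. z \<bullet> y)" by (intro continuous_intros)
  then obtain x where x: "x \<in> S" and xmax: "\<And>z. z \<in> S \<Longrightarrow> z \<bullet> y \<le> x \<bullet> y"
    using continuous_attains_sup[OF cpt ne] by metis
  define \<alpha> \<beta> where "\<alpha> = y \<bullet> x" and "\<beta> = y \<bullet> n x"
  have ydec: "y = \<alpha> *\<^sub>R x + \<beta> *\<^sub>R n x"
    unfolding \<alpha>_def \<beta>_def using normal_decomposition[OF x] critical_point_orthogonal[OF x xmax] by metis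
  have ab: "\<alpha>\<^sup>2 + \<beta>\<^sup>2 = 1"
    using yy inner_self_S[OF x] n_orth[OF x] unfolding ydec
    by (simp add: inner_add_left inner_add_right inner_commute[of x "n x"] power2_eq_square)
  have "\<beta> \<noteq> 0"
  proof
    assume b0: "\<beta> = 0"
    then have "\<alpha> = 1 \<or> \<alpha> = -1" using ab by (simp add: power2_eq_1_iff)
    then show False
    proof
      assume "\<alpha> = 1" then show False using ydec b0 x y(2) by simp
    next
      \<comment> \<open>The closest point of \<open>S\<close> to \<open>y\<close> would be antipodal
        to \<open>y\<close>; the second-order test with \<beta> = 0 then reads 0 \<le> - (v
        \<bullet> v).\<close>
      assume a: "\<alpha> = -1"
      obtain v where v: "v \<in> T x" "v \<noteq> 0" using exists_tangent_nonzero[OF x] .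
      have "-1 * (z \<bullet> x) + 0 * (z \<bullet> n x) \<le> -1" if "z \<in> S" for z
        using xmax[OF that] a b0 ydec inner_self_S[OF x] by simp
      from touching_second_order[OF x this v(1)] show False using v(2) by (simp add: not_less[symmetric])
    qed
  qed
  define \<theta> where "\<theta> = arccos \<alpha>"
  have a1: "\<alpha>\<^sup>2 < 1" using ab \<open>\<beta> \<noteq> 0\<close> by (smt (verit) zero_less_power2)
  then have a2: "-1 < \<alpha>" "\<alpha> < 1" by (simp_all add: abs_square_less_1 abs_less_iff)
  have \<theta>: "0 < \<theta>" "\<theta> < pi" "cos \<theta> = \<alpha>" unfolding \<theta>_def using arccos_lt_bounded[OF a2] a2 by auto
  have "sin \<theta> = \<bar>\<beta>\<bar>"
  proof -
    have "sin \<theta> = sqrt (1 - \<alpha>\<^sup>2)" unfolding \<theta>_def using a2 by (simp add: sin_arccos)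
    also have "1 - \<alpha>\<^sup>2 = \<beta>\<^sup>2" using ab by simp
    finally show ?thesis by simp
  qed
  then have yE: "y = E x (sgn \<beta> * \<theta>)" using \<theta>(3) ydec \<open>\<beta> \<noteq> 0\<close>
    unfolding E_def by (cases "\<beta> > 0") auto
  have s1: "\<bar>sgn \<beta>\<bar> = 1" using \<open>\<beta> \<noteq> 0\<close> by (simp add: abs_sgn_eq)
  have xmax': "z \<bullet> E x (sgn \<beta> * \<theta>) \<le> cos \<theta>" if "z \<in> S" for z
    using xmax[OF that] \<theta>(3) unfolding yE[symmetric] \<alpha>_def by (simp add: inner_commute)
  have seg: "E x (sgn \<beta> * t) \<in> \<Omega>2" if "0 < t" "t \<le> \<theta>" for t
    using E_segment_in_component[OF x \<theta>(1) _ s1 xmax' _ \<theta>(1) order_refl _ that] \<theta>(2) y(1) yE by simp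
  \<comment> \<open>For positive \<beta> the radius from \<open>x\<close> to \<open>y\<close> would
    start in \<Omega>1 and yet lie in \<Omega>2.\<close>
  have "\<beta> < 0"
  proof (rule ccontr)
    assume "\<not> \<beta> < 0"
    then have "sgn \<beta> = 1" using \<open>\<beta> \<noteq> 0\<close> by simp
    moreover obtain e where e: "e > 0" "\<And>t. 0 < t \<Longrightarrow> t < e \<Longrightarrow> E x t \<in> \<Omega>1" using E_inward[OF x] by blast
    ultimately have "E x (min \<theta> (e / 2)) \<in> \<Omega>1 \<inter> \<Omega>2" using seg[of "min \<theta> (e / 2)"] \<theta> by simp
    then show False using disjoint_sides by blast
  qed
  then have seg': "E x (- t) \<in> \<Omega>2" if "0 < t" "t \<le> \<theta>" for t using seg[OF that] by simp
  obtain C where C: "C > 0" "\<And>q x. q \<in> S \<Longrightarrow> x \<in> S \<Longrightarrow> \<bar>x \<bullet> n q\<bar> \<le> C * (1 - x \<bullet> q)"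
    using quadratic_bound by blast
  \<comment> \<open>For 0 < t < e, a point \<open>E q (- t)\<close> of \<open>S\<close> would force
    sin t \<le> C (1 - cos t) \<le> C (sin t)^2, although C sin t \<le> C t < 1; the bound t < 1
    keeps cos t positive.\<close>
  define e where "e = min 1 (1 / C)"
  have e: "e > 0" unfolding e_def using C(1) by simp
  have out: "E q (- t) \<notin> S" if q: "q \<in> S" and t: "0 < t" "t < e" for q t
  proof
    assume "E q (- t) \<in> S"
    from C(2)[OF q this] have le: "\<bar>sin t\<bar> \<le> C * (1 - cos t)"
      using inner_self_S[OF q] n_orth[OF q] unfolding E_def by (simp add: inner_add_left inner_diff_left inner_commute[of q "n q"])
    have t1: "t < 1" "C * t < 1" using t C(1) unfolding e_def by (auto simp: field_simps)
    have t2: "t < pi / 2" using t1 pi_gt3 by simp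
    have st: "0 < sin t" "sin t \<le> t" "0 < cos t"
      using t(1) t2 sin_gt_zero[of t] sin_x_le_x[of t] cos_gt_zero[of t] by auto
    have "1 - cos t \<le> (1 - cos t) * (1 + cos t)" using st(3) by (simp add: algebra_simps mult_left_le_one_le)
    also have "\<dots> = (sin t)\<^sup>2" by (simp add: sin_squared_eq power2_eq_square algebra_simps)
    finally have "C * (1 - cos t) \<le> C * (sin t)\<^sup>2" using C(1) by simp
    also have "\<dots> = (C * sin t) * sin t" by (simp add: power2_eq_square)
    also have "\<dots> < 1 * sin t"
    proof (rule mult_strict_right_mono)
      have "C * sin t \<le> C * t" using st C(1) by simp
      then show "C * sin t < 1" using t1 by simp
    qed (rule st)
    finally show False using le st(1) by simp
  qed
  let ?A = "S \<times> {- e<..<0}"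
  have "connected ((\<lambda>(q, t). E q t) ` ?A)"
    by (intro connected_E_image connected_Times conn) auto
  moreover have "(\<lambda>(q, t). E q t) ` ?A \<subseteq> sphere 0 1 - S"
    using out[of _ "- t" for t] norm_E by (force simp: dist_norm)
  moreover have "E x (- (min \<theta> (e / 2))) \<in> (\<lambda>(q, t). E q t) ` ?A"
    using x \<theta>(1) e by (intro image_eqI[of _ _ "(x, - (min \<theta> (e / 2)))"]) auto
  moreover have "E x (- (min \<theta> (e / 2))) \<in> \<Omega>2" using seg' \<theta>(1) e by simp
  ultimately have "(\<lambda>(q, t). E q t) ` ?A \<subseteq> \<Omega>2" using component_absorbs[of _ \<Omega>2] by blast
  then have "E q (- t) \<in> \<Omega>2" if "q \<in> S" "0 < t" "t < e" for q t
    using that by (force simp: image_subset_iff)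
  then show ?thesis using that e by blast
qed

text \<open>The common centre would lie in \<Omega>1, being joined to \<open>q\<close> on the
  positive side, and in \<Omega>2, being joined to \<open>x\<close> on the negative side, by radii
  that meet \<open>S\<close> only at their ends.\<close>

lemma no_opposite_contact:
  assumes q: "q \<in> S" and x: "x \<in> S" and d: "0 < d" "d \<le> pi"
    and max: "\<And>z. z \<in> S \<Longrightarrow> z \<bullet> E q d \<le> cos d"
  shows "E q d \<noteq> E x (- d)"
proof
  assume eq: "E q d = E x (- d)"
  obtain e1 where e1: "e1 > 0" "\<And>t. 0 < t \<Longrightarrow> t < e1 \<Longrightarrow> E q t \<in> \<Omega>1" using E_inward[OF q] by blast
  obtain e2 where e2: "e2 > 0" "\<And>q t. q \<in> S \<Longrightarrow> 0 < t \<Longrightarrow> t < e2 \<Longrightarrow> E q (- t) \<in> \<Omega>2" using negative_side by blast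
  have "E q (1 * d) \<in> \<Omega>1"
  proof (rule E_segment_in_component[OF q d, where u = "min d (e1 / 2)"])
    show "E q (1 * min d (e1 / 2)) \<in> \<Omega>1" using e1(1) d by (simp add: e1(2))
  qed (use d e1 max in auto)
  moreover have "E x (- 1 * d) \<in> \<Omega>2"
  proof (rule E_segment_in_component[OF x d, where u = "min d (e2 / 2)"])
    show "E x (- 1 * min d (e2 / 2)) \<in> \<Omega>2" using e2(1) d x e2(2)[of x "min d (e2 / 2)"] by simp
  qed (use d e2 max eq in auto)
  ultimately show False using eq disjoint_sides by auto
qed

end

subsection \<open>Second variation at a distant contact\<close>

text \<open>In terms of \<open>M = \<kappa> - A\<close> and the second form \<open>B\<close>, the quadratic form below is
  \<open>\<beta> |M v|\<^sup>2 - M v \<bullet> v + \<kappa> |w|\<^sup>2 - B w \<bullet> w - 2 w \<bullet> M v\<close>. It is tested on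
  \<open>v = adj M e\<^sub>i\<close>, \<open>w = (det M / \<kappa>) e\<^sub>i\<close> and summed over \<open>i = 1, 2\<close>, so that \<open>B\<close> enters only
  through its trace.\<close>
lemma second_variation_contradiction:
  fixes a b c a' b' c' \<kappa> \<alpha> \<beta> :: real
  assumes Q: "\<And>v1 v2 w1 w2. 0 \<le> \<kappa> * \<alpha> * (v1\<^sup>2 + v2\<^sup>2) - (\<kappa> * \<beta> + \<alpha>) * (a * v1\<^sup>2 + 2 * b * v1 * v2 + c * v2\<^sup>2)
      - 2 * \<kappa> * (v1 * w1 + v2 * w2) + \<kappa> * (w1\<^sup>2 + w2\<^sup>2) - (a' * w1\<^sup>2 + 2 * b' * w1 * w2 + c' * w2\<^sup>2)
      + 2 * (w1 * (a * v1 + b * v2) + w2 * (b * v1 + c * v2))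
      + \<beta> * ((a * v1 + b * v2)\<^sup>2 + (b * v1 + c * v2)\<^sup>2)"
    and \<kappa>: "\<kappa> > 0" and \<alpha>: "\<alpha> = \<kappa> * \<beta> - 1" and \<beta>: "\<kappa> * \<beta> < 2"
    and tr: "a + c \<ge> 0" "a' + c' \<ge> 0"
    and pos: "a < \<kappa>" "c < \<kappa>" "(\<kappa> - a) * (\<kappa> - c) > b\<^sup>2"
  shows False
proof -
  define m1 m2 D where "m1 = \<kappa> - a" and "m2 = \<kappa> - c" and "D = (\<kappa> - a) * (\<kappa> - c) - b\<^sup>2"
  have ac: "a = \<kappa> - m1" "c = \<kappa> - m2" unfolding m1_def m2_def by simp_all
  have D: "D = m1 * m2 - b\<^sup>2" "D > 0" unfolding D_def m1_def m2_def using pos by simp_all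
  have m: "m1 > 0" "m2 > 0" "m1 + m2 \<le> 2 * \<kappa>" unfolding m1_def m2_def using pos tr by simp_all
  have Q': "0 \<le> \<beta> * ((m1 * v1 - b * v2)\<^sup>2 + (m2 * v2 - b * v1)\<^sup>2) - ((m1 * v1 - b * v2) * v1 + (m2 * v2 - b * v1) * v2)
     + \<kappa> * (w1\<^sup>2 + w2\<^sup>2) - (a' * w1\<^sup>2 + 2 * b' * w1 * w2 + c' * w2\<^sup>2)
     - 2 * (w1 * (m1 * v1 - b * v2) + w2 * (m2 * v2 - b * v1))" for v1 v2 w1 w2
    using Q[of v1 v2 w1 w2] unfolding \<alpha> ac by (simp add: power2_eq_square algebra_simps)
  have e1: "m1 * m2 - b * b = D" "m2 * b - b * m2 = 0" and e2: "m1 * b - b * m1 = 0" "m2 * m1 - b * b = D"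
    unfolding D(1) by (simp_all add: power2_eq_square)
  \<comment> \<open>The choice of \<open>w\<close> is M v / \<kappa>, the minimiser of \<kappa>
    |w|^2 - 2 w \<bullet> M v, which is all that remains of the terms in \<open>w\<close> once the
    trace of \<open>B\<close> is dropped.\<close>
  have 1: "0 \<le> \<beta> * D\<^sup>2 - D * m2 + \<kappa> * (D / \<kappa>)\<^sup>2 - a' * (D / \<kappa>)\<^sup>2 - 2 * (D / \<kappa> * D)"
    using Q'[of m2 b "D / \<kappa>" 0] unfolding e1 by simp
  have 2: "0 \<le> \<beta> * D\<^sup>2 - D * m1 + \<kappa> * (D / \<kappa>)\<^sup>2 - c' * (D / \<kappa>)\<^sup>2 - 2 * (D / \<kappa> * D)"
    using Q'[of b m1 0 "D / \<kappa>"] unfolding e2 by simp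
  have "(a' + c') * (D / \<kappa>)\<^sup>2 \<ge> 0" using tr(2) by simp
  then have "0 \<le> (a' * (D / \<kappa>)\<^sup>2 + c' * (D / \<kappa>)\<^sup>2)" by (simp only: distrib_right)
  moreover have "D * (m1 + m2) = D * m1 + D * m2" by (rule distrib_left)
  ultimately have "0 \<le> 2 * (\<beta> * D\<^sup>2) - D * (m1 + m2) + 2 * (\<kappa> * (D / \<kappa>)\<^sup>2) - 4 * (D / \<kappa> * D)"
    using 1 2 by linarith
  also have "\<dots> = D * (2 * D * (\<beta> - 1 / \<kappa>) - (m1 + m2))"
    using \<kappa> by (simp add: field_simps power2_eq_square)
  finally have 3: "m1 + m2 \<le> 2 * D * (\<beta> - 1 / \<kappa>)" using D(2) by (simp add: zero_le_mult_iff)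
  define r where "r = \<beta> - 1 / \<kappa>"
  have rp: "r > 0"
  proof (rule ccontr)
    assume "\<not> r > 0"
    then have "2 * D * r \<le> 0" using D(2) by (simp add: mult_le_0_iff)
    then show False using 3 m unfolding r_def by simp
  qed
  \<comment> \<open>Determinant against trace: together with \<open>3\<close> and m1 + m2 \<le> 2
    \<kappa>, which is where the sign of a + c enters, this pushes \<kappa> \<beta> up to 2.\<close>
  have "4 * D \<le> (m1 + m2)\<^sup>2"
  proof -
    have "(m1 + m2)\<^sup>2 - 4 * D = (m1 - m2)\<^sup>2 + 4 * b\<^sup>2" unfolding D(1) by (simp add: power2_eq_square algebra_simps)
    then show ?thesis by (smt (verit) zero_le_power2)
  qed
  then have "4 * D * r \<le> (m1 + m2)\<^sup>2 * r" using rp by simp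
  then have "2 * (m1 + m2) \<le> (m1 + m2)\<^sup>2 * r" using 3 unfolding r_def by simp
  then have "(m1 + m2) * 2 \<le> (m1 + m2) * ((m1 + m2) * r)" by (simp add: power2_eq_square algebra_simps)
  then have "2 \<le> (m1 + m2) * r" using m(1,2) by (metis add_pos_pos mult_le_cancel_left_pos)
  also have "\<dots> \<le> 2 * \<kappa> * r" using m(3) rp by simp
  finally have "2 \<le> \<kappa> * \<beta>" using \<kappa> unfolding r_def by (simp add: algebra_simps)
  then show False using \<beta> by simp
qed

lemma DERIV_inner:
  assumes "(f has_vector_derivative f') (at t)" "(g has_vector_derivative g') (at t)"
  shows "((\<lambda>t. f t \<bullet> g t) has_real_derivative (f' \<bullet> g t + f t \<bullet> g')) (at t)"
  unfolding has_field_derivative_def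
  by (rule has_derivative_eq_rhs[OF has_derivative_inner[OF assms[unfolded has_vector_derivative_def]]])
    (auto simp: fun_eq_iff algebra_simps)

context unit_normal_surface
begin

text \<open>The gap \<kappa> (1 - b \<bullet> c) - b \<bullet> n(c) is nonnegative on the surface
  and zero at the contact, so its second derivative along two simultaneous curves is nonnegative.
  \<open>nx\<close> turns the pairing of \<open>b2 0\<close> with data at \<open>q\<close> into one
  with data at \<open>x\<close>, and \<open>xq\<close> expresses \<open>x\<close> by data at
  \<open>q\<close> for \<open>c2 0\<close> and \<open>N2 0\<close>; hence no tangential part of a
  second derivative occurs.\<close>

lemma contact_second_variation:
  assumes q: "q \<in> S" and x: "x \<in> S"
    and le: "\<And>a b. a \<in> S \<Longrightarrow> b \<in> S \<Longrightarrow> b \<bullet> n a \<le> \<kappa> * (1 - b \<bullet> a)"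
    and eq: "x \<bullet> n q = \<kappa> * (1 - x \<bullet> q)"
    and v: "v \<in> T q" and w: "w \<in> T x"
    and xq: "x = \<alpha> *\<^sub>R q + \<beta> *\<^sub>R n q" and nx: "n x + \<kappa> *\<^sub>R x = n q + \<kappa> *\<^sub>R q"
  shows "0 \<le> \<kappa> * \<alpha> * (v \<bullet> v) - (\<kappa> * \<beta> + \<alpha>) * II q v v - 2 * \<kappa> * (v \<bullet> w) + \<kappa> * (w \<bullet> w) - II x w w
     + 2 * II q w v + \<beta> * (dN S n q v \<bullet> dN S n q v)"
proof -
  obtain c c1 c2 N1 N2 :: "real \<Rightarrow> real^4" and d where c: "d > 0" "c 0 = q" "c1 0 = v" "N1 0 = dN S n q v"
    "\<And>t. \<bar>t\<bar> < d \<Longrightarrow> c t \<in> S"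
    "\<And>t. \<bar>t\<bar> < d \<Longrightarrow> (c has_vector_derivative c1 t) (at t)"
    "\<And>t. \<bar>t\<bar> < d \<Longrightarrow> (c1 has_vector_derivative c2 t) (at t)"
    "\<And>t. \<bar>t\<bar> < d \<Longrightarrow> ((\<lambda>t. n (c t)) has_vector_derivative N1 t) (at t)"
    "\<And>t. \<bar>t\<bar> < d \<Longrightarrow> (N1 has_vector_derivative N2 t) (at t)"
    "c2 0 \<bullet> q = - (v \<bullet> v)" "c2 0 \<bullet> n q = II q v v"
    "N2 0 \<bullet> q = II q v v" "N2 0 \<bullet> n q = - (dN S n q v \<bullet> dN S n q v)"
    by (rule obtain_curve[OF q v]) blast
  obtain b b1 b2 N1' N2' :: "real \<Rightarrow> real^4" and d' where b: "d' > 0" "b 0 = x" "b1 0 = w" "N1' 0 = dN S n x w"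
    "\<And>t. \<bar>t\<bar> < d' \<Longrightarrow> b t \<in> S"
    "\<And>t. \<bar>t\<bar> < d' \<Longrightarrow> (b has_vector_derivative b1 t) (at t)"
    "\<And>t. \<bar>t\<bar> < d' \<Longrightarrow> (b1 has_vector_derivative b2 t) (at t)"
    "b2 0 \<bullet> x = - (w \<bullet> w)" "b2 0 \<bullet> n x = II x w w"
    by (rule obtain_curve[OF x w]) blast
  define D where "D = min d d'"
  have D: "D > 0" "\<And>t. \<bar>t\<bar> < D \<Longrightarrow> \<bar>t\<bar> < d \<and> \<bar>t\<bar> < d'" unfolding D_def using c(1) b(1) by auto
  define F where "F t = \<kappa> * (1 - b t \<bullet> c t) - b t \<bullet> n (c t)" for t
  define F1 where "F1 t = \<kappa> * (0 - (b1 t \<bullet> c t + b t \<bullet> c1 t)) - (b1 t \<bullet> n (c t) + b t \<bullet> N1 t)" for t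
  define F2 where "F2 = \<kappa> * (0 - ((b2 0 \<bullet> c 0 + b1 0 \<bullet> c1 0) + (b1 0 \<bullet> c1 0 + b 0 \<bullet> c2 0)))
      - ((b2 0 \<bullet> n (c 0) + b1 0 \<bullet> N1 0) + (b1 0 \<bullet> N1 0 + b 0 \<bullet> N2 0))"
  have d1: "(F has_real_derivative F1 t) (at t)" if "\<bar>t\<bar> < D" for t
    unfolding F_def F1_def using D(2)[OF that]
    by (intro DERIV_diff DERIV_cmult DERIV_const DERIV_inner c(6,8) b(6)) auto
  have d2: "(F1 has_real_derivative F2) (at 0)"
    unfolding F1_def F2_def using D(2)[of 0] D(1)
    by (intro DERIV_diff DERIV_cmult DERIV_const DERIV_add DERIV_inner c(6,7,8,9) b(6,7)) auto
  have "F 0 = 0" unfolding F_def b(2) c(2) eq by simp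
  then have "F 0 \<le> F t" if "\<bar>t\<bar> < D" for t
    using le[OF c(5) b(5)] D(2)[OF that] unfolding F_def by simp
  from second_derivative_at_min(2)[OF D(1) d1 d2 this] have "0 \<le> F2" .
  moreover have "b2 0 \<bullet> n q + \<kappa> * (b2 0 \<bullet> q) = II x w w - \<kappa> * (w \<bullet> w)"
    using arg_cong[OF nx, of "\<lambda>z. b2 0 \<bullet> z"] b(8,9) by (simp add: inner_add_right)
  moreover have "x \<bullet> c2 0 = \<beta> * II q v v - \<alpha> * (v \<bullet> v)"
    using arg_cong[OF xq, of "\<lambda>z. c2 0 \<bullet> z"] c(10,11) by (simp add: inner_add_right inner_commute)
  moreover have "x \<bullet> N2 0 = \<alpha> * II q v v - \<beta> * (dN S n q v \<bullet> dN S n q v)"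
    using arg_cong[OF xq, of "\<lambda>z. N2 0 \<bullet> z"] c(12,13) by (simp add: inner_add_right inner_commute)
  moreover have "w \<bullet> dN S n q v = - II q w v" unfolding second_ff_def by simp
  ultimately show ?thesis
    unfolding F2_def c(2,3,4) b(2,3) by (simp add: algebra_simps inner_commute)
qed

end

section \<open>Contacts off the diagonal\<close>

lemma arccot_bounds: "0 < arccot x" "arccot x < pi"
  using arctan_lbound[of x] arctan_ubound[of x] unfolding arccot_def by auto

lemma cos_arccot: "cos (arccot x) = x * sin (arccot x)"
  unfolding arccot_def using cos_arctan_not_zero[of x] tan_arctan[of x]
  unfolding cos_diff sin_diff by (simp add: tan_def field_simps)

lemma sin_arccot: "sin (arccot x) > 0" "(sin (arccot x))\<^sup>2 * (1 + x\<^sup>2) = 1"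
proof -
  show "sin (arccot x) > 0" using arccot_bounds[of x] by (intro sin_gt_zero)
  show "(sin (arccot x))\<^sup>2 * (1 + x\<^sup>2) = 1"
    using sin_cos_squared_add[of "arccot x"] unfolding cos_arccot
    by (simp add: power_mult_distrib algebra_simps)
qed

context dividing_surface
begin

lemma no_distant_contact:
  assumes q: "q \<in> S" and x: "x \<in> S" and ne: "x \<noteq> q" and \<kappa>: "\<kappa> > 0"
    and kmax: "kmax q < \<kappa>" and H: "mean_curv S n q \<ge> 0" "mean_curv S n x \<ge> 0"
    and le: "\<And>a b. a \<in> S \<Longrightarrow> b \<in> S \<Longrightarrow> b \<bullet> n a \<le> \<kappa> * (1 - b \<bullet> a)"
  shows "x \<bullet> n q \<noteq> \<kappa> * (1 - x \<bullet> q)"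
proof
  assume eq: "x \<bullet> n q = \<kappa> * (1 - x \<bullet> q)"
  define d where "d = arccot \<kappa>"
  have d: "0 < d" "d \<le> pi" "cos d = \<kappa> * sin d" "sin d > 0"
    unfolding d_def using arccot_bounds[of \<kappa>] cos_arccot sin_arccot by auto
  have zE: "z \<bullet> E q d = sin d * (\<kappa> * (z \<bullet> q) + z \<bullet> n q)" for z
    unfolding inner_E d(3) by (simp add: algebra_simps)
  \<comment> \<open>The ball of radius \<open>d\<close> about \<open>E q d\<close> is free of
    \<open>S\<close> inside and has \<open>x\<close>, as well as \<open>q\<close>, on its
    boundary.\<close>
  have max: "z \<bullet> E q d \<le> cos d" if "z \<in> S" for z
  proof -
    have "\<kappa> * (z \<bullet> q) + z \<bullet> n q \<le> \<kappa>" using le[OF q that] by (simp add: algebra_simps)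
    then show ?thesis using d(4) mult_left_mono[of _ \<kappa> "sin d"] unfolding zE d(3) by (simp add: mult.commute)
  qed
  have xE: "x \<bullet> E q d = cos d" unfolding zE d(3) eq by (simp add: algebra_simps)
  define s where "s = E q d \<bullet> n x"
  have dec: "E q d = cos d *\<^sub>R x + s *\<^sub>R n x"
    using normal_decomposition[OF x, of "E q d"] critical_point_orthogonal[OF x, of "E q d"] max xE
    unfolding s_def by (simp add: inner_commute)
  have "E q d \<bullet> E q d = (cos d)\<^sup>2 + s\<^sup>2"
    using inner_self_S[OF x] n_orth[OF x] unfolding dec
    by (simp add: inner_add_left inner_add_right inner_commute[of x "n x"] power2_eq_square)
  then have "(cos d)\<^sup>2 + s\<^sup>2 = 1" using E_inner_E[OF q, of d d] by simp
  then have "s\<^sup>2 = (sin d)\<^sup>2" using sin_cos_squared_add[of d] by linarith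
  \<comment> \<open>The centre is \<open>E x d\<close> or \<open>E x (- d)\<close>; the separation
    of the two sides rules out the second.\<close>
  then have "s = sin d \<or> s = - sin d" by (simp add: power2_eq_iff)
  moreover have "s \<noteq> - sin d"
    using no_opposite_contact[OF q x d(1,2) max] dec unfolding E_def by auto
  ultimately have s: "s = sin d" by blast
  have "sin d *\<^sub>R (n q + \<kappa> *\<^sub>R q) = sin d *\<^sub>R (n x + \<kappa> *\<^sub>R x)"
    using dec unfolding E_def s d(3) by (simp add: scaleR_add_right algebra_simps)
  then have nx: "n x + \<kappa> *\<^sub>R x = n q + \<kappa> *\<^sub>R q" using d(4) by simp
  text \<open>Varying \<open>q\<close> alone: \<open>x\<close> is orthogonal to the range of \<open>\<kappa> - A\<close>, i.e. to the tangent plane.\<close>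
  have first: "x \<bullet> (\<kappa> *\<^sub>R v + dN S n q v) = 0" if v: "v \<in> T q" for v
  proof -
    obtain c c1 c2 N1 N2 :: "real \<Rightarrow> real^4" and \<delta> where c: "\<delta> > 0" "c 0 = q" "c1 0 = v" "N1 0 = dN S n q v"
      "\<And>t. \<bar>t\<bar> < \<delta> \<Longrightarrow> c t \<in> S"
      "\<And>t. \<bar>t\<bar> < \<delta> \<Longrightarrow> (c has_vector_derivative c1 t) (at t)"
      "\<And>t. \<bar>t\<bar> < \<delta> \<Longrightarrow> (c1 has_vector_derivative c2 t) (at t)"
      "\<And>t. \<bar>t\<bar> < \<delta> \<Longrightarrow> ((\<lambda>t. n (c t)) has_vector_derivative N1 t) (at t)"
      "\<And>t. \<bar>t\<bar> < \<delta> \<Longrightarrow> (N1 has_vector_derivative N2 t) (at t)"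
      by (rule obtain_curve[OF q v]) blast
    define F where "F t = \<kappa> * (1 - x \<bullet> c t) - x \<bullet> n (c t)" for t
    have dF: "(F has_real_derivative \<kappa> * (0 - x \<bullet> c1 t) - x \<bullet> N1 t) (at t)" if "\<bar>t\<bar> < \<delta>" for t
      unfolding F_def
      by (intro DERIV_diff DERIV_cmult DERIV_const)
        (auto simp: has_real_derivative_iff_has_vector_derivative
          intro!: bounded_linear.has_vector_derivative[OF bounded_linear_inner_right] c(6,8) that)
    have "F 0 = 0" unfolding F_def c(2) eq by simp
    then have "F 0 \<le> F t" if "\<bar>t\<bar> < \<delta>" for t using le[OF c(5)[OF that] x] unfolding F_def by simp
    then have "\<kappa> * (0 - x \<bullet> c1 0) - x \<bullet> N1 0 = 0"
      using DERIV_local_min[OF dF[of 0] c(1)] c(1) by (simp add: abs_minus_commute)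
    then show ?thesis unfolding c(3,4) by (simp add: inner_add_right)
  qed
  \<comment> \<open>The tangential part \<open>u\<close> of \<open>x\<close> satisfies u \<bullet>
    (\<kappa> - A) u = 0 with A the shape operator, and \<kappa> > \<open>kmax q\<close> makes
    \<kappa> - A positive definite; hence u = 0.\<close>
  have xT: "v \<bullet> x = 0" if v: "v \<in> T q" for v
  proof -
    define u where "u = x - ((x \<bullet> q) *\<^sub>R q + (x \<bullet> n q) *\<^sub>R n q)"
    have uT: "u \<in> T q" unfolding T_def u_def using inner_self_S[OF q] n_orth[OF q]
      by (simp add: inner_diff_left inner_add_left inner_commute[of q "n q"])
    have ux: "u \<bullet> z = x \<bullet> z" if "z \<in> T q" for z
      using that unfolding u_def T_def by (simp add: inner_diff_left inner_add_left inner_commute[of q z] inner_commute[of "n q" z])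
    have "\<kappa> *\<^sub>R u + dN S n q u \<in> T q"
      using uT dN_mem_T[OF q uT] subspace_T[of q] by (simp add: subspace_add subspace_scale)
    then have "u \<bullet> (\<kappa> *\<^sub>R u + dN S n q u) = 0" using first[OF uT] ux by simp
    then have "\<kappa> * (u \<bullet> u) = II q u u" unfolding second_ff_def by (simp add: inner_add_right)
    also have "\<dots> \<le> kmax q * (u \<bullet> u)" using II_le_kmax[OF q uT] .
    finally have "(\<kappa> - kmax q) * (u \<bullet> u) \<le> 0" by (simp add: algebra_simps)
    then have "u \<bullet> u \<le> 0" using kmax by (simp add: mult_le_0_iff)
    then have "u = 0" using inner_gt_zero_iff[of u] by linarith
    then show ?thesis using ux[OF v] by (simp add: inner_commute)
  qed
  define \<alpha> \<beta> where "\<alpha> = x \<bullet> q" and "\<beta> = x \<bullet> n q"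
  have xq: "x = \<alpha> *\<^sub>R q + \<beta> *\<^sub>R n q"
    unfolding \<alpha>_def \<beta>_def using normal_decomposition[OF q, of x] xT by blast
  have "x \<bullet> x = \<alpha>\<^sup>2 + \<beta>\<^sup>2"
    using inner_self_S[OF q] n_orth[OF q] unfolding xq
    by (simp add: inner_add_left inner_add_right inner_commute[of q "n q"] power2_eq_square)
  then have ab: "\<alpha>\<^sup>2 + \<beta>\<^sup>2 = 1" using inner_self_S[OF x] by simp
  have bk: "\<beta> = \<kappa> * (1 - \<alpha>)" using eq unfolding \<alpha>_def \<beta>_def .
  have "\<alpha> \<noteq> 1"
  proof
    assume "\<alpha> = 1" then show False using bk xq ne by simp
  qed
  moreover have "(1 - \<alpha>) * (\<kappa>\<^sup>2 * (1 - \<alpha>)) = (1 - \<alpha>) * (1 + \<alpha>)"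
    using ab unfolding bk by (simp add: power2_eq_square algebra_simps)
  ultimately have "\<kappa>\<^sup>2 * (1 - \<alpha>) = 1 + \<alpha>" by simp
  \<comment> \<open>In terms of \<open>d\<close> this says \<kappa> \<beta> = 1 + cos 2d = 2 (cos
    d)^2; it falls below 2 as soon as \<alpha> < 1.\<close>
  then have k2: "\<kappa> * \<beta> = 1 + \<alpha>" unfolding bk by (simp add: power2_eq_square)
  have "\<alpha> < 1"
  proof -
    have "\<alpha>\<^sup>2 \<le> 1" using ab by (smt (verit) zero_le_power2)
    then show ?thesis using \<open>\<alpha> \<noteq> 1\<close> by (simp add: abs_square_le_1)
  qed
  have TT: "v \<in> T x" if "v \<in> T q" for v
  proof -
    have vx: "v \<bullet> x = 0" using xT[OF that] .
    have "v \<bullet> (n x + \<kappa> *\<^sub>R x) = 0" unfolding nx using that unfolding T_def by (simp add: inner_add_right)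
    then show ?thesis using vx unfolding T_def by (simp add: inner_add_right)
  qed
  obtain e1 e2 where e: "onb q e1 e2" and Hq: "mean_curv S n q = (II q e1 e1 + II q e2 e2) / 2"
    using curvatures_onb[OF q] by metis
  obtain f1 f2 where f: "onb x f1 f2" and Hx: "mean_curv S n x = (II x f1 f1 + II x f2 f2) / 2"
    using curvatures_onb[OF x] by metis
  \<comment> \<open>One basis serves at both points, so the two second forms become matrices in the
    same coordinates, with traces twice the mean curvatures.\<close>
  have ex: "onb x e1 e2" using e TT unfolding onb_def by blast
  have eT: "e1 \<in> T q" "e2 \<in> T q" using e unfolding onb_def by auto
  have nd: "(II q e1 e1 - \<kappa>) * x\<^sup>2 + 2 * II q e1 e2 * x * y + (II q e2 e2 - \<kappa>) * y\<^sup>2 < 0" if "(x, y) \<noteq> (0, 0)" for x y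
  proof -
    let ?v = "x *\<^sub>R e1 + y *\<^sub>R e2"
    have "?v \<bullet> ?v = x * x + y * y" by (rule inner_onb[OF e])
    moreover have "x * x + y * y > 0" using that by (auto simp: sum_squares_gt_zero_iff)
    moreover have "II q ?v ?v \<le> kmax q * (?v \<bullet> ?v)" using II_le_kmax[OF q onb_mem_T[OF e]] .
    ultimately have "II q ?v ?v < \<kappa> * (x * x + y * y)" using kmax by (smt (verit) mult_strict_right_mono)
    then show ?thesis unfolding II_expand[OF q e] by (simp add: power2_eq_square algebra_simps)
  qed
  show False
  proof (rule second_variation_contradiction[where \<kappa>=\<kappa> and \<alpha>=\<alpha> and \<beta>=\<beta> and a="II q e1 e1" and b="II q e1 e2" and c="II q e2 e2"
        and a'="II x e1 e1" and b'="II x e1 e2" and c'="II x e2 e2"])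
    fix v1 v2 w1 w2
    let ?v = "v1 *\<^sub>R e1 + v2 *\<^sub>R e2" and ?w = "w1 *\<^sub>R e1 + w2 *\<^sub>R e2"
    have v: "?v \<in> T q" and w: "?w \<in> T x" using onb_mem_T[OF e] onb_mem_T[OF ex] by auto
    have 1: "II q e1 ?v = II q e1 e1 * v1 + II q e1 e2 * v2"
      using II_expand[OF q e, of 1 0 v1 v2] by simp
    have 2: "II q e2 ?v = II q e1 e2 * v1 + II q e2 e2 * v2"
      using II_expand[OF q e, of 0 1 v1 v2] by simp
    have "dN S n q ?v \<bullet> dN S n q ?v = (II q e1 e1 * v1 + II q e1 e2 * v2)\<^sup>2 + (II q e1 e2 * v1 + II q e2 e2 * v2)\<^sup>2"
      unfolding dN_onb[OF q e v] inner_onb[OF e] 1 2 by (simp add: power2_eq_square algebra_simps)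
    with contact_second_variation[OF q x le eq v w xq nx]
    show "0 \<le> \<kappa> * \<alpha> * (v1\<^sup>2 + v2\<^sup>2) - (\<kappa> * \<beta> + \<alpha>) * (II q e1 e1 * v1\<^sup>2 + 2 * II q e1 e2 * v1 * v2 + II q e2 e2 * v2\<^sup>2)
      - 2 * \<kappa> * (v1 * w1 + v2 * w2) + \<kappa> * (w1\<^sup>2 + w2\<^sup>2) - (II x e1 e1 * w1\<^sup>2 + 2 * II x e1 e2 * w1 * w2 + II x e2 e2 * w2\<^sup>2)
      + 2 * (w1 * (II q e1 e1 * v1 + II q e1 e2 * v2) + w2 * (II q e1 e2 * v1 + II q e2 e2 * v2))
      + \<beta> * ((II q e1 e1 * v1 + II q e1 e2 * v2)\<^sup>2 + (II q e1 e2 * v1 + II q e2 e2 * v2)\<^sup>2)"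
      unfolding II_expand[OF q e] II_expand[OF x ex] inner_onb[OF e]
      by (simp add: power2_eq_square algebra_simps)
  next
    show "II q e1 e1 + II q e2 e2 \<ge> 0" using H(1) Hq by simp
    show "II x e1 e1 + II x e2 e2 \<ge> 0" using H(2) Hx II_trace_unique[OF x ex f] by simp
    show "II q e1 e1 < \<kappa>" "II q e2 e2 < \<kappa>" using nd[of 1 0] nd[of 0 1] by simp_all
    show "(II q e1 e2)\<^sup>2 < (\<kappa> - II q e1 e1) * (\<kappa> - II q e2 e2)"
      using negative_definite_discriminant(2)[OF nd] by (simp add: algebra_simps)
  qed (use \<kappa> k2 \<open>\<alpha> < 1\<close> in auto)
qed

text \<open>Z cannot be maximised over all pairs directly, because of the diagonal. A level
  \<open>k1\<close> strictly between the supremum of \<open>kmax\<close> and a supposed larger value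
  of Z bounds Z near the diagonal; the maximum over the remaining compact set of pairs is then
  global.\<close>

lemma touching_bound_Sup:
  assumes H: "\<And>q. q \<in> S \<Longrightarrow> mean_curv S n q \<ge> 0" and a: "a \<in> S" and b: "b \<in> S"
  shows "b \<bullet> n a \<le> Sup (kmax ` S) * (1 - b \<bullet> a)"
proof (rule ccontr)
  let ?k = "Sup (kmax ` S)"
  assume "\<not> b \<bullet> n a \<le> ?k * (1 - b \<bullet> a)"
  then have gt: "b \<bullet> n a > ?k * (1 - b \<bullet> a)" by simp
  have kle: "kmax q \<le> ?k" if "q \<in> S" for q using cSup_upper[OF _ kmax_bdd_above] that by blast
  \<comment> \<open>Mean convexity enters here as well: it makes the maximum \<kappa> >
    \<open>?k\<close> positive, as \<open>no_distant_contact\<close> demands.\<close>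
  have k0: "?k \<ge> 0"
  proof -
    have "kmax a \<ge> 0" unfolding kmax_def using H[OF a] lam_curv_nonneg[OF a] by simp
    then show ?thesis using kle[OF a] by simp
  qed
  define Z where "Z p = (snd p \<bullet> n (fst p)) / (1 - snd p \<bullet> fst p)" for p
  have pos: "1 - x \<bullet> q > 0" if "q \<in> S" "x \<in> S" "q \<noteq> x" for q x
    using that unfolding one_minus_inner[OF that(1,2)] by simp
  have ab: "a \<noteq> b" using gt inner_self_S[OF a] n_orth[OF a] by (auto simp: inner_commute)
  have Zab: "Z (a, b) > ?k" unfolding Z_def using gt pos[OF a b ab] by (simp add: field_simps)
  define k1 where "k1 = (?k + Z (a, b)) / 2"
  have k1: "?k < k1" "k1 < Z (a, b)" unfolding k1_def using Zab by auto
  have "kmax q < k1" if "q \<in> S" for q using kle[OF that] k1 by simp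
  then obtain \<delta> where \<delta>: "\<delta> > 0" "\<And>q x. q \<in> S \<Longrightarrow> x \<in> S \<Longrightarrow> dist q x < \<delta> \<Longrightarrow> x \<bullet> n q \<le> k1 * (1 - x \<bullet> q)"
    using uniform_touching_bound[of k1] by blast
  define P where "P = (S \<times> S) \<inter> {p. \<delta> \<le> dist (fst p) (snd p)}"
  have near: "Z (q, x) \<le> k1" if "q \<in> S" "x \<in> S" "q \<noteq> x" "dist q x < \<delta>" for q x
    unfolding Z_def using \<delta>(2)[OF that(1,2,4)] pos[OF that(1-3)] by (simp add: field_simps)
  have "closed {p :: (real^4) \<times> (real^4). \<delta> \<le> dist (fst p) (snd p)}"
    by (intro closed_Collect_le continuous_intros)
  then have cP: "compact P" unfolding P_def using cpt by (intro compact_Int_closed compact_Times)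
  have abP: "(a, b) \<in> P" unfolding P_def using near[OF a b ab] k1 a b by (auto simp: not_less[symmetric])
  have Pne: "fst p \<in> S" "snd p \<in> S" "fst p \<noteq> snd p" if "p \<in> P" for p
    using that \<delta>(1) unfolding P_def by auto
  have "continuous_on P Z" unfolding Z_def
    by (intro continuous_intros continuous_on_compose2[OF n_continuous])
      (use Pne pos in \<open>force simp: less_le\<close>)+
  then obtain p where p: "p \<in> P" "\<And>p'. p' \<in> P \<Longrightarrow> Z p' \<le> Z p"
    using continuous_attains_sup[OF cP] abP by (metis empty_iff)
  define q x where "q = fst p" and "x = snd p"
  have qx: "q \<in> S" "x \<in> S" "q \<noteq> x" unfolding q_def x_def using Pne[OF p(1)] by auto
  define \<kappa> where "\<kappa> = Z (q, x)"
  have \<kappa>: "\<kappa> = Z p" unfolding \<kappa>_def q_def x_def by simp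
  have big: "k1 < \<kappa>" using p(2)[OF abP] k1 \<kappa> by simp
  have Zle: "Z (q', x') \<le> \<kappa>" if "q' \<in> S" "x' \<in> S" "q' \<noteq> x'" for q' x'
  proof (cases "dist q' x' < \<delta>")
    case True then show ?thesis using near[OF that] big by simp
  next
    case False then have "(q', x') \<in> P" unfolding P_def using that by simp
    then show ?thesis using p(2) \<kappa> by simp
  qed
  have le: "x' \<bullet> n q' \<le> \<kappa> * (1 - x' \<bullet> q')" if "q' \<in> S" "x' \<in> S" for q' x'
  proof (cases "q' = x'")
    case True then show ?thesis using inner_self_S n_orth that by (simp add: inner_commute)
  next
    case False then show ?thesis using Zle[OF that False] pos[OF that False] unfolding Z_def by (simp add: field_simps)
  qed
  have "x \<bullet> n q = \<kappa> * (1 - x \<bullet> q)" unfolding \<kappa>_def Z_def using pos[OF qx] by simp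
  moreover have "\<kappa> > 0" "kmax q < \<kappa>" using big k1 k0 kle[OF qx(1)] by simp_all
  ultimately show False using no_distant_contact[OF qx(1,2) _ _ _ H[OF qx(1)] H[OF qx(2)] le] qx(3) by blast
qed

end

subsection \<open>Coverings and the genus of a sphere\<close>

text \<open>The image is open and compact, hence all of the connected \<open>S\<close>; fibres are
  finite, being compact and discrete. The sheets over \<open>y\<close> come from small disjoint
  neighbourhoods of the fibre, and removing the image of the complement of their union from the base
  keeps all other preimages away.\<close>

lemma compact_local_homeomorphism_covering:
  fixes f :: "'a::metric_space \<Rightarrow> 'b::metric_space"
  assumes C: "compact C" "C \<noteq> {}" and S: "connected S"
    and f: "continuous_on C f" "f ` C \<subseteq> S"
    and loc: "\<And>x. x \<in> C \<Longrightarrow> \<exists>u. x \<in> u \<and> openin (top_of_set C) u \<and> inj_on f u \<and>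
        (\<forall>w. w \<subseteq> u \<longrightarrow> openin (top_of_set C) w \<longrightarrow> openin (top_of_set S) (f ` w))"
  shows "covering_space C f S"
proof
  obtain u where u: "\<And>x. x \<in> C \<Longrightarrow> x \<in> u x" "\<And>x. x \<in> C \<Longrightarrow> openin (top_of_set C) (u x)"
    "\<And>x. x \<in> C \<Longrightarrow> inj_on f (u x)"
    "\<And>x w. x \<in> C \<Longrightarrow> w \<subseteq> u x \<Longrightarrow> openin (top_of_set C) w \<Longrightarrow> openin (top_of_set S) (f ` w)"
    using loc by metis
  have opn: "openin (top_of_set S) (f ` w)" if w: "openin (top_of_set C) w" for w
  proof -
    have wC: "w \<subseteq> C" using openin_imp_subset[OF w] .
    have "f ` w = (\<Union>x\<in>w. f ` (w \<inter> u x))" using u(1) wC by blast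
    moreover have "openin (top_of_set S) (f ` (w \<inter> u x))" if "x \<in> w" for x
      using u(4)[of x "w \<inter> u x"] u(2)[of x] w wC that by (auto intro: openin_Int)
    ultimately show ?thesis by (auto intro!: openin_Union)
  qed
  show "continuous_on C f" by (rule f)
  have "openin (top_of_set S) (f ` C)" by (rule opn) simp
  moreover have "closedin (top_of_set S) (f ` C)"
    using compact_continuous_image[OF f(1) C(1)] f(2) by (intro closed_subset compact_imp_closed)
  ultimately show fC: "f ` C = S" using S C(2) unfolding connected_clopen by blast
  fix y assume y: "y \<in> S"
  define F where "F = C \<inter> f -` {y}"
  have FC: "F \<subseteq> C" unfolding F_def by blast
  have "closedin (top_of_set C) F"
    unfolding F_def using f(1) by (rule continuous_closedin_preimage) simp
  then have "compact F" using closedin_compact C(1) by blast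
  moreover have "\<exists>e>0. \<forall>z\<in>F. dist x z < e \<longrightarrow> z = x" if x: "x \<in> F" for x
  proof -
    have xC: "x \<in> C" using x FC by blast
    obtain e where e: "e > 0" "\<And>z. z \<in> C \<Longrightarrow> dist z x < e \<Longrightarrow> z \<in> u x"
      using u(1)[OF xC] u(2)[OF xC] unfolding openin_euclidean_subtopology_iff by metis
    have "z = x" if "z \<in> F" "dist x z < e" for z
      using e(2)[of z] u(3)[OF xC] u(1)[OF xC] that x FC unfolding F_def
      by (auto simp: dist_commute inj_on_def)
    then show ?thesis using e(1) by blast
  qed
  then have "\<not> x islimpt F" if "x \<in> F" for x
    using that unfolding islimpt_approachable by (metis dist_commute)
  ultimately have finF: "finite F"
    unfolding compact_eq_Bolzano_Weierstrass by blast
  obtain r where r: "r > 0" "\<And>a b. a \<in> F \<Longrightarrow> b \<in> F \<Longrightarrow> a \<noteq> b \<Longrightarrow> r \<le> dist a b"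
  proof -
    let ?D = "(\<lambda>(a, b). dist a b) ` {p \<in> F \<times> F. fst p \<noteq> snd p}"
    have finD: "finite ?D" using finF by simp
    \<comment> \<open>Inserting 1 keeps \<open>Min\<close> meaningful for a fibre with at most one
      point.\<close>
    show ?thesis
    proof (rule that[of "Min (insert 1 ?D)"])
      show "Min (insert 1 ?D) > 0" using finD by (subst Min_gr_iff) auto
      fix a b assume "a \<in> F" "b \<in> F" "a \<noteq> b"
      then have "dist a b \<in> insert 1 ?D" by force
      then show "Min (insert 1 ?D) \<le> dist a b" using finD by (intro Min_le) auto
    qed
  qed
  define u' where "u' x = u x \<inter> ball x (r / 2)" for x
  have u'o: "openin (top_of_set C) (u' x)" if "x \<in> F" for x
    unfolding u'_def using u(2)[of x] that FC by (metis openin_Int_open open_ball subsetD)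
  have u'x: "x \<in> u' x" if "x \<in> F" for x unfolding u'_def using u(1)[of x] that FC r(1) by auto
  have disj: "u' a \<inter> u' b = {}" if "a \<in> F" "b \<in> F" "a \<noteq> b" for a b
  proof (rule ccontr)
    assume "u' a \<inter> u' b \<noteq> {}"
    then obtain z where "dist a z < r / 2" "dist b z < r / 2" unfolding u'_def by auto
    then have "dist a b < r" using dist_triangle2[of a b z] by linarith
    then show False using r(2)[OF that] by simp
  qed
  define R where "R = C - (\<Union>x\<in>F. u' x)"
  have "openin (top_of_set C) (\<Union>x\<in>F. u' x)" using u'o by blast
  then have "closedin (top_of_set C) R"
    unfolding R_def by (metis closedin_diff closedin_topspace topspace_euclidean_subtopology)
  then have "compact R" using closedin_compact C(1) by blast
  then have "closed (f ` R)"
    using f(1) closedin_imp_subset[OF \<open>closedin (top_of_set C) R\<close>]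
    by (metis compact_continuous_image compact_imp_closed continuous_on_subset)
  then have oR: "openin (top_of_set S) (S - f ` R)"
    by (simp add: Diff_eq openin_open_Int open_Compl)
  define T where "T = (S - f ` R) \<inter> \<Inter>((\<lambda>x. f ` u' x) ` F)"
  have "openin (top_of_set S) T"
  proof (cases "F = {}")
    case True then show ?thesis unfolding T_def using oR by simp
  next
    case False
    have "openin (top_of_set S) (\<Inter>((\<lambda>x. f ` u' x) ` F))"
      using finF False opn u'o by (intro openin_INT2) auto
    then show ?thesis unfolding T_def using oR by (rule openin_Int[rotated])
  qed
  moreover have "y \<in> T"
  proof -
    have "y \<notin> f ` R" using u'x unfolding R_def F_def by blast
    moreover have "y \<in> f ` u' x" if "x \<in> F" for x using u'x[OF that] that unfolding F_def by auto
    ultimately show ?thesis unfolding T_def using y by auto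
  qed
  moreover have "\<Union>((\<lambda>x. u' x \<inter> f -` T) ` F) = C \<inter> f -` T"
  proof
    show "\<Union>((\<lambda>x. u' x \<inter> f -` T) ` F) \<subseteq> C \<inter> f -` T"
      using u'o openin_imp_subset by blast
    show "C \<inter> f -` T \<subseteq> \<Union>((\<lambda>x. u' x \<inter> f -` T) ` F)" unfolding T_def R_def by blast
  qed
  moreover have wopen: "\<forall>w\<in>(\<lambda>x. u' x \<inter> f -` T) ` F. openin (top_of_set C) w"
  proof clarify
    fix x assume x: "x \<in> F"
    have "openin (top_of_set C) (C \<inter> f -` T)"
      using continuous_openin_preimage[OF f(1) _ \<open>openin (top_of_set S) T\<close>] f(2) by blast
    then have "openin (top_of_set C) (u' x \<inter> (C \<inter> f -` T))" using u'o[OF x] by blast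
    moreover have "u' x \<inter> (C \<inter> f -` T) = u' x \<inter> f -` T" using openin_imp_subset[OF u'o[OF x]] by blast
    ultimately show "openin (top_of_set C) (u' x \<inter> f -` T)" by simp
  qed
  moreover have "pairwise disjnt ((\<lambda>x. u' x \<inter> f -` T) ` F)"
    using disj unfolding pairwise_def disjnt_def by blast
  moreover have "\<forall>w\<in>(\<lambda>x. u' x \<inter> f -` T) ` F. \<exists>q. homeomorphism w T f q"
  proof clarify
    fix x assume x: "x \<in> F"
    let ?w = "u' x \<inter> f -` T"
    have wo: "openin (top_of_set C) ?w" using wopen x by simp
    have wC: "?w \<subseteq> C" using openin_imp_subset[OF wo] .
    have im: "f ` ?w = T"
    proof
      show "f ` ?w \<subseteq> T" by blast
      have "T \<subseteq> f ` u' x" using x unfolding T_def by blast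
      then show "T \<subseteq> f ` ?w" by blast
    qed
    have inj: "inj_on f ?w" using u(3)[of x] x FC unfolding u'_def by (auto intro: inj_on_subset)
    have TS: "T \<subseteq> S" unfolding T_def by blast
    have "openin (top_of_set T) (f ` U)" if U: "openin (top_of_set ?w) U" for U
    proof -
      have "openin (top_of_set S) (f ` U)" using opn openin_trans[OF U wo] by blast
      moreover have "f ` U \<subseteq> T" using openin_imp_subset[OF U] im by blast
      ultimately show ?thesis using TS by (metis openin_subset_trans)
    qed
    then show "\<exists>q. homeomorphism ?w T f q"
      using homeomorphism_injective_open_map[OF continuous_on_subset[OF f(1) wC] im inj] by metis
  qed
  ultimately show "\<exists>T. y \<in> T \<and> openin (top_of_set S) T \<and>
           (\<exists>v. \<Union>v = C \<inter> f -` T \<and> (\<forall>u\<in>v. openin (top_of_set C) u) \<and>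
                pairwise disjnt v \<and> (\<forall>u\<in>v. \<exists>q. homeomorphism u T f q))"
    by (intro exI[of _ T] conjI exI[of _ "(\<lambda>x. u' x \<inter> f -` T) ` F"])
qed

text \<open>A simply connected base lets its identity lift to a section \<open>g\<close>. Both
  \<open>g \<circ> p\<close> and the identity of \<open>C\<close> lift \<open>p\<close> and agree at
  \<open>g (p c)\<close>, so they coincide on the connected \<open>C\<close>.\<close>

lemma covering_space_simply_connected_homeomorphism:
  fixes p :: "'a::real_normed_vector \<Rightarrow> 'b::real_normed_vector"
  assumes cov: "covering_space C p S" and C: "connected C" "C \<noteq> {}"
    and S: "simply_connected S" "locally path_connected S"
  obtains g where "homeomorphism C S p g"
proof -
  obtain g where g: "continuous_on S g" "g \<in> S \<rightarrow> C" "\<And>y. y \<in> S \<Longrightarrow> p (g y) = y"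
    using covering_space_lift[OF cov S continuous_on_id] by auto
  have p: "continuous_on C p" "p ` C = S"
    using covering_space_imp_continuous[OF cov] covering_space_imp_surjective[OF cov] .
  obtain c where c: "c \<in> C" using C(2) by blast
  have c': "g (p c) \<in> C" "p c \<in> S" using g(2) p(2) c by auto
  have "g (p x) = x" if x: "x \<in> C" for x
  proof (rule covering_space_lift_unique[OF cov, where f = p and T = C and a = "g (p c)" and ?g1.0 = "g \<circ> p" and ?g2.0 = id, unfolded o_def id_def])
    show "continuous_on C (\<lambda>x. g (p x))"
      using continuous_on_compose2[OF g(1) p(1)] p(2) by blast
  qed (use g p c c' x C in \<open>auto simp: image_subset_iff\<close>)
  moreover have "g ` S = C"
  proof
    show "g ` S \<subseteq> C" using g(2) by blast
    show "C \<subseteq> g ` S"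
    proof
      fix x assume "x \<in> C"
      then have "x = g (p x)" "p x \<in> S" using calculation p(2) by auto
      then show "x \<in> g ` S" by (rule image_eqI)
    qed
  qed
  ultimately have "homeomorphism C S p g"
    unfolding homeomorphism_def using p g(1,3) by blast
  then show ?thesis using that by blast
qed

lemma trivial_groups_iso:
  assumes "group G" "group H" "trivial_group G" "trivial_group H"
  shows "G \<cong> H"
proof -
  have "(\<lambda>_. \<one>\<^bsub>H\<^esub>) \<in> iso G H"
    using assms unfolding trivial_group_def iso_def hom_def bij_betw_def
    by (auto simp: group.is_monoid)
  then show ?thesis unfolding is_iso_def by blast
qed

text \<open>The first homology of the 2-sphere is trivial, and a free abelian group of rank 2k is
  trivial only for k = 0; the second fact makes the \<open>THE\<close> in \<open>genus\<close> well
  defined here.\<close>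

lemma genus_sphere:
  fixes p :: "real^4 \<Rightarrow> real^3"
  assumes "homeomorphism S (sphere 0 1) p g"
  shows "genus S = 0"
proof -
  have "homeomorphic_maps (top_of_set S) (top_of_set (sphere 0 1 :: (real^3) set)) p g"
    using assms unfolding homeomorphism_def homeomorphic_maps_def
    by (auto simp: continuous_map_in_subtopology)
  then have 1: "top_of_set S homeomorphic_space top_of_set (sphere 0 1 :: (real^3) set)"
    unfolding homeomorphic_space_def by blast
  obtain f h where "homeomorphic_maps (nsphere (3 - 1)) (top_of_set (sphere 0 1 \<inter> span (Basis :: (real^3) set))) f h"
  proof (rule homeomorphic_maps_nsphere_euclidean_sphere[of "Basis :: (real^3) set" 3])
    show "pairwise orthogonal (Basis :: (real^3) set)" 
      by (simp add: pairwise_def orthogonal_def inner_Basis)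
  qed (auto simp: independent_Basis)
  then have "nsphere 2 homeomorphic_space top_of_set (sphere 0 1 :: (real^3) set)"
    unfolding homeomorphic_space_def by auto
  then have "top_of_set S homeomorphic_space nsphere 2"
    using 1 homeomorphic_space_sym homeomorphic_space_trans by blast
  then have "reduced_homology_group 1 (top_of_set S) \<cong> reduced_homology_group 1 (nsphere 2)"
    by (rule homeomorphic_space_imp_isomorphic_reduced_homology_groups)
  moreover have "trivial_group (reduced_homology_group 1 (nsphere 2))"
    using trivial_reduced_homology_group_nsphere[of 1 2] by simp
  ultimately have "trivial_group (reduced_homology_group 1 (top_of_set S))"
    using isomorphic_group_triviality[OF _ group_reduced_homology_group group_reduced_homology_group] by blast
  then have triv: "trivial_group (homology_group 1 (top_of_set S))"
    using un_reduced_homology_group[of 1 "top_of_set S"] by simp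
  have gH: "group (homology_group 1 (top_of_set S))"
    using un_reduced_homology_group[of 1 "top_of_set S"] group_reduced_homology_group[of 1 "top_of_set S"] by simp
  have "carrier (free_Abelian_group ({} :: nat set)) = {0}"
    by (auto simp: free_Abelian_group_def)
  then have triv0: "trivial_group (free_Abelian_group ({} :: nat set))"
    by (simp add: group.trivial_group)
  have iff: "homology_group 1 (top_of_set S) \<cong> free_Abelian_group {..<2 * k} \<longleftrightarrow> k = 0" for k :: nat
  proof
    assume "homology_group 1 (top_of_set S) \<cong> free_Abelian_group {..<2 * k}"
    then have "trivial_group (free_Abelian_group {..<2 * k})"
      using isomorphic_group_triviality1[OF _ group_free_Abelian_group triv] by blast
    then have "free_Abelian_group {..<2 * k} \<cong> free_Abelian_group ({} :: nat set)"
      using triv0 by (intro trivial_groups_iso) auto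
    then have "{..<2 * k} \<approx> ({} :: nat set)" using isomorphic_free_Abelian_groups by blast
    then have "{..<2 * k} = {}" by simp
    then show "k = 0" by (cases k) auto
  next
    assume "k = 0"
    then show "homology_group 1 (top_of_set S) \<cong> free_Abelian_group {..<2 * k}"
      using triv triv0 gH by (auto intro!: trivial_groups_iso)
  qed
  show ?thesis unfolding genus_def iff by simp
qed

subsection \<open>The quaternionic Gauss map and the cut distance\<close>

text \<open>The imaginary part of the quaternion product of \<open>w\<close> with the conjugate of \<open>q\<close>.\<close>
definition quat_im :: "real^4 \<Rightarrow> real^4 \<Rightarrow> real^3" where
  "quat_im q w = vector
    [q$1 * w$2 - q$2 * w$1 - q$4 * w$3 + q$3 * w$4,
     q$1 * w$3 - q$3 * w$1 + q$4 * w$2 - q$2 * w$4,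
     q$1 * w$4 - q$4 * w$1 - q$3 * w$2 + q$2 * w$3]"

text \<open>The product of \<open>w\<close> with the conjugate of \<open>q\<close> has squared norm
  |q|^2 |w|^2 and real part q \<bullet> w; the imaginary part carries the rest.\<close>

lemma quat_im_norm: "quat_im q w \<bullet> quat_im q w = (q \<bullet> q) * (w \<bullet> w) - (q \<bullet> w)\<^sup>2"
  unfolding quat_im_def inner_vec_def sum_3 sum_4 vector_3
  by (simp add: power2_eq_square algebra_simps)

lemma bounded_bilinear_quat_im: "bounded_bilinear quat_im"
  unfolding bilinear_conv_bounded_bilinear[symmetric]
  unfolding bilinear_def
  by (auto intro!: linearI simp: quat_im_def vec_eq_iff forall_3 algebra_simps)

text \<open>The cone over \<open>g\<close> adds the radial direction, so that invariance of domain
  applies in dimension 3; intersecting with the unit sphere recovers the image of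
  \<open>g\<close>.\<close>

lemma openin_sphere_immersion_image:
  fixes g :: "real^2 \<Rightarrow> real^3"
  assumes B: "open B" and g: "continuous_on B g" "inj_on g B" "\<And>x. x \<in> B \<Longrightarrow> norm (g x) = 1"
  shows "openin (top_of_set (sphere 0 1)) (g ` B)"
proof -
  define G where "G p = snd p *\<^sub>R g (fst p)" for p :: "(real^2) \<times> real"
  have "continuous_on (B \<times> {0<..}) G"
    unfolding G_def by (intro continuous_intros continuous_on_compose2[OF g(1) continuous_on_fst[OF continuous_on_id]]) auto
  moreover have "inj_on G (B \<times> {0<..})"
  proof (rule inj_onI)
    fix p p' assume p: "p \<in> B \<times> {0<..}" "p' \<in> B \<times> {0<..}" and eq: "G p = G p'"
    have "snd p = norm (G p)" "snd p' = norm (G p')" using p g(3) unfolding G_def by auto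
    then have s: "snd p = snd p'" using eq by simp
    have "snd p' > 0" using p by auto
    then have "g (fst p) = g (fst p')" using eq s unfolding G_def by simp
    then have "fst p = fst p'" using inj_onD[OF g(2)] p by auto
    then show "p = p'" using s by (simp add: prod_eq_iff)
  qed
  moreover have "open (B \<times> {0::real<..})" using B by (simp add: open_Times)
  ultimately have "open (G ` (B \<times> {0<..}))" by (intro invariance_of_domain_gen) auto
  moreover have "g ` B = sphere 0 1 \<inter> G ` (B \<times> {0<..})"
  proof
    show "g ` B \<subseteq> sphere 0 1 \<inter> G ` (B \<times> {0<..})"
    proof
      fix y assume "y \<in> g ` B"
      then obtain x where x: "x \<in> B" "y = g x" by blast
      then have "y = G (x, 1)" unfolding G_def by simp
      moreover have "y \<in> sphere 0 1" using x g(3) by simp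
      ultimately show "y \<in> sphere 0 1 \<inter> G ` (B \<times> {0<..})" using x(1) by auto
    qed
    show "sphere 0 1 \<inter> G ` (B \<times> {0<..}) \<subseteq> g ` B"
    proof clarify
      fix x s assume xs: "x \<in> B" "0 < s" "G (x, s) \<in> sphere 0 1"
      then have "s = 1" using g(3)[OF xs(1)] unfolding G_def by simp
      then show "G (x, s) \<in> g ` B" using xs unfolding G_def by simp
    qed
  qed
  ultimately show ?thesis by (simp add: openin_open_Int)
qed

context unit_normal_surface
begin

text \<open>By Cayley-Hamilton the shape operator satisfies A^2 = 2 H A - (H^2 - \<lambda>^2). Since
  2 H is nonnegative, the bound of the second form by \<open>kmax\<close> may be inserted.\<close>

lemma dN_norm_le:
  assumes q: "q \<in> S" and v: "v \<in> T q" and H: "mean_curv S n q \<ge> 0"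
  shows "dN S n q v \<bullet> dN S n q v \<le> (kmax q)\<^sup>2 * (v \<bullet> v)"
proof -
  obtain e1 e2 where e: "onb q e1 e2" and H': "mean_curv S n q = (II q e1 e1 + II q e2 e2) / 2"
    "lam_curv S n q = sqrt (((II q e1 e1 + II q e2 e2) / 2)\<^sup>2 - (II q e1 e1 * II q e2 e2 - (II q e1 e2)\<^sup>2))"
    using curvatures_onb[OF q] .
  define a b c where "a = II q e1 e1" and "b = II q e1 e2" and "c = II q e2 e2"
  define h s where "h = mean_curv S n q" and "s = lam_curv S n q"
  obtain x y where v': "v = x *\<^sub>R e1 + y *\<^sub>R e2" using onb_expand[OF q e v] by blast
  have 1: "II q e1 v = a * x + b * y"
    using II_expand[OF q e, of 1 0 x y] unfolding v' a_def b_def by simp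
  have 2: "II q e2 v = b * x + c * y"
    using II_expand[OF q e, of 0 1 x y] unfolding v' b_def c_def by simp
  have vv: "v \<bullet> v = x * x + y * y" unfolding v' inner_onb[OF e] by simp
  have IIv: "II q v v = a * x\<^sup>2 + 2 * b * x * y + c * y\<^sup>2"
    unfolding v' II_expand[OF q e] a_def b_def c_def by (simp add: power2_eq_square algebra_simps)
  have disc: "((a + c) / 2)\<^sup>2 - (a * c - b\<^sup>2) = ((a - c) / 2)\<^sup>2 + b\<^sup>2"
    by (simp add: field_simps power2_eq_square)
  have "0 \<le> ((a + c) / 2)\<^sup>2 - (a * c - b\<^sup>2)" unfolding disc by simp
  then have s2: "s\<^sup>2 = h\<^sup>2 - (a * c - b\<^sup>2)" unfolding s_def h_def H' a_def b_def c_def by simp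
  have h2: "2 * h = a + c" unfolding h_def H' a_def c_def by simp
  have "dN S n q v \<bullet> dN S n q v = (a * x + b * y)\<^sup>2 + (b * x + c * y)\<^sup>2"
    unfolding dN_onb[OF q e v] inner_onb[OF e] 1 2 by (simp add: power2_eq_square algebra_simps)
  also have "\<dots> = (a + c) * II q v v - (a * c - b\<^sup>2) * (v \<bullet> v)"
    unfolding IIv vv by (simp add: power2_eq_square algebra_simps)
  also have "\<dots> = 2 * h * II q v v - (h\<^sup>2 - s\<^sup>2) * (v \<bullet> v)"
    unfolding h2[symmetric] s2 by simp
  also have "\<dots> \<le> 2 * h * ((h + s) * (v \<bullet> v)) - (h\<^sup>2 - s\<^sup>2) * (v \<bullet> v)"
    using II_le_kmax[OF q v] H unfolding kmax_def h_def s_def by (simp add: mult_left_mono)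
  also have "\<dots> = (kmax q)\<^sup>2 * (v \<bullet> v)"
    unfolding kmax_def h_def s_def by (simp add: power2_eq_square algebra_simps)
  finally show ?thesis .
qed

text \<open>Since \<open>|dN v| < |v|\<close>, the map \<open>q \<mapsto> n(q) q\<^sup>-\<^sup>1\<close> is an immersion into the unit sphere of the
  imaginary quaternions: its derivative at \<open>v\<close> is \<open>quat_im v n + quat_im q (dN v)\<close>, whose two summands
  have norms \<open>|v|\<close> and \<open>|dN v|\<close>.\<close>
lemma quat_gauss_local_homeomorphism:
  assumes q0: "q0 \<in> S" and H: "\<And>q. q \<in> S \<Longrightarrow> mean_curv S n q \<ge> 0" and k: "kmax q0 < 1"
  defines "f \<equiv> \<lambda>q. quat_im q (n q)"
  shows "\<exists>u. q0 \<in> u \<and> openin (top_of_set S) u \<and> inj_on f u \<and>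
    (\<forall>w. w \<subseteq> u \<longrightarrow> openin (top_of_set S) w \<longrightarrow> openin (top_of_set (sphere 0 1)) (f ` w))"
proof -
  interpret Q: bounded_bilinear quat_im by (rule bounded_bilinear_quat_im)
  obtain V \<phi> a where c: "chart S V \<phi>" "a \<in> V" "\<phi> a = q0" using obtain_chart[OF q0] .
  note C = chartD[OF c(1)]
  define f' where "f' x u = quat_im (\<phi> x) (pd (n \<circ> \<phi>) u x) + quat_im (pd \<phi> u x) (n (\<phi> x))" for x u
  have fd: "(f \<circ> \<phi> has_derivative f' x) (at x)" if "x \<in> V" for x
    using Q.FDERIV[OF smooth_on_has_derivative[OF C(2) that] smooth_on_has_derivative[OF C(8) that]]
    unfolding f_def f'_def o_def by simp
  have f'c: "continuous_on V (\<lambda>x. f' x u)" for u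
    unfolding f'_def
    by (intro continuous_on_add Q.continuous_on smooth_on_continuous[OF C(2)] smooth_on_continuous[OF smooth_on_pd[OF C(8)]]
        smooth_on_continuous[OF smooth_on_pd[OF C(2)]] smooth_on_continuous[OF C(8), unfolded o_def])
  have "inj (f' a)"
  proof -
    have lin: "linear (f' a)" using has_derivative_linear[OF fd[OF c(2)]] .
    have "u = 0" if u: "f' a u = 0" for u
    proof -
      let ?v = "pd \<phi> u a"
      have v: "?v \<in> T q0" using range_pd_eq_T[OF c(1,2)] c(3) by blast
      have dn: "pd (n \<circ> \<phi>) u a = dN S n q0 ?v" using dN_pd[OF c(1,2), of u] c(3) by simp
      have "quat_im q0 (dN S n q0 ?v) = - quat_im ?v (n q0)"
        using u c(3) unfolding f'_def dn by (simp add: eq_neg_iff_add_eq_0)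
      then have "quat_im q0 (dN S n q0 ?v) \<bullet> quat_im q0 (dN S n q0 ?v) = quat_im ?v (n q0) \<bullet> quat_im ?v (n q0)"
        by simp
      then have eq: "dN S n q0 ?v \<bullet> dN S n q0 ?v = ?v \<bullet> ?v"
        using v dN_mem_T[OF q0 v] inner_self_S[OF q0] unfolding quat_im_norm T_def by (simp add: inner_commute)
      have "kmax q0 \<ge> 0" unfolding kmax_def using H[OF q0] lam_curv_nonneg[OF q0] by simp
      then have "(kmax q0)\<^sup>2 < 1" using k by (simp add: abs_square_less_1)
      moreover have "(1 - (kmax q0)\<^sup>2) * (?v \<bullet> ?v) \<le> 0"
        using dN_norm_le[OF q0 v H[OF q0]] eq by (simp add: algebra_simps)
      ultimately have "?v \<bullet> ?v \<le> 0" by (simp add: mult_le_0_iff)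
      then have "?v = 0" using inner_gt_zero_iff[of ?v] by linarith
      then show "u = 0" using C(7)[OF c(2)] linear_injective_0[OF linear_pd[OF C(2) c(2)]] by blast
    qed
    then show ?thesis using linear_injective_0[OF lin] by blast
  qed
  then obtain r where r: "r > 0" "ball a r \<subseteq> V" "inj_on (f \<circ> \<phi>) (ball a r)"
    using immersion_locally_injective[OF C(1) c(2) fd f'c] by blast
  have cf: "continuous_on V (f \<circ> \<phi>)"
    by (rule has_derivative_continuous_on, rule has_derivative_at_withinI, rule fd)
  define u where "u = \<phi> ` ball a r"
  have uo: "openin (top_of_set S) u" unfolding u_def by (rule openin_chart_image[OF c(1) open_ball r(2)])
  have fn: "norm (f q) = 1" if "q \<in> S" for q
    unfolding f_def norm_eq_sqrt_inner quat_im_norm using inner_self_S[OF that] n_orth[OF that]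
    by (simp add: inner_commute)
  have "openin (top_of_set (sphere 0 1)) (f ` w)" if w: "w \<subseteq> u" "openin (top_of_set S) w" for w
  proof -
    obtain W where W: "open W" "w = S \<inter> W" using w(2) by (auto simp: openin_open)
    define B where "B = ball a r \<inter> (V \<inter> \<phi> -` W)"
    have "open B" unfolding B_def
      using continuous_open_preimage[OF smooth_on_continuous[OF C(2)] C(1) W(1)] by blast
    moreover have "continuous_on B (f \<circ> \<phi>)" by (rule continuous_on_subset[OF cf]) (auto simp: B_def)
    moreover have "inj_on (f \<circ> \<phi>) B" by (rule inj_on_subset[OF r(3)]) (auto simp: B_def)
    moreover have "norm ((f \<circ> \<phi>) x) = 1" if "x \<in> B" for x using that fn C(4) unfolding B_def by auto
    ultimately have "openin (top_of_set (sphere 0 1)) ((f \<circ> \<phi>) ` B)" by (rule openin_sphere_immersion_image)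
    moreover have "\<phi> ` B = w"
    proof
      show "\<phi> ` B \<subseteq> w" using W(2) C(4) unfolding B_def by auto
      show "w \<subseteq> \<phi> ` B"
      proof
        fix y assume y: "y \<in> w"
        then obtain x where "x \<in> ball a r" "y = \<phi> x" using w(1) unfolding u_def by blast
        moreover have "y \<in> W" using y W(2) by blast
        ultimately show "y \<in> \<phi> ` B" using r(2) unfolding B_def by auto
      qed
    qed
    ultimately show ?thesis unfolding image_comp[symmetric] by simp
  qed
  moreover have "inj_on f u" using r(3) unfolding u_def by (rule inj_on_imageI)
  moreover have "q0 \<in> u" unfolding u_def using c(3) r(1) by auto
  ultimately show ?thesis using uo by blast
qed

end

lemma (in compact_normal_surface) genus_zero_if_kmax_less_1:
  assumes conn: "connected S" and H: "\<And>q. q \<in> S \<Longrightarrow> mean_curv S n q \<ge> 0"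
    and k: "\<And>q. q \<in> S \<Longrightarrow> kmax q < 1"
  shows "genus S = 0"
proof -
  define f where "f q = quat_im q (n q)" for q
  interpret Q: bounded_bilinear quat_im by (rule bounded_bilinear_quat_im)
  have "continuous_on S f" unfolding f_def by (intro Q.continuous_on continuous_on_id n_continuous)
  moreover have "f ` S \<subseteq> sphere 0 1"
    using inner_self_S n_orth unfolding f_def by (auto simp: norm_eq_sqrt_inner quat_im_norm inner_commute)
  moreover have "connected (sphere (0::real^3) 1)" by (intro connected_sphere) simp
  ultimately have "covering_space S f (sphere 0 1)"
    using compact_local_homeomorphism_covering[OF cpt ne, of "sphere 0 1" f]
      quat_gauss_local_homeomorphism[OF _ H k] unfolding f_def by blast
  moreover have "simply_connected (sphere (0::real^3) 1)" by (intro simply_connected_sphere) simp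
  moreover have "locally path_connected (sphere (0::real^3) 1)" by (rule locally_path_connected_sphere)
  ultimately show ?thesis
    using covering_space_simply_connected_homeomorphism[OF _ conn ne] genus_sphere by metis
qed

section \<open>Cut distance and touching balls\<close>

context compact_normal_surface
begin

lemma dist_S3_bounds:
  assumes "norm y = 1" "z \<in> S"
  shows "0 \<le> dist_S3 y z" "dist_S3 y z \<le> pi" "cos (dist_S3 y z) = y \<bullet> z"
proof -
  have "\<bar>y \<bullet> z\<bar> \<le> 1" using Cauchy_Schwarz_ineq2[of y z] norm_S[OF assms(2)] assms(1) by simp
  then show "0 \<le> dist_S3 y z" "dist_S3 y z \<le> pi" "cos (dist_S3 y z) = y \<bullet> z"
    unfolding dist_S3_def by (auto intro: arccos_lbound arccos_ubound simp: abs_le_iff)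
qed

lemma setdist_S3_le:
  assumes "norm y = 1" "z \<in> S"
  shows "setdist_S3 y S \<le> dist_S3 y z"
  unfolding setdist_S3_def
  by (rule cInf_lower) (use assms dist_S3_bounds(1)[OF assms(1)] in \<open>auto intro!: bdd_belowI2[of _ 0]\<close>)

text \<open>An admissible \<open>d\<close> is the radius of a ball touching at \<open>q\<close>, so
  \<open>touching_second_order\<close> bounds the second form by cot d. The end values are separate:
  at 0 the claim is positivity of \<open>arccot\<close>, at \<pi> the test reads 0 \<le> - (v
  \<bullet> v).\<close>

lemma cut_dist_member:
  assumes q: "q \<in> S" and d: "0 \<le> d" "setdist_S3 (exp_S3 q (d *\<^sub>R n q)) S = d"
  shows "d \<le> arccot (kmax q)"
proof -
  have nE: "norm (E q d) = 1" by (rule norm_E[OF q])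
  have le: "d \<le> dist_S3 (E q d) z" if "z \<in> S" for z
    using setdist_S3_le[OF nE that] d(2) unfolding exp_S3_eq_E[OF q] by simp
  have dpi: "d \<le> pi" using le[OF q] dist_S3_bounds(2)[OF nE q] by simp
  have max: "cos d * (z \<bullet> q) + sin d * (z \<bullet> n q) \<le> cos d" if "z \<in> S" for z
  proof -
    have "cos (dist_S3 (E q d) z) \<le> cos d"
      using le[OF that] dist_S3_bounds[OF nE that] d(1) by (intro cos_monotone_0_pi_le) auto
    then show ?thesis using dist_S3_bounds(3)[OF nE that] inner_E[of z q d] by (simp add: inner_commute)
  qed
  have II: "sin d * II q v v \<le> cos d * (v \<bullet> v)" if "v \<in> T q" for v
    by (rule touching_second_order[OF q max that])
  consider "d = 0" | "d = pi" | "0 < d" "d < pi" using d(1) dpi by linarith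
  then show ?thesis
  proof cases
    case 1 then show ?thesis using arccot_bounds(1)[of "kmax q"] by simp
  next
    case 2
    obtain v where "v \<in> T q" "v \<noteq> 0" using exists_tangent_nonzero[OF q] .
    then show ?thesis using II[of v] inner_gt_zero_iff[of v] unfolding 2 by (simp add: not_less[symmetric])
  next
    case 3
    then have s: "sin d > 0" by (intro sin_gt_zero)
    have "II q v v \<le> cos d / sin d * (v \<bullet> v)" if "v \<in> T q" for v
      using II[OF that] s by (simp add: field_simps)
    then have "kmax q \<le> cos d / sin d" by (rule kmax_le[OF q])
    also have "\<dots> = tan (pi / 2 - d)" by (simp add: tan_def cos_diff sin_diff)
    finally have "arctan (kmax q) \<le> pi / 2 - d"
      using 3 arctan_monotone'[of "kmax q" "tan (pi / 2 - d)"] arctan_tan[of "pi / 2 - d"] by simp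
    then show ?thesis unfolding arccot_def by simp
  qed
qed

lemma cut_dist_le:
  assumes q: "q \<in> S"
  shows "cut_dist S n q \<le> arccot (kmax q)"
  unfolding cut_dist_def
proof (rule cSup_least)
  \<comment> \<open>The value 0 is admissible, so the supremum runs over a nonempty set.\<close>
  have "setdist_S3 q S = 0"
  proof (rule antisym)
    show "setdist_S3 q S \<le> 0"
      using setdist_S3_le[OF norm_S[OF q] q] inner_self_S[OF q] unfolding dist_S3_def by simp
    show "0 \<le> setdist_S3 q S" unfolding setdist_S3_def
      by (rule cInf_greatest) (use ne dist_S3_bounds(1)[OF norm_S[OF q]] in auto)
  qed
  then show "{d. 0 \<le> d \<and> setdist_S3 (exp_S3 q (d *\<^sub>R n q)) S = d} \<noteq> {}"
    unfolding exp_S3_eq_E[OF q] by (auto intro!: exI[of _ 0])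
qed (use cut_dist_member[OF q] in auto)

text \<open>The hypothesis makes \<open>arccot \<kappa>\<close> itself an admissible distance;
  \<open>cut_dist_member\<close> supplies the upper bound that gives \<open>Sup\<close> its
  meaning.\<close>

lemma cut_dist_ge:
  assumes q: "q \<in> S" and le: "\<And>x. x \<in> S \<Longrightarrow> x \<bullet> n q \<le> \<kappa> * (1 - x \<bullet> q)"
  shows "arccot \<kappa> \<le> cut_dist S n q"
  unfolding cut_dist_def
proof (rule cSup_upper)
  let ?d = "arccot \<kappa>"
  have nE: "norm (E q ?d) = 1" by (rule norm_E[OF q])
  note d = arccot_bounds[of \<kappa>]
  have "E q ?d \<bullet> q = cos ?d" using E_inner_E[OF q, of ?d 0] by simp
  then have self: "dist_S3 (E q ?d) q = ?d" unfolding dist_S3_def using d by (simp add: arccos_cos)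
  have "setdist_S3 (E q ?d) S = ?d"
  proof (rule antisym)
    show "setdist_S3 (E q ?d) S \<le> ?d" using setdist_S3_le[OF nE q] self by simp
    show "?d \<le> setdist_S3 (E q ?d) S" unfolding setdist_S3_def
    proof (rule cInf_greatest)
      fix t assume "t \<in> dist_S3 (E q ?d) ` S"
      then obtain z where z: "z \<in> S" "t = dist_S3 (E q ?d) z" by blast
      have "\<kappa> * (z \<bullet> q) + z \<bullet> n q \<le> \<kappa>" using le[OF z(1)] by (simp add: algebra_simps)
      then have "sin ?d * (\<kappa> * (z \<bullet> q) + z \<bullet> n q) \<le> sin ?d * \<kappa>"
        using sin_arccot(1)[of \<kappa>] by (intro mult_left_mono) auto
      then have "cos (dist_S3 (E q ?d) z) \<le> cos ?d"
        unfolding dist_S3_bounds(3)[OF nE z(1)] using inner_E[of z q ?d]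
        unfolding cos_arccot by (simp add: inner_commute algebra_simps)
      then show "?d \<le> t" unfolding z(2)
        using dist_S3_bounds(1,2)[OF nE z(1)] d by (simp add: cos_mono_le_eq)
    qed (use ne in auto)
  qed
  then show "?d \<in> {d. 0 \<le> d \<and> setdist_S3 (exp_S3 q (d *\<^sub>R n q)) S = d}"
    unfolding exp_S3_eq_E[OF q] using d by simp
  show "bdd_above {d. 0 \<le> d \<and> setdist_S3 (exp_S3 q (d *\<^sub>R n q)) S = d}"
    using cut_dist_member[OF q] by (intro bdd_aboveI[of _ "arccot (kmax q)"]) auto
qed

end

text \<open>One inequality is the global touching bound; the other uses only the local estimate
  \<open>cut_dist_le\<close>. It passes through kmax q \<le> tan (pi / 2 - r) for all
  \<open>q\<close>, which avoids attainment of the supremum.\<close>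

lemma (in dividing_surface) Inf_cut_dist:
  assumes H: "\<And>q. q \<in> S \<Longrightarrow> mean_curv S n q \<ge> 0"
  shows "Inf (cut_dist S n ` S) = arccot (Sup (kmax ` S))"
proof (rule antisym)
  have ge: "arccot (Sup (kmax ` S)) \<le> cut_dist S n q" if "q \<in> S" for q
    using cut_dist_ge[OF that] touching_bound_Sup[OF H that] by blast
  then show 1: "arccot (Sup (kmax ` S)) \<le> Inf (cut_dist S n ` S)"
    using ne by (intro cInf_greatest) auto
  define r where "r = Inf (cut_dist S n ` S)"
  have rle: "r \<le> arccot (kmax q)" if "q \<in> S" for q
  proof -
    have "r \<le> cut_dist S n q" unfolding r_def
      by (rule cInf_lower) (use that ge in \<open>auto intro!: bdd_belowI2\<close>)
    then show ?thesis using cut_dist_le[OF that] by simp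
  qed
  obtain q where q: "q \<in> S" using ne by blast
  \<comment> \<open>Keeps pi / 2 - r strictly between - pi / 2 and pi / 2, where
    \<open>arctan\<close> undoes \<open>tan\<close>.\<close>
  have r: "0 < r" "r < pi"
    using 1 arccot_bounds(1)[of "Sup (kmax ` S)"] rle[OF q] arccot_bounds(2)[of "kmax q"]
    unfolding r_def by linarith+
  have "kmax q \<le> tan (pi / 2 - r)" if "q \<in> S" for q
  proof -
    have "arctan (kmax q) \<le> pi / 2 - r" using rle[OF that] unfolding arccot_def by simp
    then have "arctan (kmax q) \<le> arctan (tan (pi / 2 - r))" using r by (simp add: arctan_tan)
    then show ?thesis by (simp add: arctan_le_iff)
  qed
  then have "Sup (kmax ` S) \<le> tan (pi / 2 - r)" using ne by (intro cSup_least) auto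
  then have "arctan (Sup (kmax ` S)) \<le> arctan (tan (pi / 2 - r))" by (simp add: arctan_le_iff)
  then show "Inf (cut_dist S n ` S) \<le> arccot (Sup (kmax ` S))"
    using r unfolding r_def[symmetric] arccot_def by (simp add: arctan_tan)
qed

theorem theorem3p3:
  fixes \<Sigma> \<Omega>1 \<Omega>2 :: "(real^4) set" and n :: "real^4 \<Rightarrow> real^4"
  assumes surf: "embedded_surface_S3 \<Sigma>"
    and cpt: "compact \<Sigma>" and conn: "connected \<Sigma>" and ne: "\<Sigma> \<noteq> {}"
    and divide: "components (sphere 0 1 - \<Sigma>) = {\<Omega>1, \<Omega>2}" and "\<Omega>1 \<noteq> \<Omega>2"
    and n_smooth: "smooth_map_on_surface \<Sigma> n"
    and n_unit: "\<forall>q\<in>\<Sigma>. norm (n q) = 1"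
    and n_tan_S3: "\<forall>q\<in>\<Sigma>. n q \<bullet> q = 0"
    and n_normal: "\<forall>q\<in>\<Sigma>. \<forall>v\<in>tangent_space \<Sigma> q. n q \<bullet> v = 0"
    and n_inward: "\<forall>q\<in>\<Sigma>. \<exists>e>0. \<forall>t. 0 < t \<and> t < e \<longrightarrow> exp_S3 q (t *\<^sub>R n q) \<in> \<Omega>1"
    and mean_convex: "\<forall>q\<in>\<Sigma>. mean_curv \<Sigma> n q \<ge> 0"
  shows "Inf (cut_dist \<Sigma> n ` \<Sigma>) = arccot (Sup ((\<lambda>q. mean_curv \<Sigma> n q + lam_curv \<Sigma> n q) ` \<Sigma>))
         \<and> Inf (cut_dist \<Sigma> n ` \<Sigma>) \<le> pi / 2
         \<and> (genus \<Sigma> \<ge> 1 \<longrightarrow> Inf (cut_dist \<Sigma> n ` \<Sigma>) \<le> pi / 4)"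
proof -
  interpret dividing_surface \<Sigma> n \<Omega>1 \<Omega>2
    by unfold_locales (use assms in auto)
  have H: "mean_curv \<Sigma> n q \<ge> 0" if "q \<in> \<Sigma>" for q using mean_convex that by blast
  let ?k = "Sup (kmax ` \<Sigma>)"
  have eq: "Inf (cut_dist \<Sigma> n ` \<Sigma>) = arccot ?k" by (rule Inf_cut_dist[OF H])
  have kle: "kmax q \<le> ?k" if "q \<in> \<Sigma>" for q using cSup_upper[OF _ kmax_bdd_above] that by blast
  obtain q where q: "q \<in> \<Sigma>" using ne by blast
  have "0 \<le> kmax q" unfolding kmax_def using H[OF q] lam_curv_nonneg[OF q] by simp
  then have "?k \<ge> 0" using kle[OF q] by simp
  then have half: "arccot ?k \<le> pi / 2" unfolding arccot_def by simp
  have quarter: "arccot ?k \<le> pi / 4" if g: "genus \<Sigma> \<ge> 1"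
  proof (rule ccontr)
    assume "\<not> arccot ?k \<le> pi / 4"
    \<comment> \<open>The constant pi / 4 is \<open>arccot 1\<close>, and 1 is the curvature bound
      under which the quaternionic Gauss map is an immersion.\<close>
    then have "arctan ?k < arctan 1" unfolding arccot_def arctan_one by simp
    then have "?k < 1" unfolding arctan_less_iff .
    then have "kmax q < 1" if "q \<in> \<Sigma>" for q using kle[OF that] by simp
    from genus_zero_if_kmax_less_1[OF conn H this] g show False by simp
  qed
  have "(\<lambda>q. mean_curv \<Sigma> n q + lam_curv \<Sigma> n q) = kmax" unfolding kmax_def by simp
  then show ?thesis using eq half quarter by presburger
qed

end
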